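(* Let $K_1, K_2, \dots, K_N$ be fields with $\mathbb{Q} \subseteq K_n \subseteq \overline{\mathbb{Q}}$ for each $n = 1, 2, \dots, N$, such that for each pair of integers $n_1 \neq n_2$ in $\{1,\dots,N\}$, either $K_{n_1}/(K_{n_1} \cap K_{n_2})$ is a (possibly infinite) Galois extension, or $K_{n_2}/(K_{n_1} \cap K_{n_2})$ is a (possibly infinite) Galois extension. Let $\alpha \in \overline{\mathbb{Q}}^{\times}$. Assume that for every $\varepsilon > 0$ there exist an integer $m \neq 0$ and points $\beta_n \in K_n^{\times}$, for $n = 1, 2, \dots, N$, such that $$h\bigl(\alpha^m \beta_1^{-1}\beta_2^{-1}\cdots\beta_N^{-1}\bigr) < \varepsilon |m|.$$ Then there exists an integer $q \neq 0$ such that $\alpha^q \in K_1^{\times}K_2^{\times}\cdots K_N^{\times}$.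
   Context: $\overline{\mathbb{Q}}$ is a fixed algebraic closure of $\mathbb{Q}$ and $h : \overline{\mathbb{Q}}^{\times} \to [0,\infty)$ is the absolute logarithmic Weil height. The group $K_1^{\times}K_2^{\times}\cdots K_N^{\times}$ is the subgroup of $\overline{\mathbb{Q}}^{\times}$ consisting of all products $\beta_1\beta_2\cdots\beta_N$ with $\beta_n \in K_n^{\times}$. *)

theory Defs
  imports
    "HOL-Analysis.Infinite_Sum"
    "HOL-Computational_Algebra.Fundamental_Theorem_Algebra"
    "HOL-Algebra.Algebraic_Closure_Type"
    "HOL-Algebra.Ideal_Product"
    "HOL-Algebra.Generated_Fields"
begin

text \<open>
  The algebraic closure of the rationals is realised as the set of algebraic complex numbers,
  and its subfields as subsets of \<open>complex\<close>.
\<close>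

definition Qbar :: "complex set" where
  "Qbar = {z. algebraic z}"

abbreviation complex_field :: "complex ring" where
  "complex_field \<equiv> ring_of_type_algebra"

abbreviation subring_of_complex :: "complex set \<Rightarrow> complex ring" where
  "subring_of_complex S \<equiv> complex_field\<lparr>carrier := S\<rparr>"


section \<open>Galois extensions of subfields of the complex numbers\<close>

definition polys_over :: "complex set \<Rightarrow> complex poly set" where
  "polys_over F = {p. \<forall>i. poly.coeff p i \<in> F}"

definition irreducible_over :: "complex set \<Rightarrow> complex poly \<Rightarrow> bool" where
  "irreducible_over F p \<longleftrightarrow>
     p \<in> polys_over F \<and> Polynomial.degree p > 0 \<and>
     (\<forall>q\<in>polys_over F. \<forall>r\<in>polys_over F. p = q * r \<longrightarrow>
        Polynomial.degree q = 0 \<or> Polynomial.degree r = 0)"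

definition splits_in :: "complex set \<Rightarrow> complex poly \<Rightarrow> bool" where
  "splits_in L p \<longleftrightarrow>
     (\<exists>c\<in>L. \<exists>A. set_mset A \<subseteq> L \<and> p = smult c (\<Prod>a\<in>#A. [:- a, 1:]))"

definition algebraic_extension :: "complex set \<Rightarrow> complex set \<Rightarrow> bool" where
  "algebraic_extension F L \<longleftrightarrow> (\<forall>x\<in>L. \<exists>p\<in>polys_over F. p \<noteq> 0 \<and> poly p x = 0)"

definition normal_extension :: "complex set \<Rightarrow> complex set \<Rightarrow> bool" where
  "normal_extension F L \<longleftrightarrow>
     algebraic_extension F L \<and>
     (\<forall>p. irreducible_over F p \<longrightarrow> (\<exists>x\<in>L. poly p x = 0) \<longrightarrow> splits_in L p)"

text \<open>
  Since \<open>complex\<close> is algebraically closed, \<open>rsquarefree\<close> says that the polynomial has no multiple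
  root in a splitting field.
\<close>

definition separable_extension :: "complex set \<Rightarrow> complex set \<Rightarrow> bool" where
  "separable_extension F L \<longleftrightarrow>
     algebraic_extension F L \<and>
     (\<forall>p. irreducible_over F p \<longrightarrow> (\<exists>x\<in>L. poly p x = 0) \<longrightarrow> rsquarefree p)"

definition galois_extension :: "complex set \<Rightarrow> complex set \<Rightarrow> bool" where
  "galois_extension F L \<longleftrightarrow>
     subfield F complex_field \<and> subfield L complex_field \<and> F \<subseteq> L \<and>
     normal_extension F L \<and> separable_extension F L"


section \<open>The absolute logarithmic Weil height\<close>

definition ring_of_integers :: "complex set \<Rightarrow> complex ring" where
  "ring_of_integers K = subring_of_complex {x \<in> K. algebraic_int x}"

text \<open>
  The archimedean places of a number field \<open>K\<close> are given by its embeddings into \<open>complex\<close>, the two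
  embeddings of a conjugate pair giving the same place, of local degree 2. So summing over
  embeddings counts each archimedean place with its local degree. Embeddings are made
  extensional, so that each is represented by one function.
\<close>

definition embeddings :: "complex set \<Rightarrow> (complex \<Rightarrow> complex) set" where
  "embeddings K = ring_hom (subring_of_complex K) complex_field \<inter> extensional K"

definition finite_places :: "complex set \<Rightarrow> complex set set" where
  "finite_places K = {P. primeideal P (ring_of_integers K) \<and> P \<noteq> {0}}"

definition ideal_norm :: "complex set \<Rightarrow> complex set \<Rightarrow> nat" where
  "ideal_norm K P = card (carrier (ring_of_integers K Quot P))"

definition ord_integral :: "complex set \<Rightarrow> complex set \<Rightarrow> complex \<Rightarrow> nat" where
  "ord_integral K P x =
     (GREATEST n. x \<in> P [^]\<^bsub>ideals_set (ring_of_integers K)\<^esub> (n::nat))"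

definition ord_at :: "complex set \<Rightarrow> complex set \<Rightarrow> complex \<Rightarrow> int" where
  "ord_at K P x =
     (THE k. \<exists>a\<in>carrier (ring_of_integers K) - {0}. \<exists>b\<in>carrier (ring_of_integers K) - {0}.
        x = a / b \<and> k = int (ord_integral K P a) - int (ord_integral K P b))"

text \<open>
  With \<open>p\<close> the rational prime in \<open>P\<close>, this is the \<open>[K\<^sub>P : \<rat>\<^sub>p]\<close>-th power of the absolute
  value of \<open>K\<close> at \<open>P\<close> that extends the usual \<open>p\<close>-adic one.
\<close>

definition abs_at :: "complex set \<Rightarrow> complex set \<Rightarrow> complex \<Rightarrow> real" where
  "abs_at K P x = (if x = 0 then 0 else real (ideal_norm K P) powi (- ord_at K P x))"

definition log_plus :: "real \<Rightarrow> real" where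
  "log_plus t = ln (max 1 t)"

text \<open>
  The sum of \<open>([K\<^sub>v : \<rat>\<^sub>v] / [K : \<rat>]) log\<^sup>+ \<bar>x\<bar>\<^sub>v\<close> over all places \<open>v\<close> of the number field \<open>K\<close>.
  Only finitely many of the terms at finite places are nonzero.
\<close>

definition height_in :: "complex set \<Rightarrow> complex \<Rightarrow> real" where
  "height_in K x =
     ((\<Sum>\<sigma>\<in>embeddings K. log_plus (norm (\<sigma> x))) +
      (\<Sum>\<^sub>\<infinity>P\<in>finite_places K. log_plus (abs_at K P x)))
     / real (ring.dim complex_field \<rat> K)"

text \<open>The value does not depend on the number field containing \<open>x\<close>; the field used is \<open>\<rat>(x)\<close>.\<close>

definition weil_height :: "complex \<Rightarrow> real" where
  "weil_height x = height_in (generate_field complex_field {x}) x"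


section \<open>The product of the multiplicative groups\<close>

definition units_product :: "(nat \<Rightarrow> complex set) \<Rightarrow> nat \<Rightarrow> complex set" where
  "units_product K N = {(\<Prod>n=1..N. \<beta> n) | \<beta>. \<forall>n\<in>{1..N}. \<beta> n \<in> K n - {0}}"

end

theory Submission
  imports Defs "Jordan_Normal_Form.Char_Poly"
begin

text \<open>
  Let the twist of an algebraic number \<open>x\<close> at a field \<open>F\<close> be \<open>x ^ n\<close> divided by the product of the \<open>n\<close> conjugates of \<open>x\<close> over \<open>F\<close>. It kills the elements of
  \<open>F\<close> and multiplies heights by at most a constant, and by the Galois hypothesis it maps
  each of the other fields to itself, so that composing the twists at \<open>K\<^sub>1, \<dots>, K\<^sub>N\<close> kills every \<open>\<beta>\<^sub>n\<close>.
  Applied to \<open>\<alpha>\<close> it gives an element \<open>z = \<alpha>\<^sup>D \<kappa>\<^sub>1 \<cdots> \<kappa>\<^sub>N\<close> with \<open>\<kappa>\<^sub>n \<in> K\<^sub>n\<close>, and the approximations force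
  the height of \<open>z\<close> to be zero. By Kronecker's theorem \<open>z\<close> is a root of unity.

  The only fact about the finite places that is needed is the upper bound for the leading coefficient
  of the primitive minimal polynomial by their contribution to the height; this turns the height into
  a statement about conjugates and algebraic integers.
\<close>

subsection \<open>Algebraic integers\<close>

text \<open>The fields \<open>K i\<close> may be infinite over the rationals, and the points \<beta>
  change with \<epsilon>. Computations take place in a finite Galois field \<open>L\<close> that
  depends on \<epsilon>, while the element z must not. This forces two versions of the twist.
  \<open>twist\<close> sees only the conjugates over \<open>F\<close> and defines z from \<alpha>
  and the \<open>K i\<close> alone, but its exponent varies with x, so it is not multiplicative.
  \<open>gtwist\<close> uses the group of \<open>L\<close> over \<open>F \<inter> L\<close>, is
  multiplicative, and can be applied to the approximations. On \<alpha> the iterated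
  \<open>gtwist\<close> equals \<open>z ^ E\<close>, and the product \<open>C\<close> of the group
  orders is \<open>E * D\<close>. It multiplies heights by at most \<open>2 ^ N * C\<close>; the
  \<open>E\<close>-th root leaves the factor \<open>2 ^ N * D\<close>, which is free of
  \<open>L\<close>. The finite places enter by counting: a lattice containing high powers of x is
  covered by few cosets of the ring of integers, their number being bounded by a power of the norm
  of the denominator of x, whereas the leading coefficient of the minimal polynomial forces many
  classes. This avoids the factorization of ideals.\<close>

inductive_set zspan :: "complex set \<Rightarrow> complex set" for B where
  base: "b \<in> B \<Longrightarrow> b \<in> zspan B"
| zero: "0 \<in> zspan B"
| diff: "x \<in> zspan B \<Longrightarrow> y \<in> zspan B \<Longrightarrow> x - y \<in> zspan B"

lemma zspan_uminus: "x \<in> zspan B \<Longrightarrow> - x \<in> zspan B"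
  using zspan.diff[OF zspan.zero, of x B] by simp

lemma zspan_add: "x \<in> zspan B \<Longrightarrow> y \<in> zspan B \<Longrightarrow> x + y \<in> zspan B"
  using zspan.diff[OF _ zspan_uminus, of x B y] by simp

lemma zspan_int_mult: "x \<in> zspan B \<Longrightarrow> of_int n * x \<in> zspan B"
proof (induction n rule: int_induct[of _ 0])
  case base then show ?case by (simp add: zspan.zero)
next
  case (step1 i) then show ?case by (simp add: ring_distribs zspan_add)
next
  case (step2 i) then show ?case by (simp add: ring_distribs zspan.diff)
qed

lemma zspan_sum: "(\<And>i. i \<in> I \<Longrightarrow> f i \<in> zspan B) \<Longrightarrow> sum f I \<in> zspan B"
  by (induction I rule: infinite_finite_induct) (auto intro: zspan_add zspan.zero)

lemma zspan_coeffs: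
  assumes "finite B" "x \<in> zspan B"
  shows "\<exists>c :: complex \<Rightarrow> int. x = (\<Sum>b\<in>B. of_int (c b) * b)"
  using assms(2)
proof induction
  case (base b)
  then show ?case using assms(1)
    by (intro exI[of _ "\<lambda>b'. if b' = b then 1 else 0"])
       (simp add: if_distrib[of of_int] if_distrib[of "\<lambda>x. x * _"] cong: if_cong)
next
  case zero
  then show ?case by (intro exI[of _ "\<lambda>_. 0"]) simp
next
  case (diff x y)
  then obtain c d :: "complex \<Rightarrow> int" where "x = (\<Sum>b\<in>B. of_int (c b) * b)" "y = (\<Sum>b\<in>B. of_int (d b) * b)"
    by blast
  then show ?case
    by (intro exI[of _ "\<lambda>b. c b - d b"]) (simp add: sum_subtractf ring_distribs)
qed

lemma zspan_mult:
  assumes "y \<in> zspan B" "\<And>b. b \<in> B \<Longrightarrow> x * b \<in> zspan C"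
  shows "x * y \<in> zspan C"
  using assms(1) by induction (auto simp: assms(2) zspan.zero ring_distribs intro: zspan.diff)

text \<open>The generators form an eigenvector of an integer matrix, with eigenvalue \<open>x\<close>.\<close>

lemma algebraic_int_of_stable_module:
  assumes "finite B" "b0 \<in> B" "b0 \<noteq> 0" and stable: "\<And>b. b \<in> B \<Longrightarrow> x * b \<in> zspan B"
  shows "algebraic_int x"
proof -
  have "\<exists>c. \<forall>b\<in>B. x * b = (\<Sum>b'\<in>B. of_int (c b b') * b')"
    using zspan_coeffs[OF assms(1) stable] by (intro bchoice) auto
  then obtain c :: "complex \<Rightarrow> complex \<Rightarrow> int"
    where c: "\<And>b. b \<in> B \<Longrightarrow> x * b = (\<Sum>b'\<in>B. of_int (c b b') * b')" by blast
  obtain bs where bs: "distinct bs" "set bs = B"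
    using assms(1) finite_distinct_list by blast
  define n where "n = length bs"
  define M where "M = mat n n (\<lambda>(i, j). c (bs ! i) (bs ! j))"
  define A where "A = map_mat (of_int :: int \<Rightarrow> complex) M"
  define v where "v = vec n (\<lambda>i. bs ! i)"
  have M: "M \<in> carrier_mat n n" and A: "A \<in> carrier_mat n n"
    by (auto simp: M_def A_def)
  have img: "bij_betw ((!) bs) {0..<n} B"
    using bij_betw_nth[OF bs(1), of "{..<n}" B] bs by (simp add: n_def lessThan_atLeast0)
  have "A *\<^sub>v v = x \<cdot>\<^sub>v v"
  proof (rule eq_vecI)
    fix i assume "i < dim_vec (x \<cdot>\<^sub>v v)"
    then have i: "i < n" by (simp add: v_def)
    then have "x * bs ! i = (\<Sum>b'\<in>B. of_int (c (bs ! i) b') * b')"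
      using bs by (intro c) (auto simp: n_def)
    also have "\<dots> = (\<Sum>j\<in>{0..<n}. of_int (c (bs ! i) (bs ! j)) * bs ! j)"
      by (rule sum.reindex_bij_betw[OF img, symmetric])
    finally show "(A *\<^sub>v v) $ i = (x \<cdot>\<^sub>v v) $ i"
      using i by (simp add: A_def M_def v_def scalar_prod_def)
  qed (auto simp: A_def M_def v_def)
  moreover have "v \<noteq> 0\<^sub>v n"
  proof -
    obtain i where "i < n" "bs ! i = b0"
      using assms(2) bs by (auto simp: in_set_conv_nth n_def)
    then have "v $ i \<noteq> 0\<^sub>v n $ i" using assms(3) by (simp add: v_def)
    then show ?thesis by metis
  qed
  ultimately have "eigenvalue A x"
    using A unfolding eigenvalue_def eigenvector_def by (intro exI[of _ v]) (auto simp: v_def)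
  then have "poly (char_poly A) x = 0"
    using eigenvalue_root_char_poly[OF A] by simp
  moreover have "char_poly A = map_poly of_int (char_poly M)"
    unfolding A_def by (rule of_int_hom.char_poly_hom[OF M])
  moreover have "lead_coeff (char_poly M) = 1"
    using degree_monic_char_poly[OF M] by simp
  ultimately show ?thesis
    unfolding algebraic_int_altdef_ipoly by auto
qed

text \<open>The monic equation of \<open>r\<close> expresses \<open>r ^ d\<close> by lower powers,
  so the products \<open>b * r ^ j\<close> with \<open>j < d\<close> span a module stable under
  \<open>r\<close>; multipliers from \<open>S\<close> act on the factor \<open>b\<close> alone.
  Repetition yields one module for several algebraic integers, hence for their differences and
  products.\<close>

lemma extend_stable_module:
  assumes "finite B" "1 \<in> B" "algebraic_int r" "\<And>x b. x \<in> S \<Longrightarrow> b \<in> B \<Longrightarrow> x * b \<in> zspan B"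
  shows "\<exists>C. finite C \<and> 1 \<in> C \<and> (\<forall>x\<in>insert r S. \<forall>b\<in>C. x * b \<in> zspan C)"
proof -
  obtain p where p: "poly (map_poly of_int p) r = 0" "lead_coeff p = (1::int)"
    using assms(3) unfolding algebraic_int_altdef_ipoly by blast
  define d where "d = degree p"
  have d0: "d > 0"
  proof (rule ccontr)
    assume "\<not> d > 0"
    then have "p = 1" using p(2) by (auto simp: d_def elim!: degree_eq_zeroE)
    then show False using p(1) by simp
  qed
  have rd: "r ^ d = - (\<Sum>i<d. of_int (coeff p i) * r ^ i)"
  proof -
    have "0 = (\<Sum>i\<le>d. of_int (coeff p i) * r ^ i)"
      using p(1) unfolding poly_altdef by (simp add: d_def coeff_map_poly degree_map_poly)
    also have "\<dots> = (\<Sum>i<d. of_int (coeff p i) * r ^ i) + r ^ d"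
      using p(2) by (simp add: d_def lessThan_Suc_atMost[symmetric])
    finally show ?thesis by (simp add: eq_neg_iff_add_eq_0 add.commute)
  qed
  define C where "C = (\<lambda>(b, j). b * r ^ j) ` (B \<times> {..<d})"
  have inC: "b * r ^ j \<in> zspan C" if "b \<in> B" "j < d" for b j
    using that by (intro zspan.base) (auto simp: C_def)
  have "finite C" using assms(1) by (simp add: C_def)
  moreover have "1 \<in> C"
    unfolding C_def using assms(2) d0 by (intro image_eqI[of _ _ "(1, 0)"]) auto
  moreover have "x * (b * r ^ j) \<in> zspan C" if "x \<in> S" "b \<in> B" "j < d" for x b j
  proof -
    have "r ^ j * (x * b) \<in> zspan C"
      by (rule zspan_mult[OF assms(4)[OF that(1,2)]]) (use inC that in \<open>simp add: mult.commute\<close>)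
    then show ?thesis by (simp add: mult_ac)
  qed
  moreover have "r * (b * r ^ j) \<in> zspan C" if "b \<in> B" "j < d" for b j
  proof (cases "Suc j < d")
    case True
    then show ?thesis using inC[OF that(1) True] by (simp add: mult_ac)
  next
    case False
    then have "r * (b * r ^ j) = b * r ^ d" using that(2)
      by (metis linorder_neqE_nat not_less_eq mult.left_commute power_Suc)
    also have "\<dots> = - (\<Sum>i<d. of_int (coeff p i) * (b * r ^ i))"
      unfolding rd by (simp add: sum_distrib_left mult_ac)
    also have "\<dots> \<in> zspan C"
      using inC that by (intro zspan_uminus zspan_sum zspan_int_mult) auto
    finally show ?thesis .
  qed
  ultimately show ?thesis
    by (intro exI[of _ C]) (auto simp: C_def)
qed

lemma algebraic_int_diff_times:
  assumes "algebraic_int x" "algebraic_int y"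
  shows algebraic_int_diff: "algebraic_int (x - y :: complex)"
    and algebraic_int_times: "algebraic_int (x * y)"
proof -
  obtain B where B: "finite B" "1 \<in> B" "\<forall>t\<in>{x}. \<forall>b\<in>B. t * b \<in> zspan B"
    using extend_stable_module[of "{1}" x "{}"] assms by auto
  obtain C where C: "finite C" "1 \<in> C" "\<forall>t\<in>{y, x}. \<forall>b\<in>C. t * b \<in> zspan C"
    using extend_stable_module[OF B(1,2) assms(2), of "{x}"] B(3) by blast
  have "(x - y) * b \<in> zspan C" if "b \<in> C" for b
    using C(3) that by (auto simp: ring_distribs intro: zspan.diff)
  then show "algebraic_int (x - y)"
    using C by (intro algebraic_int_of_stable_module[of C 1]) auto
  have "x * y * b \<in> zspan C" if "b \<in> C" for b
    using zspan_mult[of "y * b" C x C] C(3) that by (auto simp: mult.assoc)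
  then show "algebraic_int (x * y)"
    using C by (intro algebraic_int_of_stable_module[of C 1]) auto
qed

lemma algebraic_int_add: "algebraic_int x \<Longrightarrow> algebraic_int y \<Longrightarrow> algebraic_int (x + y :: complex)"
  using algebraic_int_diff[of x "- y"] by auto

lemma algebraic_int_sum: "(\<And>i. i \<in> I \<Longrightarrow> algebraic_int (f i :: complex)) \<Longrightarrow> algebraic_int (sum f I)"
  by (induction I rule: infinite_finite_induct) (auto intro: algebraic_int_add)

lemma algebraic_int_prod: "(\<And>i. i \<in> I \<Longrightarrow> algebraic_int (f i :: complex)) \<Longrightarrow> algebraic_int (prod f I)"
  by (induction I rule: infinite_finite_induct) (auto intro: algebraic_int_times)

lemma algebraic_int_power: "algebraic_int (x :: complex) \<Longrightarrow> algebraic_int (x ^ n)"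
  by (induction n) (auto intro: algebraic_int_times)

lemma algebraic_int_power_root:
  assumes "algebraic_int (x ^ n :: complex)" "n > 0"
  shows "algebraic_int x"
  by (rule algebraic_int_root[OF assms(1), of "monom 1 n"])
     (use assms(2) in \<open>auto simp: poly_monom degree_monom_eq\<close>)

subsection \<open>Products of roots\<close>

text \<open>Multiplying \<open>poly p x = 0\<close> by \<open>a ^ (d - 1)\<close> gives a monic
  equation for \<open>y = a * x\<close>. Its coefficients are themselves only algebraic integers, so
  the stable module is a module \<open>B\<close> stable under all of them, times the powers of
  \<open>y\<close> below the \<open>d\<close>-th.\<close>

lemma algebraic_int_lead_times_root:
  assumes "\<And>i. algebraic_int (coeff p i)" "poly p x = 0" "p \<noteq> 0"
  shows "algebraic_int (lead_coeff p * x :: complex)"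
proof -
  have stable: "\<exists>B. finite B \<and> 1 \<in> B \<and> (\<forall>c\<in>set cs. \<forall>b\<in>B. c * b \<in> zspan B)"
    if "\<forall>c\<in>set cs. algebraic_int c" for cs :: "complex list"
    using that
  proof (induction cs)
    case Nil
    then show ?case by (intro exI[of _ "{1}"]) auto
  next
    case (Cons c cs)
    then obtain B where "finite B" "1 \<in> B" "\<forall>c\<in>set cs. \<forall>b\<in>B. c * b \<in> zspan B" by auto
    then show ?case
      using extend_stable_module[of B c "set cs"] Cons.prems by auto
  qed
  have "\<forall>c\<in>set (coeffs p). algebraic_int c"
    using assms(1) by (auto simp: coeffs_def)
  from stable[OF this] obtain B where B: "finite B" "1 \<in> B"
    "\<forall>c\<in>set (coeffs p). \<forall>b\<in>B. c * b \<in> zspan B" by (elim exE conjE)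
  have cB: "coeff p i * b \<in> zspan B" if "b \<in> B" for i b
  proof (cases "i \<le> degree p")
    case True
    then show ?thesis using B(3) coeff_in_coeffs[OF assms(3)] that by auto
  next
    case False
    then show ?thesis by (simp add: coeff_eq_0 zspan.zero)
  qed
  define a where "a = lead_coeff p"
  define d where "d = degree p"
  define y where "y = a * x"
  have a0: "a \<noteq> 0" using assms(3) by (simp add: a_def)
  have d0: "d > 0"
  proof (rule ccontr)
    assume "\<not> d > 0"
    then obtain c where "p = [:c:]" by (auto simp: d_def elim: degree_eq_zeroE)
    then show False using assms by simp
  qed
  have yd: "y ^ d = - (\<Sum>i<d. coeff p i * a ^ (d - 1 - i) * y ^ i)"
  proof -
    have "0 = a ^ (d - 1) * poly p x" using assms(2) by simp
    also have "\<dots> = (\<Sum>i\<le>d. a ^ (d - 1) * coeff p i * x ^ i)"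
      by (simp add: poly_altdef sum_distrib_left d_def mult.assoc)
    also have "\<dots> = (\<Sum>i<d. a ^ (d - 1) * coeff p i * x ^ i) + a ^ (d - 1) * a * x ^ d"
      by (simp add: lessThan_Suc_atMost[symmetric] a_def d_def)
    also have "a ^ (d - 1) * a * x ^ d = y ^ d"
      using d0 by (metis Suc_diff_1 power_Suc2 power_mult_distrib y_def)
    also have "(\<Sum>i<d. a ^ (d - 1) * coeff p i * x ^ i) = (\<Sum>i<d. coeff p i * a ^ (d - 1 - i) * y ^ i)"
    proof (rule sum.cong[OF refl])
      fix i assume "i \<in> {..<d}"
      then have "a ^ (d - 1) = a ^ (d - 1 - i) * a ^ i" by (simp flip: power_add)
      then show "a ^ (d - 1) * coeff p i * x ^ i = coeff p i * a ^ (d - 1 - i) * y ^ i"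
        by (simp add: y_def power_mult_distrib mult_ac)
    qed
    finally show ?thesis by (simp add: eq_neg_iff_add_eq_0 add.commute)
  qed
  define C where "C = (\<lambda>(b, j). b * y ^ j) ` (B \<times> {..<d})"
  have fC: "finite C" using B(1) by (simp add: C_def)
  have inC: "t * y ^ j \<in> zspan C" if "t \<in> zspan B" "j < d" for t j
  proof -
    have "y ^ j * t \<in> zspan C"
      by (rule zspan_mult[OF that(1)]) (use that in \<open>auto simp: C_def mult.commute[of "y ^ j"] intro!: zspan.base image_eqI[of _ _ "(b, j)" for b]\<close>)
    then show ?thesis by (simp add: mult.commute)
  qed
  have pow: "a ^ k * t \<in> zspan B" if "t \<in> zspan B" for k t
    using that
  proof (induction k)
    case (Suc k)
    have "a * (a ^ k * t) \<in> zspan B"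
      by (rule zspan_mult[OF Suc.IH[OF Suc.prems]]) (simp add: a_def cB)
    then show ?case by (simp add: mult_ac)
  qed simp
  have "y * (b * y ^ j) \<in> zspan C" if "b \<in> B" "j < d" for b j
  proof (cases "Suc j < d")
    case True
    then show ?thesis using inC[of b "Suc j"] that(1) by (simp add: mult_ac zspan.base)
  next
    case False
    then have "Suc j = d" using that(2) by simp
    then have "y * (b * y ^ j) = b * y ^ d" by auto
    also have "\<dots> = - (\<Sum>i<d. (a ^ (d - 1 - i) * (coeff p i * b)) * y ^ i)"
      unfolding yd by (simp add: sum_distrib_left mult_ac)
    also have "\<dots> \<in> zspan C"
      using that by (intro zspan_uminus zspan_sum inC pow cB) auto
    finally show ?thesis .
  qed
  moreover have "1 \<in> C"
    unfolding C_def using B(2) d0 by (intro image_eqI[of _ _ "(1, 0)"]) auto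
  ultimately have "algebraic_int y"
    using fC by (intro algebraic_int_of_stable_module[of C 1]) (auto simp: C_def)
  then show ?thesis by (simp add: y_def a_def)
qed

text \<open>Induction by cutting off the leading term \<open>monom c n\<close> of \<open>q\<close>.
  This changes the product by terms with coefficients \<open>c\<close> and \<open>c * x\<close>, and
  \<open>c * x\<close> is integral because \<open>x\<close> is a root of the product, whose leading
  coefficient is \<open>c\<close>.\<close>

lemma algebraic_int_coeffs_divide_root:
  assumes "\<And>i. algebraic_int (coeff ([:- x, 1:] * q) i)"
  shows "algebraic_int (coeff q i :: complex)"
  using assms
proof (induction "degree q" arbitrary: q i rule: less_induct)
  case less
  show ?case
  proof (cases "q = 0")
    case False
    define n where "n = degree q"
    define c where "c = lead_coeff q"
    let ?p = "[:- x, 1:] * q"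
    have p0: "?p \<noteq> 0" using False by (simp only: mult_eq_0_iff pCons_eq_0_iff) simp
    have lp: "lead_coeff ?p = c" by (simp only: lead_coeff_mult) (simp add: c_def)
    have c: "algebraic_int c" using less.prems[of "degree ?p"] lp by metis
    have cx: "algebraic_int (c * x)"
      using algebraic_int_lead_times_root[OF less.prems _ p0, of x] lp by simp
    define q' where "q' = q - monom c n"
    have step: "[:- x, 1:] * q' = ?p - monom c (Suc n) + monom (c * x) n"
      by (simp add: q'_def algebra_simps monom_Suc smult_monom smult_diff_right add_monom)
    have "algebraic_int (coeff q' i)" for i
    proof (cases "q' = 0")
      case nz: False
      have "degree q' \<le> n" unfolding q'_def n_def
        by (intro degree_diff_le) (auto simp: degree_monom_le)
      moreover have "coeff q' n = 0" by (simp add: q'_def n_def c_def)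
      ultimately have "degree q' < degree q"
        using nz by (metis leading_coeff_0_iff n_def nat_less_le)
      moreover have "algebraic_int (coeff ([:- x, 1:] * q') i)" for i
        unfolding step coeff_add coeff_diff coeff_monom using less.prems c cx
        by (intro algebraic_int_add algebraic_int_diff) auto
      ultimately show ?thesis using less.hyps by blast
    qed simp
    moreover have "coeff q i = coeff q' i + (if i = n then c else 0)" for i
      by (simp add: q'_def)
    ultimately show ?thesis using c by (metis add.right_neutral algebraic_int_add)
  qed simp
qed

text \<open>The roots outside \<open>T\<close> are divided away one at a time; up to sign, the
  constant term of what remains is \<open>c\<close> times the product over \<open>T\<close>.\<close>

lemma algebraic_int_lead_times_roots:
  assumes "finite S" "\<And>i. algebraic_int (coeff (smult c (\<Prod>x\<in>S. [:- x, 1:])) i)" "T \<subseteq> S"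
  shows "algebraic_int (c * (\<Prod>x\<in>T. x) :: complex)"
proof -
  have coeffs: "algebraic_int (coeff (smult c (\<Prod>x\<in>S - U. [:- x, 1:])) i)" if "finite U" "U \<subseteq> S" for U i
    using that
  proof (induction U arbitrary: i rule: finite_induct)
    case empty
    then show ?case using assms(2) by simp
  next
    case (insert u U)
    define D where "D = S - Set.insert u U"
    have D: "S - U = Set.insert u D" "u \<notin> D" "finite D" using insert assms(1) by (auto simp: D_def)
    have eq: "smult c (\<Prod>x\<in>S - U. [:- x, 1:]) = [:- u, 1:] * smult c (\<Prod>x\<in>D. [:- x, 1:])"
      unfolding D(1) prod.insert[OF D(3,2)] mult_smult_right ..
    have "algebraic_int (coeff (smult c (\<Prod>x\<in>S - U. [:- x, 1:])) i)" for i
      by (rule insert.IH) (use insert.prems in simp)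
    then show ?case
      unfolding D_def[symmetric] eq by (rule algebraic_int_coeffs_divide_root)
  qed
  have "finite (S - T)" using assms(1) by simp
  from coeffs[OF this, of 0] have "algebraic_int (coeff (smult c (\<Prod>x\<in>T. [:- x, 1:])) 0)"
    using assms(3) by (simp only: double_diff Diff_subset subset_refl)
  then have "algebraic_int (c * coeff (\<Prod>x\<in>T. [:- x, 1:]) 0)" by (simp only: coeff_smult)
  moreover have "poly (\<Prod>x\<in>T. [:- x, 1:]) 0 = (-1) ^ card T * (\<Prod>x\<in>T. x)"
    unfolding poly_prod by (simp add: prod_uminus)
  then have "coeff (\<Prod>x\<in>T. [:- x, 1:]) 0 = (-1) ^ card T * (\<Prod>x\<in>T. x)"
    by (simp only: poly_0_coeff_0)
  ultimately have "algebraic_int (c * ((-1) ^ card T * (\<Prod>x\<in>T. x)))" by simp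
  then have "algebraic_int ((-1) ^ card T * (c * ((-1) ^ card T * (\<Prod>x\<in>T. x))))"
    by (rule algebraic_int_times[rotated]) (intro algebraic_int_power, simp)
  moreover have "(-1) ^ card T * (c * ((-1) ^ card T * (\<Prod>x\<in>T. x))) = c * (\<Prod>x\<in>T. x)"
    by (cases "even (card T)") auto
  ultimately show ?thesis by (simp only:)
qed

subsection \<open>Algebraic numbers\<close>

lemma algebraic_int_multiple:
  assumes "algebraic (x :: complex)"
  shows "\<exists>n::nat. n > 0 \<and> algebraic_int (of_nat n * x)"
proof -
  obtain p where p: "p \<noteq> 0" "\<And>i. coeff p i \<in> \<int>" "poly p x = 0"
    using assms by (elim algebraicE) blast
  then have "algebraic_int (lead_coeff p * x)"
    by (intro algebraic_int_lead_times_root) (auto intro: int_imp_algebraic_int)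
  moreover obtain a where a: "lead_coeff p = of_int a" using p(2) Ints_cases by blast
  moreover have "of_nat (nat \<bar>a\<bar>) * x = of_int a * x \<or> of_nat (nat \<bar>a\<bar>) * x = - (of_int a * x)"
    by (cases "a \<ge> 0") auto
  ultimately have "algebraic_int (of_nat (nat \<bar>a\<bar>) * x)"
    using algebraic_int_minus by metis
  moreover have "a \<noteq> 0" using p(1) a by auto
  ultimately show ?thesis by (intro exI[of _ "nat \<bar>a\<bar>"]) auto
qed

lemma algebraic_if_algebraic_int_multiple:
  assumes "algebraic_int (of_nat n * x :: complex)" "n > 0"
  shows "algebraic x"
proof -
  obtain p where p: "lead_coeff p = 1" "\<forall>i. coeff p i \<in> \<int>" "poly p (of_nat n * x) = 0"
    using assms(1) by (auto simp: algebraic_int.simps)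
  define q where "q = pcompose p [:0, of_nat n:]"
  have "poly q x = 0" using p by (simp add: q_def poly_pcompose mult.commute)
  moreover have "q \<noteq> 0"
  proof
    assume "q = 0"
    then have "lead_coeff p * of_nat n ^ degree p = 0"
      using lead_coeff_comp[of "[:0, of_nat n :: complex:]" p] assms(2) by (simp add: q_def)
    then show False using p assms(2) by simp
  qed
  moreover have "coeff q i \<in> \<int>" for i
    unfolding q_def using p by (intro coeff_pcompose_semiring_closed) (auto simp: coeff_pCons split: nat.splits)
  ultimately show ?thesis by (intro algebraicI) auto
qed

lemma algebraic_diff_times:
  assumes "algebraic x" "algebraic (y::complex)"
  shows algebraic_diff: "algebraic (x - y)" and algebraic_times: "algebraic (x * y)"
proof -
  obtain m n :: nat where mn: "m > 0" "n > 0" "algebraic_int (of_nat m * x)" "algebraic_int (of_nat n * y)"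
    using assms algebraic_int_multiple by metis
  have "algebraic_int (of_nat n * (of_nat m * x) - of_nat m * (of_nat n * y))"
    by (intro algebraic_int_diff algebraic_int_times[OF algebraic_int_of_nat] mn)
  then have "algebraic_int (of_nat (m * n) * (x - y))" by (simp add: right_diff_distrib mult_ac)
  then show "algebraic (x - y)" using mn by (intro algebraic_if_algebraic_int_multiple[of "m * n"]) auto
  have "algebraic_int ((of_nat m * x) * (of_nat n * y))"
    by (intro algebraic_int_times mn)
  then have "algebraic_int (of_nat (m * n) * (x * y))" by (simp add: mult_ac)
  then show "algebraic (x * y)" using mn by (intro algebraic_if_algebraic_int_multiple[of "m * n"]) auto
qed

lemma algebraic_inverse':
  assumes "algebraic (x :: complex)"
  shows "algebraic (inverse x)"
proof (cases "x = 0")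
  case False
  obtain p where p: "p \<noteq> 0" "\<forall>i. coeff p i \<in> \<int>" "poly p x = 0"
    using assms by (elim algebraicE) blast
  show ?thesis
  proof (rule algebraicI)
    show "poly (reflect_poly p) (inverse x) = 0"
      using p False by (simp add: poly_reflect_poly_nz)
  qed (use p in \<open>auto simp: coeff_reflect_poly\<close>)
next
  case True
  then show ?thesis using assms by simp
qed

lemma algebraic_rational: "x \<in> \<rat> \<Longrightarrow> algebraic (x :: complex)"
proof -
  assume "x \<in> \<rat>"
  then obtain a b :: int where ab: "b > 0" "x = of_int a / of_int b"
    by (rule Rats_cases')
  then have "of_nat (nat b) * x = of_int a" by (simp add: of_nat_nat)
  then have "algebraic_int (of_nat (nat b) * x)" by (metis algebraic_int_of_int)
  then show ?thesis using ab by (intro algebraic_if_algebraic_int_multiple[of "nat b"]) auto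
qed

subsection \<open>Subfields of the complex numbers\<close>

text \<open>Conditions on bare sets; as \<open>inverse 0 = 0\<close>, closure under inverses makes
  no exception for zero.\<close>

locale csubfield =
  fixes F :: "complex set"
  assumes one: "1 \<in> F"
    and diff: "x \<in> F \<Longrightarrow> y \<in> F \<Longrightarrow> x - y \<in> F"
    and mult: "x \<in> F \<Longrightarrow> y \<in> F \<Longrightarrow> x * y \<in> F"
    and inv: "x \<in> F \<Longrightarrow> inverse x \<in> F"
begin

lemma zero: "0 \<in> F"
  using diff[OF one one] by simp

lemma neg: "x \<in> F \<Longrightarrow> - x \<in> F"
  using diff[OF zero] by simp

lemma add: "x \<in> F \<Longrightarrow> y \<in> F \<Longrightarrow> x + y \<in> F"
  using diff[OF _ neg, of x y] by simp

lemma of_nat: "of_nat n \<in> F"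
  by (induction n) (auto intro: zero add one)

lemma of_int: "of_int n \<in> F"
  using of_nat[of "nat \<bar>n\<bar>"] neg[OF of_nat[of "nat \<bar>n\<bar>"]] by (cases "n \<ge> 0") simp_all

lemma divide: "x \<in> F \<Longrightarrow> y \<in> F \<Longrightarrow> x / y \<in> F"
  unfolding divide_inverse by (intro mult inv)

lemma Rats_subset: "\<rat> \<subseteq> F"
  by (auto elim!: Rats_cases' intro!: divide of_int)

lemma sum: "(\<And>i. i \<in> I \<Longrightarrow> f i \<in> F) \<Longrightarrow> sum f I \<in> F"
  by (induction I rule: infinite_finite_induct) (auto intro: zero add)

lemma prod: "(\<And>i. i \<in> I \<Longrightarrow> f i \<in> F) \<Longrightarrow> prod f I \<in> F"
  by (induction I rule: infinite_finite_induct) (auto intro: one mult)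

lemma power: "x \<in> F \<Longrightarrow> x ^ n \<in> F"
  by (induction n) (auto intro: one mult)

lemma poly_in: "p \<in> polys_over F \<Longrightarrow> x \<in> F \<Longrightarrow> poly p x \<in> F"
  unfolding poly_altdef polys_over_def by (auto intro!: sum mult power)

lemma polys_const: "c \<in> F \<Longrightarrow> [:c:] \<in> polys_over F"
  by (auto simp: polys_over_def coeff_pCons zero split: nat.splits)

lemma polys_pCons: "c \<in> F \<Longrightarrow> p \<in> polys_over F \<Longrightarrow> pCons c p \<in> polys_over F"
  by (auto simp: polys_over_def coeff_pCons split: nat.splits)

lemma polys_0: "0 \<in> polys_over F"
  by (auto simp: polys_over_def zero)

lemma polys_diff: "p \<in> polys_over F \<Longrightarrow> q \<in> polys_over F \<Longrightarrow> p - q \<in> polys_over F"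
  by (auto simp: polys_over_def diff)

lemma polys_add: "p \<in> polys_over F \<Longrightarrow> q \<in> polys_over F \<Longrightarrow> p + q \<in> polys_over F"
  by (auto simp: polys_over_def add)

lemma polys_mult: "p \<in> polys_over F \<Longrightarrow> q \<in> polys_over F \<Longrightarrow> p * q \<in> polys_over F"
  by (auto simp: polys_over_def coeff_mult intro!: sum mult)

lemma polys_monom: "c \<in> F \<Longrightarrow> monom c n \<in> polys_over F"
  by (auto simp: polys_over_def zero)

lemma polys_pderiv: "p \<in> polys_over F \<Longrightarrow> pderiv p \<in> polys_over F"
  by (auto simp: polys_over_def coeff_pderiv simp del: of_nat_Suc intro!: mult of_nat)

lemma polys_pcompose: "p \<in> polys_over F \<Longrightarrow> q \<in> polys_over F \<Longrightarrow> pcompose p q \<in> polys_over F"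
proof (induction p)
  case (pCons a p)
  have "coeff (pCons a p) 0 \<in> F" "coeff (pCons a p) (Suc i) \<in> F" for i
    using pCons.prems(1) unfolding polys_over_def by blast+
  then have "a \<in> F" "p \<in> polys_over F"
    by (simp_all add: polys_over_def)
  then show ?case using pCons by (auto simp: pcompose_pCons intro!: polys_add polys_mult polys_const)
qed (simp add: polys_0)

lemma polys_prod: "(\<And>i. i \<in> I \<Longrightarrow> f i \<in> polys_over F) \<Longrightarrow> prod f I \<in> polys_over F"
  by (induction I rule: infinite_finite_induct)
     (auto intro: polys_mult polys_const[OF one, folded one_pCons])

lemma polys_division:
  assumes "g \<in> polys_over F" "g \<noteq> 0" "p \<in> polys_over F"
  shows "\<exists>q\<in>polys_over F. \<exists>r\<in>polys_over F. p = q * g + r \<and> (r = 0 \<or> degree r < degree g)"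
  using assms(3)
proof (induction "degree p" arbitrary: p rule: less_induct)
  case less
  show ?case
  proof (cases "p = 0 \<or> degree p < degree g")
    case True
    then show ?thesis using less.prems polys_0 by (intro bexI[of _ 0] bexI[of _ p]) auto
  next
    case False
    define c where "c = lead_coeff p / lead_coeff g"
    define t where "t = monom c (degree p - degree g)"
    have c0: "c \<noteq> 0" using False assms(2) by (simp add: c_def)
    have cF: "c \<in> F" using less.prems assms(1) by (auto simp: c_def polys_over_def intro!: divide)
    have t: "t \<in> polys_over F" unfolding t_def by (rule polys_monom[OF cF])
    have t0: "t \<noteq> 0" using c0 by (simp add: t_def)
    have "degree t = degree p - degree g" unfolding t_def by (rule degree_monom_eq[OF c0])
    then have dt: "degree (t * g) = degree p"
      using False assms(2) t0 by (simp add: degree_mult_eq)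
    have lt: "lead_coeff (t * g) = lead_coeff p"
    proof -
      have "lead_coeff t = c" unfolding t_def by (rule lead_coeff_monom)
      then show ?thesis unfolding lead_coeff_mult using assms(2) by (simp add: c_def)
    qed
    define p' where "p' = p - t * g"
    have p': "p' \<in> polys_over F"
      unfolding p'_def using less.prems t assms(1) by (intro polys_diff polys_mult)
    have "\<exists>q\<in>polys_over F. \<exists>r\<in>polys_over F. p' = q * g + r \<and> (r = 0 \<or> degree r < degree g)"
    proof (cases "p' = 0")
      case True
      then show ?thesis using polys_0 by (intro bexI[of _ 0]) auto
    next
      case nz: False
      have "degree p' \<le> degree p" unfolding p'_def using dt by (intro degree_diff_le) auto
      moreover have "coeff p' (degree p) = 0" unfolding p'_def using dt lt by simp
      ultimately have "degree p' < degree p"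
        using nz by (metis leading_coeff_0_iff le_neq_implies_less)
      then show ?thesis using less.hyps p' by blast
    qed
    then obtain q r where "q \<in> polys_over F" "r \<in> polys_over F" "p' = q * g + r" "r = 0 \<or> degree r < degree g"
      by blast
    then show ?thesis using t
      by (intro bexI[of _ "q + t"] bexI[of _ r] polys_add) (auto simp: p'_def algebra_simps)
  qed
qed

end

lemma csubfield_subfield:
  assumes "subfield F complex_field"
  shows "csubfield F"
proof -
  interpret C: field complex_field by (rule field_from_type_algebra)
  have minus: "\<ominus>\<^bsub>complex_field\<^esub> x = - x" for x :: complex
    by (rule C.minus_equality) (auto simp: ring_of_type_algebra_def)
  have inv: "inv\<^bsub>complex_field\<^esub> x = inverse x" if "x \<noteq> 0" for x :: complex
    by (rule C.comm_inv_char) (use that in \<open>auto simp: ring_of_type_algebra_def\<close>)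
  note sub = subfieldE(1)[OF assms]
  have neg: "- x \<in> F" if "x \<in> F" for x
    using subringE(5)[OF sub that] minus by simp
  show ?thesis
  proof
    show "1 \<in> F" using subringE(3)[OF sub] by (simp add: ring_of_type_algebra_def)
    show "x - y \<in> F" if "x \<in> F" "y \<in> F" for x y
      using subringE(7)[OF sub that(1) neg[OF that(2)]] by (simp add: ring_of_type_algebra_def)
    show "x * y \<in> F" if "x \<in> F" "y \<in> F" for x y
      using subringE(6)[OF sub that] by (simp add: ring_of_type_algebra_def)
    show "inverse x \<in> F" if "x \<in> F" for x
    proof (cases "x = 0")
      case False
      then have "inv\<^bsub>complex_field\<^esub> x \<in> F"
        using C.subfield_m_inv(1)[OF assms, of x] that by (simp add: ring_of_type_algebra_def)
      then show ?thesis using inv False by simp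
    qed (use that in simp)
  qed
qed

lemma csubfield_Rats: "csubfield \<rat>"
  by unfold_locales auto

lemma csubfield_Qbar: "csubfield Qbar"
  unfolding Qbar_def
  by unfold_locales (auto intro: algebraic_diff algebraic_times algebraic_inverse' algebraic_rational)

lemma algebraic_poly: "p \<in> polys_over \<rat> \<Longrightarrow> algebraic x \<Longrightarrow> algebraic (poly p x)"
  using csubfield.poly_in[OF csubfield_Qbar, of p x]
  by (auto simp: Qbar_def polys_over_def intro: algebraic_rational)

lemma polys_over_mono: "F \<subseteq> F' \<Longrightarrow> polys_over F \<subseteq> polys_over F'"
  by (auto simp: polys_over_def)

lemma algebraic_Rats_poly:
  assumes "algebraic (x :: complex)"
  shows "\<exists>p\<in>polys_over \<rat>. p \<noteq> 0 \<and> poly p x = 0"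
proof -
  obtain p where p: "p \<noteq> 0" "\<And>i. coeff p i \<in> \<int>" "poly p x = 0"
    using assms by (elim algebraicE) blast
  have "coeff p i \<in> \<rat>" for i using p(2)[of i] Ints_subset_Rats by blast
  then show ?thesis using p by (intro bexI[of _ p]) (auto simp: polys_over_def)
qed

lemma Rats_poly_root_algebraic:
  assumes "p \<in> polys_over \<rat>" "p \<noteq> 0" "poly p x = 0"
  shows "algebraic (x :: complex)"
proof -
  have "\<exists>n::nat. n > 0 \<and> of_nat n * c \<in> \<int>" if "c \<in> \<rat>" for c :: complex
  proof -
    obtain a b :: int where ab: "b > 0" "c = of_int a / of_int b"
      using \<open>c \<in> \<rat>\<close> by (rule Rats_cases')
    then show ?thesis by (intro exI[of _ "nat b"]) (simp add: of_nat_nat)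
  qed
  then obtain n :: "complex \<Rightarrow> nat" where n: "\<And>c. c \<in> \<rat> \<Longrightarrow> n c > 0 \<and> of_nat (n c) * c \<in> \<int>"
    by metis
  define N where "N = (\<Prod>c\<in>set (coeffs p). n c)"
  have rat: "coeff p i \<in> \<rat>" for i using assms(1) by (simp add: polys_over_def)
  have "c \<in> \<rat>" if "c \<in> set (coeffs p)" for c
    using that rat by (auto simp: coeffs_def split: if_splits)
  then have N0: "N > 0" unfolding N_def using n by (intro prod_pos) auto
  have "of_nat N * coeff p i \<in> \<int>" for i
  proof (cases "i \<le> degree p")
    case True
    have i: "coeff p i \<in> set (coeffs p)" by (rule coeff_in_coeffs[OF assms(2) True])
    have "of_nat N * coeff p i = of_nat (\<Prod>c\<in>set (coeffs p) - {coeff p i}. n c) * (of_nat (n (coeff p i)) * coeff p i)"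
      unfolding N_def using prod.remove[OF _ i, of n] by (simp add: mult_ac)
    then show ?thesis using n[OF rat] by (metis Ints_mult Ints_of_nat)
  qed (simp add: coeff_eq_0)
  then show ?thesis
    by (intro algebraicI[of "smult (of_nat N) p"]) (use assms N0 in auto)
qed

subsection \<open>Minimal polynomials and conjugates\<close>

definition minp :: "complex set \<Rightarrow> complex \<Rightarrow> complex poly" where
  "minp F x = (ARG_MIN degree p. p \<in> polys_over F \<and> lead_coeff p = 1 \<and> poly p x = 0)"

definition conjs :: "complex set \<Rightarrow> complex \<Rightarrow> complex set" where
  "conjs F x = {y. poly (minp F x) y = 0}"

context csubfield
begin

lemma minp:
  assumes "algebraic x"
  shows minp_poly: "minp F x \<in> polys_over F" and minp_monic: "lead_coeff (minp F x) = 1"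
    and minp_root: "poly (minp F x) x = 0"
    and minp_least: "p \<in> polys_over F \<Longrightarrow> p \<noteq> 0 \<Longrightarrow> poly p x = 0 \<Longrightarrow> degree (minp F x) \<le> degree p"
proof -
  let ?P = "\<lambda>p. p \<in> polys_over F \<and> lead_coeff p = 1 \<and> poly p x = 0"
  have scale: "?P (smult (inverse (lead_coeff p)) p)" if "p \<in> polys_over F" "p \<noteq> 0" "poly p x = 0" for p
    using that by (auto intro!: mult inv simp: polys_over_def)
  obtain p\<^sub>0 where "p\<^sub>0 \<in> polys_over F" "p\<^sub>0 \<noteq> 0" "poly p\<^sub>0 x = 0"
    using algebraic_Rats_poly[OF assms] polys_over_mono[OF Rats_subset] by blast
  from arg_min_nat_lemma[of ?P, OF scale[OF this], of degree]
  have m: "?P (minp F x)" "\<And>p. ?P p \<Longrightarrow> degree (minp F x) \<le> degree p"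
    unfolding minp_def by blast+
  show "minp F x \<in> polys_over F" "lead_coeff (minp F x) = 1" "poly (minp F x) x = 0"
    using m(1) by auto
  show "degree (minp F x) \<le> degree p" if "p \<in> polys_over F" "p \<noteq> 0" "poly p x = 0"
    using m(2)[OF scale[OF that]] that(2) by simp
qed

lemma minp_nz: "algebraic x \<Longrightarrow> minp F x \<noteq> 0"
  using minp_monic by fastforce

lemma degree_minp_pos: "algebraic x \<Longrightarrow> degree (minp F x) > 0"
  using minp_root[of x] minp_nz[of x] by (intro Nat.gr0I) (auto elim!: degree_eq_zeroE)

lemma minp_dvd:
  assumes "algebraic x" "p \<in> polys_over F" "poly p x = 0"
  shows "\<exists>q\<in>polys_over F. p = q * minp F x"
proof -
  obtain q r where qr: "q \<in> polys_over F" "r \<in> polys_over F" "p = q * minp F x + r"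
    "r = 0 \<or> degree r < degree (minp F x)"
    using polys_division[OF minp_poly[OF assms(1)] minp_nz[OF assms(1)] assms(2)] by blast
  have "poly r x = 0" using qr(3) assms(3) minp_root[OF assms(1)] by simp
  then have "r = 0" using minp_least[OF assms(1) qr(2)] qr(4) by (meson leD)
  then show ?thesis using qr(1,3) by (intro bexI[of _ q]) simp_all
qed

lemma poly_conjs: "algebraic x \<Longrightarrow> p \<in> polys_over F \<Longrightarrow> poly p x = 0 \<Longrightarrow> y \<in> conjs F x \<Longrightarrow> poly p y = 0"
  using minp_dvd[of x p] by (auto simp: conjs_def)

lemma self_conjs: "algebraic x \<Longrightarrow> x \<in> conjs F x"
  using minp_root by (simp add: conjs_def)

lemma finite_conjs: "algebraic x \<Longrightarrow> finite (conjs F x)"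
  unfolding conjs_def using poly_roots_finite minp_nz by blast

lemma algebraic_conjs:
  assumes "algebraic x" "y \<in> conjs F x"
  shows "algebraic y"
proof -
  obtain p where p: "p \<in> polys_over \<rat>" "p \<noteq> 0" "poly p x = 0"
    using algebraic_Rats_poly[OF assms(1)] by blast
  then have "poly p y = 0"
    using poly_conjs[OF assms(1) _ _ assms(2)] polys_over_mono[OF Rats_subset] by blast
  then show ?thesis using Rats_poly_root_algebraic p by blast
qed

text \<open>\<open>minp F y\<close> divides \<open>minp F x\<close>. If \<open>x\<close> were not
  one of its roots, it would be a root of the cofactor, whose degree is too small. So
  \<open>x\<close> is a root of \<open>minp F y\<close>, the degrees agree, and both polynomials are
  monic.\<close>

lemma minp_conjs:
  assumes x: "algebraic x" and y: "y \<in> conjs F x"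
  shows "minp F y = minp F x"
proof -
  note ay = algebraic_conjs[OF x y]
  obtain q where q: "q \<in> polys_over F" "minp F x = q * minp F y"
    using minp_dvd[OF ay minp_poly[OF x]] y by (auto simp: conjs_def)
  have nz: "q \<noteq> 0" "minp F y \<noteq> 0" using q minp_nz[OF x] by auto
  have dq: "degree (minp F x) = degree q + degree (minp F y)"
    unfolding q(2) by (rule degree_mult_eq[OF nz])
  have "poly q x \<noteq> 0"
    using minp_least[OF x q(1) nz(1)] dq degree_minp_pos[OF ay] by linarith
  moreover have "poly q x * poly (minp F y) x = 0"
    using minp_root[OF x] unfolding q(2) poly_mult .
  ultimately have "poly (minp F y) x = 0" by simp
  then have "degree q = 0"
    using minp_least[OF x minp_poly[OF ay] nz(2)] dq by linarith
  then obtain c where c: "q = [:c:]" by (rule degree_eq_zeroE)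
  have "lead_coeff (minp F x) = lead_coeff q * lead_coeff (minp F y)"
    unfolding q(2) by (rule lead_coeff_mult)
  then have "lead_coeff q = 1" unfolding minp_monic[OF x] minp_monic[OF ay] by simp
  then have "q = 1" unfolding c by simp
  then show ?thesis using q(2) by (simp only: mult_1_left)
qed

lemma conjs_conjs:
  assumes "algebraic x" "y \<in> conjs F x"
  shows "conjs F y = conjs F x"
  unfolding conjs_def minp_conjs[OF assms] ..

text \<open>Separability in characteristic zero: at a double root \<open>a\<close> the derivative
  would be a polynomial over \<open>F\<close> vanishing at \<open>a\<close> of degree smaller than
  that of \<open>minp F a = minp F x\<close>.\<close>

lemma minp_eq_prod:
  assumes "algebraic x"
  shows "minp F x = (\<Prod>y\<in>conjs F x. [:- y, 1:])"
proof -
  have "rsquarefree (minp F x)"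
    unfolding rsquarefree_roots
  proof (intro allI notI)
    fix a assume a: "poly (minp F x) a = 0 \<and> poly (pderiv (minp F x)) a = 0"
    then have "a \<in> conjs F x" by (simp add: conjs_def)
    then have m: "minp F a = minp F x" "algebraic a"
      using minp_conjs algebraic_conjs assms by blast+
    have "pderiv (minp F x) \<noteq> 0"
      using degree_minp_pos[OF assms] by (simp add: pderiv_eq_0_iff)
    then have "degree (minp F a) \<le> degree (pderiv (minp F x))"
      using a by (intro minp_least m polys_pderiv minp_poly assms) auto
    then show False using m degree_minp_pos[OF assms] by (simp add: degree_pderiv)
  qed
  from complex_poly_decompose_rsquarefree[OF this] show ?thesis
    using minp_monic[OF assms] by (simp add: conjs_def)
qed

lemma degree_minp:
  assumes "algebraic x"
  shows "degree (minp F x) = card (conjs F x)"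
proof -
  have "degree (minp F x) = degree (\<Prod>y\<in>conjs F x. [:- y, 1:])"
    using minp_eq_prod[OF assms] by (rule arg_cong)
  also have "\<dots> = (\<Sum>y\<in>conjs F x. degree [:- y, 1:])"
    by (rule degree_prod_eq_sum_degree) simp
  finally show ?thesis by simp
qed

lemma conjs_singleton:
  assumes "algebraic x" "conjs F x \<subseteq> {x}"
  shows "x \<in> F"
proof -
  have "conjs F x = {x}" using assms self_conjs by blast
  then have "minp F x = (\<Prod>y\<in>{x}. [:- y, 1:])" using minp_eq_prod[OF assms(1)] by (simp only:)
  then have "coeff (minp F x) 0 = - x" by simp
  moreover have "coeff (minp F x) 0 \<in> F" using minp_poly[OF assms(1)] by (simp add: polys_over_def)
  ultimately have "- x \<in> F" by simp
  then show ?thesis using neg[of "- x"] by simp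
qed

lemma conjs_mono:
  assumes "csubfield F'" "F' \<subseteq> F" "algebraic x"
  shows "conjs F x \<subseteq> conjs F' x"
proof
  fix y assume y: "y \<in> conjs F x"
  have "minp F' x \<in> polys_over F"
    using csubfield.minp_poly[OF assms(1,3)] polys_over_mono[OF assms(2)] by blast
  then have "poly (minp F' x) y = 0"
    by (rule poly_conjs[OF assms(3) _ csubfield.minp_root[OF assms(1,3)] y])
  then show "y \<in> conjs F' x" by (simp add: conjs_def)
qed

end

subsection \<open>Simple extensions of the rationals\<close>

text \<open>The ring generated by \<theta>; for algebraic \<theta> it is already a field.\<close>

definition adj :: "complex \<Rightarrow> complex set" where
  "adj \<theta> = (\<lambda>p. poly p \<theta>) ` polys_over \<rat>"

text \<open>The minimal polynomial \<open>c + X * p\<close> of a nonzero \<open>x\<close> has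
  \<open>c \<noteq> 0\<close> by minimality, so the inverse of \<open>x\<close> is
  \<open>- p(x) / c\<close>, a polynomial in \<open>x\<close>.\<close>

lemma csubfield_of_algebraic_ring:
  assumes "\<rat> \<subseteq> F" "F \<subseteq> Qbar" "\<And>x y. x \<in> F \<Longrightarrow> y \<in> F \<Longrightarrow> x - y \<in> F"
    "\<And>x y. x \<in> F \<Longrightarrow> y \<in> F \<Longrightarrow> x * y \<in> F"
  shows "csubfield F"
proof
  show "1 \<in> F" using assms(1) by auto
  interpret Q: csubfield \<rat> by (rule csubfield_Rats)
  fix x assume x: "x \<in> F"
  show "inverse x \<in> F"
  proof (cases "x = 0")
    case False
    have ax: "algebraic x" using x assms(2) by (auto simp: Qbar_def)
    obtain c p where m: "minp \<rat> x = pCons c p" by (cases "minp \<rat> x") blast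
    have "coeff (pCons c p) i \<in> \<rat>" for i
      using Q.minp_poly[OF ax] m by (simp add: polys_over_def)
    from this[of 0] this[of "Suc _"] have cp: "c \<in> \<rat>" "p \<in> polys_over \<rat>"
      by (simp_all add: polys_over_def)
    have root: "c + x * poly p x = 0" using Q.minp_root[OF ax] m by simp
    have "c \<noteq> 0"
    proof
      assume "c = 0"
      then have "poly p x = 0" "p \<noteq> 0" using root False m Q.minp_nz[OF ax] by auto
      then have "degree (minp \<rat> x) \<le> degree p" using Q.minp_least[OF ax cp(2)] by blast
      then show False using m \<open>p \<noteq> 0\<close> by simp
    qed
    have neg: "- y \<in> F" if "y \<in> F" for y
    proof -
      have "0 \<in> F" using assms(1) by auto
      from assms(3)[OF this that] show ?thesis by simp
    qed
    have add: "y + z \<in> F" if "y \<in> F" "z \<in> F" for y z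
      using assms(3)[OF that(1) neg[OF that(2)]] by simp
    have "poly p x \<in> F" if "p \<in> polys_over \<rat>" for p
      using that
    proof (induction p)
      case (pCons a p)
      have "coeff (pCons a p) i \<in> \<rat>" for i
        using pCons.prems by (simp add: polys_over_def)
      from this[of 0] this[of "Suc _"] have "a \<in> \<rat>" "p \<in> polys_over \<rat>"
        by (simp_all add: polys_over_def)
      then show ?case using pCons.IH x assms(1) by (auto intro!: add assms(4))
    qed (use assms(1) in auto)
    then have "poly p x \<in> F" using cp by blast
    moreover have "- inverse c \<in> F" using cp assms(1) by auto
    ultimately have "- inverse c * poly p x \<in> F" using assms(4) by blast
    moreover have "inverse x = - inverse c * poly p x"
      using root \<open>c \<noteq> 0\<close> False by (simp add: field_simps add_eq_0_iff)
    ultimately show ?thesis by simp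
  qed (use x in simp)
qed (use assms in auto)

lemma adj_self: "\<theta> \<in> adj \<theta>"
  unfolding adj_def by (rule image_eqI[of _ _ "[:0, 1:]"]) (auto simp: polys_over_def coeff_pCons split: nat.splits)

lemma adj_algebraic: "algebraic \<theta> \<Longrightarrow> x \<in> adj \<theta> \<Longrightarrow> algebraic x"
  by (auto simp: adj_def intro: algebraic_poly)

lemma csubfield_adj:
  assumes "algebraic \<theta>"
  shows "csubfield (adj \<theta>)"
proof (rule csubfield_of_algebraic_ring)
  interpret Q: csubfield \<rat> by (rule csubfield_Rats)
  show "\<rat> \<subseteq> adj \<theta>"
    unfolding adj_def by (auto intro!: image_eqI[of _ _ "[:c:]" for c] Q.polys_const)
  show "adj \<theta> \<subseteq> Qbar" using adj_algebraic[OF assms] by (auto simp: Qbar_def)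
  show "x - y \<in> adj \<theta>" if "x \<in> adj \<theta>" "y \<in> adj \<theta>" for x y
    using that unfolding adj_def by (auto simp flip: poly_diff intro!: imageI Q.polys_diff)
  show "x * y \<in> adj \<theta>" if "x \<in> adj \<theta>" "y \<in> adj \<theta>" for x y
    using that unfolding adj_def by (auto simp flip: poly_mult intro!: imageI Q.polys_mult)
qed

lemma adj_subset:
  assumes "csubfield F" "\<theta> \<in> F"
  shows "adj \<theta> \<subseteq> F"
  using csubfield.poly_in[OF assms(1) _ assms(2)] polys_over_mono[OF csubfield.Rats_subset[OF assms(1)]]
  by (auto simp: adj_def)

text \<open>For all but finitely many \<open>c\<close>, no pair of conjugates with
  \<open>b' \<noteq> b\<close> satisfies \<open>a' + c * b' = a + c * b\<close>. For such a
  \<open>c\<close> the polynomials \<open>minp \<rat> b\<close> and \<open>minp \<rat> a\<close>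
  composed with \<open>\<theta> - c * X\<close> share only the root \<open>b\<close>, which
  therefore has no further conjugate over \<open>adj \<theta>\<close>.\<close>

lemma primitive_element_pair:
  assumes a: "algebraic a" and b: "algebraic b"
  shows "\<exists>c::nat. a \<in> adj (a + of_nat c * b) \<and> b \<in> adj (a + of_nat c * b)"
proof -
  interpret Q: csubfield \<rat> by (rule csubfield_Rats)
  \<comment> \<open>Pairs with \<open>b' = b\<close> contribute \<open>0\<close> through division by
    zero, which merely excludes \<open>c = 0\<close>.\<close>
  let ?bad = "(\<lambda>(a', b'). (a' - a) / (b - b')) ` (conjs \<rat> a \<times> conjs \<rat> b)"
  have "finite ?bad" using Q.finite_conjs a b by blast
  moreover have "infinite (range (of_nat :: nat \<Rightarrow> complex))"
    by (rule range_inj_infinite) (simp add: inj_on_def)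
  ultimately have "\<not> range (of_nat :: nat \<Rightarrow> complex) \<subseteq> ?bad"
    by (meson finite_subset)
  then obtain c :: nat where c: "of_nat c \<notin> ?bad" by (meson image_subsetI)
  define \<theta> where "\<theta> = a + of_nat c * b"
  have alg: "algebraic \<theta>"
  proof -
    interpret A: csubfield Qbar by (rule csubfield_Qbar)
    have "\<theta> \<in> Qbar" unfolding \<theta>_def using a b by (intro A.add A.mult A.of_nat) (auto simp: Qbar_def)
    then show ?thesis by (simp add: Qbar_def)
  qed
  interpret F: csubfield "adj \<theta>" by (rule csubfield_adj[OF alg])
  have "conjs (adj \<theta>) b \<subseteq> {b}"
  proof
    fix y assume y: "y \<in> conjs (adj \<theta>) b"
    define h where "h = pcompose (minp \<rat> a) [:\<theta>, - of_nat c:]"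
    have "h \<in> polys_over (adj \<theta>)"
      unfolding h_def using polys_over_mono[OF F.Rats_subset] Q.minp_poly[OF a] adj_self
      by (intro F.polys_pcompose F.polys_pCons F.neg F.of_nat F.polys_0) auto
    moreover have "poly h b = 0"
      using Q.minp_root[OF a] by (simp add: h_def poly_pcompose \<theta>_def algebra_simps)
    ultimately have "poly h y = 0" using F.poly_conjs[OF b _ _ y] by blast
    then have "\<theta> - of_nat c * y \<in> conjs \<rat> a"
      by (simp add: h_def poly_pcompose conjs_def mult.commute)
    moreover have "y \<in> conjs \<rat> b"
      using F.conjs_mono[OF csubfield_Rats F.Rats_subset b] y by blast
    ultimately have "((\<theta> - of_nat c * y) - a) / (b - y) \<in> ?bad"
      by (intro image_eqI[of _ _ "(\<theta> - of_nat c * y, y)"]) auto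
    moreover have "((\<theta> - of_nat c * y) - a) / (b - y) = of_nat c" if "y \<noteq> b"
    proof -
      have "\<theta> - of_nat c * y - a = of_nat c * (b - y)" by (simp add: \<theta>_def right_diff_distrib)
      then show ?thesis using that by simp
    qed
    ultimately show "y \<in> {b}" using c by (cases "y = b") simp_all
  qed
  then have "b \<in> adj \<theta>" by (rule F.conjs_singleton[OF b])
  moreover from this have "\<theta> - of_nat c * b \<in> adj \<theta>"
    by (intro F.diff F.mult F.of_nat adj_self)
  ultimately show ?thesis by (intro exI[of _ c]) (simp add: \<theta>_def)
qed

text \<open>The last clause says that \<theta> is generated by \<open>S\<close>. It reduces claims
  about \<theta> to claims about elements of \<open>S\<close>, which is how normality is obtained in
  \<open>galois_exists\<close>.\<close>

lemma primitive_element: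
  assumes "finite S" "S \<subseteq> Qbar"
  shows "\<exists>\<theta>. algebraic \<theta> \<and> S \<subseteq> adj \<theta> \<and> (\<forall>F. csubfield F \<longrightarrow> S \<subseteq> F \<longrightarrow> \<theta> \<in> F)"
  using assms
proof (induction S rule: finite_induct)
  case empty
  have "algebraic (0 :: complex)" by (rule algebraic_rational) simp
  then show ?case using csubfield.zero by (intro exI[of _ 0]) auto
next
  case (insert s S)
  then obtain \<theta> where \<theta>: "algebraic \<theta>" "S \<subseteq> adj \<theta>" "\<And>F. csubfield F \<Longrightarrow> S \<subseteq> F \<Longrightarrow> \<theta> \<in> F"
    by auto
  have s: "algebraic s" using insert.prems by (auto simp: Qbar_def)
  obtain c :: nat where c: "\<theta> \<in> adj (\<theta> + of_nat c * s)" "s \<in> adj (\<theta> + of_nat c * s)"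
    using primitive_element_pair[OF \<theta>(1) s] by (elim exE conjE)
  define \<eta> where "\<eta> = \<theta> + of_nat c * s"
  have alg: "algebraic \<eta>"
  proof -
    interpret A: csubfield Qbar by (rule csubfield_Qbar)
    have "\<eta> \<in> Qbar" unfolding \<eta>_def using \<theta> s by (intro A.add A.mult A.of_nat) (auto simp: Qbar_def)
    then show ?thesis by (simp add: Qbar_def)
  qed
  have "adj \<theta> \<subseteq> adj \<eta>"
    using adj_subset[OF csubfield_adj[OF alg]] c(1) by (simp add: \<eta>_def)
  moreover have "\<eta> \<in> F" if "csubfield F" "Set.insert s S \<subseteq> F" for F
  proof -
    interpret F: csubfield F by fact
    show ?thesis unfolding \<eta>_def using that \<theta>(3)[OF that(1)] by (intro F.add F.mult F.of_nat) auto
  qed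
  ultimately show ?case using alg \<theta>(2) c(2) by (intro exI[of _ \<eta>]) (auto simp: \<eta>_def)
qed

text \<open>
  A finite normal extension \<open>L\<close> of the rationals with its Galois group \<open>G\<close>, the automorphisms
  being functions that are only relevant on \<open>L\<close>.
\<close>

locale galois = csubfield L for L +
  fixes G :: "(complex \<Rightarrow> complex) set"
  assumes alg: "x \<in> L \<Longrightarrow> algebraic x"
    and fin: "finite G"
    and closed: "g \<in> G \<Longrightarrow> x \<in> L \<Longrightarrow> g x \<in> L"
    and hom_diff: "g \<in> G \<Longrightarrow> x \<in> L \<Longrightarrow> y \<in> L \<Longrightarrow> g (x - y) = g x - g y"
    and hom_mult: "g \<in> G \<Longrightarrow> x \<in> L \<Longrightarrow> y \<in> L \<Longrightarrow> g (x * y) = g x * g y"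
    and hom_one: "g \<in> G \<Longrightarrow> g 1 = 1"
    and ident: "\<exists>e\<in>G. \<forall>x\<in>L. e x = x"
    and comp: "g \<in> G \<Longrightarrow> h \<in> G \<Longrightarrow> \<exists>k\<in>G. \<forall>x\<in>L. k x = g (h x)"
    and ext: "g \<in> G \<Longrightarrow> h \<in> G \<Longrightarrow> (\<And>x. x \<in> L \<Longrightarrow> g x = h x) \<Longrightarrow> g = h"
    and fixed: "csubfield F \<Longrightarrow> x \<in> L \<Longrightarrow> (\<And>g. g \<in> G \<Longrightarrow> (\<And>y. y \<in> F \<inter> L \<Longrightarrow> g y = y) \<Longrightarrow> g x = x) \<Longrightarrow> x \<in> F"
begin

lemma hom_0: "g \<in> G \<Longrightarrow> g 0 = 0"
  using hom_diff[OF _ one one, of g] by simp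

lemma hom_neg: "g \<in> G \<Longrightarrow> x \<in> L \<Longrightarrow> g (- x) = - g x"
  using hom_diff[OF _ zero, of g x] hom_0 by simp

lemma hom_add: "g \<in> G \<Longrightarrow> x \<in> L \<Longrightarrow> y \<in> L \<Longrightarrow> g (x + y) = g x + g y"
  using hom_diff[OF _ _ neg, of g x y] hom_neg[of g y] by simp

lemma hom_sum: "g \<in> G \<Longrightarrow> (\<And>i. i \<in> I \<Longrightarrow> f i \<in> L) \<Longrightarrow> g (sum f I) = (\<Sum>i\<in>I. g (f i))"
  by (induction I rule: infinite_finite_induct) (simp_all add: hom_0 hom_add sum)

lemma hom_prod: "g \<in> G \<Longrightarrow> (\<And>i. i \<in> I \<Longrightarrow> f i \<in> L) \<Longrightarrow> g (prod f I) = (\<Prod>i\<in>I. g (f i))"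
  by (induction I rule: infinite_finite_induct) (simp_all add: hom_one hom_mult prod)

lemma hom_power: "g \<in> G \<Longrightarrow> x \<in> L \<Longrightarrow> g (x ^ n) = g x ^ n"
  by (induction n) (simp_all add: hom_one hom_mult power)

lemma hom_nz: "g \<in> G \<Longrightarrow> x \<in> L \<Longrightarrow> x \<noteq> 0 \<Longrightarrow> g x \<noteq> 0"
  using hom_mult[of g x "inverse x"] inv[of x] hom_one[of g] by auto

lemma hom_inverse: "g \<in> G \<Longrightarrow> x \<in> L \<Longrightarrow> g (inverse x) = inverse (g x)"
proof (cases "x = 0")
  case False
  assume gx: "g \<in> G" "x \<in> L"
  then have "g x * g (inverse x) = 1"
    using hom_mult[of g x "inverse x"] inv[of x] hom_one[of g] False by simp
  then show ?thesis using inverse_unique by fastforce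
qed (simp add: hom_0)

lemma hom_inj:
  assumes "g \<in> G" "x \<in> L" "y \<in> L" "g x = g y"
  shows "x = y"
  using hom_nz[OF assms(1) diff[OF assms(2,3)]] hom_diff[OF assms(1-3)] assms(4) by auto

lemma hom_poly:
  assumes "g \<in> G" "p \<in> polys_over L" "x \<in> L"
  shows "g (poly p x) = (\<Sum>i\<le>degree p. g (coeff p i) * g x ^ i)"
  unfolding poly_altdef using assms
  by (subst hom_sum) (auto simp: polys_over_def hom_mult hom_power power intro: mult)

text \<open>The Galois group of \<open>L\<close> over \<open>F \<inter> L\<close>; an infinite field
  \<open>F\<close> is seen only through its trace on \<open>L\<close>.\<close>

definition stab :: "complex set \<Rightarrow> (complex \<Rightarrow> complex) set" where
  "stab F = {g\<in>G. \<forall>y\<in>F \<inter> L. g y = y}"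

lemma stab_G: "g \<in> stab F \<Longrightarrow> g \<in> G"
  by (simp add: stab_def)

lemma stab_fix: "g \<in> stab F \<Longrightarrow> y \<in> F \<Longrightarrow> y \<in> L \<Longrightarrow> g y = y"
  by (simp add: stab_def)

lemma finite_stab: "finite (stab F)"
  using fin by (simp add: stab_def)

lemma stab_ident: "\<exists>e\<in>stab F. \<forall>x\<in>L. e x = x"
proof -
  obtain e where "e \<in> G" "\<forall>x\<in>L. e x = x" using ident by (elim bexE)
  then show ?thesis by (intro bexI[of _ e]) (auto simp: stab_def)
qed

text \<open>A plain composition agrees with a member of \<open>G\<close> on \<open>L\<close> but
  need not be one, as nothing is known outside \<open>L\<close>.\<close>

definition cmp :: "(complex \<Rightarrow> complex) \<Rightarrow> (complex \<Rightarrow> complex) \<Rightarrow> complex \<Rightarrow> complex" where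
  "cmp g h = (SOME k. k \<in> G \<and> (\<forall>x\<in>L. k x = g (h x)))"

lemma cmp:
  assumes "g \<in> G" "h \<in> G"
  shows cmp_G: "cmp g h \<in> G" and cmp_apply: "\<And>x. x \<in> L \<Longrightarrow> cmp g h x = g (h x)"
proof -
  have "cmp g h \<in> G \<and> (\<forall>x\<in>L. cmp g h x = g (h x))"
    unfolding cmp_def using comp[OF assms] by (intro someI_ex[of "\<lambda>k. k \<in> G \<and> (\<forall>x\<in>L. k x = g (h x))"]) auto
  then show "cmp g h \<in> G" "\<And>x. x \<in> L \<Longrightarrow> cmp g h x = g (h x)" by simp_all
qed

lemma cmp_stab:
  assumes "g \<in> stab F" "h \<in> stab F"
  shows "cmp g h \<in> stab F"
  using assms cmp[of g h] by (auto simp: stab_def)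

lemma bij_cmp_left:
  assumes "g \<in> stab F"
  shows "bij_betw (cmp g) (stab F) (stab F)"
proof -
  have "inj_on (cmp g) (stab F)"
  proof (rule inj_onI)
    fix h k assume hk: "h \<in> stab F" "k \<in> stab F" "cmp g h = cmp g k"
    show "h = k"
    proof (rule ext)
      fix x assume x: "x \<in> L"
      have "g (h x) = g (k x)"
        using cmp_apply[of g h x] cmp_apply[of g k x] hk x assms stab_G by auto
      then show "h x = k x" using hom_inj[of g "h x" "k x"] closed x hk assms stab_G by blast
    qed (use hk stab_G in auto)
  qed
  moreover have "cmp g ` stab F \<subseteq> stab F" using cmp_stab[OF assms] by auto
  ultimately show ?thesis
    using endo_inj_surj[OF finite_stab] by (auto simp: bij_betw_def)
qed

text \<open>Inverses come from finiteness: left translation is injective, hence onto, and so hits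
  the identity.\<close>

lemma stab_inverse:
  assumes "g \<in> stab F"
  shows "\<exists>h\<in>stab F. (\<forall>x\<in>L. g (h x) = x) \<and> (\<forall>x\<in>L. h (g x) = x)"
proof -
  obtain e where e: "e \<in> stab F" "\<forall>x\<in>L. e x = x" using stab_ident[of F] by (elim bexE)
  then obtain h where h: "h \<in> stab F" "cmp g h = e"
    using bij_betw_imp_surj_on[OF bij_cmp_left[OF assms]] by (metis imageE)
  have gh: "g (h x) = x" if "x \<in> L" for x
    using cmp_apply[OF stab_G[OF assms] stab_G[OF h(1)] that] h e that by simp
  have "h (g x) = x" if "x \<in> L" for x
  proof (rule hom_inj[OF stab_G[OF assms]])
    show "g (h (g x)) = g x" using gh closed[OF stab_G[OF assms] that] by simp
  qed (use closed stab_G assms h that in blast)+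
  then show ?thesis using h gh by blast
qed

lemma bij_cmp_right:
  assumes "g \<in> stab F"
  shows "bij_betw (\<lambda>h. cmp h g) (stab F) (stab F)"
proof -
  obtain g' where g': "g' \<in> stab F" "\<forall>x\<in>L. g (g' x) = x"
    using stab_inverse[OF assms] by (elim bexE conjE)
  have "inj_on (\<lambda>h. cmp h g) (stab F)"
  proof (rule inj_onI)
    fix h k assume hk: "h \<in> stab F" "k \<in> stab F" "cmp h g = cmp k g"
    show "h = k"
    proof (rule ext)
      fix x assume x: "x \<in> L"
      then have gx: "g' x \<in> L" using closed stab_G g' by blast
      have "h (g (g' x)) = k (g (g' x))"
        using cmp_apply[of h g "g' x"] cmp_apply[of k g "g' x"] hk gx assms stab_G by auto
      then show "h x = k x" using g' x by simp
    qed (use hk stab_G in auto)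
  qed
  moreover have "(\<lambda>h. cmp h g) ` stab F \<subseteq> stab F" using cmp_stab[OF _ assms] by auto
  ultimately show ?thesis
    using endo_inj_surj[OF finite_stab] by (auto simp: bij_betw_def)
qed

text \<open>The product of \<open>X - y\<close> over the orbit is invariant under the stabilizer, so
  its coefficients are in \<open>F\<close> and every conjugate is in the orbit. Conversely, an
  automorphism that fixes the coefficients of \<open>minp F x\<close> maps its roots to
  roots.\<close>

lemma orbit_eq_conjs:
  assumes F: "csubfield F" and x: "x \<in> L"
  shows "(\<lambda>g. g x) ` stab F = conjs F x"
proof
  interpret F: csubfield F by fact
  let ?O = "(\<lambda>g. g x) ` stab F"
  have fO: "finite ?O" using finite_stab by blast
  have OL: "?O \<subseteq> L" using closed stab_G x by blast
  have coeff_in: "coeff (\<Prod>y\<in>S. [:- y, 1:]) i \<in> L" if "S \<subseteq> L" for S i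
  proof -
    have "(\<Prod>y\<in>S. [:- y, 1:]) \<in> polys_over L"
      using that by (intro polys_prod polys_pCons neg polys_0 one) auto
    then show ?thesis by (simp add: polys_over_def)
  qed
  define p where "p = (\<Prod>y\<in>?O. [:- y, 1:])"
  have "p \<in> polys_over F"
    unfolding polys_over_def
  proof (intro CollectI allI)
    fix i
    show "coeff p i \<in> F"
    proof (rule fixed[OF F])
      show "coeff p i \<in> L" unfolding p_def by (rule coeff_in[OF OL])
      fix g assume "g \<in> G" "\<And>y. y \<in> F \<inter> L \<Longrightarrow> g y = y"
      then have g: "g \<in> stab F" by (simp add: stab_def)
      have img: "g ` ?O = ?O"
      proof (rule endo_inj_surj[OF fO])
        show "g ` ?O \<subseteq> ?O"
        proof clarify
          fix h assume h: "h \<in> stab F"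
          show "g (h x) \<in> ?O"
            using cmp_apply[OF stab_G[OF g] stab_G[OF h] x] cmp_stab[OF g h] by (metis image_eqI)
        qed
        show "inj_on g ?O"
          by (rule inj_onI) (use hom_inj[OF stab_G[OF g]] OL in blast)
      qed
      have "map_poly g (\<Prod>y\<in>S. [:- y, 1:]) = (\<Prod>y\<in>S. [:- g y, 1:])" if "finite S" "S \<subseteq> L" for S
        using that
      proof (induction S rule: finite_induct)
        case empty
        then show ?case using hom_one[OF stab_G[OF g]] hom_0[OF stab_G[OF g]] by (simp add: map_poly_1)
      next
        case (insert a S)
        define q where "q = (\<Prod>y\<in>S. [:- y, 1:])"
        have a: "a \<in> L" "S \<subseteq> L" using insert.prems by auto
        have q: "coeff q i \<in> L" for i unfolding q_def by (rule coeff_in[OF a(2)])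
        note g0 = hom_0[OF stab_G[OF g]]
        have "map_poly g ([:- a, 1:] * q) = [:- g a, 1:] * map_poly g q"
        proof (rule poly_eqI)
          fix i
          have e: "coeff ([:- b, 1:] * r) i = (if i = 0 then 0 else coeff r (i - 1)) - b * coeff r i" for b and r :: "complex poly"
            by (cases i) (simp_all add: coeff_pCons)
          have "coeff (map_poly g ([:- a, 1:] * q)) i = g (coeff ([:- a, 1:] * q) i)"
            by (rule coeff_map_poly[of g, OF g0])
          also have "\<dots> = (if i = 0 then 0 else g (coeff q (i - 1))) - g a * g (coeff q i)"
            unfolding e
            using hom_diff[OF stab_G[OF g], of "if i = 0 then 0 else coeff q (i - 1)" "a * coeff q i"]
              hom_mult[OF stab_G[OF g] a(1) q, of i] mult[OF a(1) q, of i] zero q g0 by (cases i) simp_all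
          also have "\<dots> = coeff ([:- g a, 1:] * map_poly g q) i"
            unfolding e by (simp only: coeff_map_poly[of g, OF g0])
          finally show "coeff (map_poly g ([:- a, 1:] * q)) i = coeff ([:- g a, 1:] * map_poly g q) i" .
        qed
        moreover have "map_poly g q = (\<Prod>y\<in>S. [:- g y, 1:])" unfolding q_def using insert.IH a by blast
        ultimately show ?case unfolding prod.insert[OF insert.hyps] q_def by (simp only:)
      qed
      from this[OF fO OL] have "map_poly g p = (\<Prod>y\<in>?O. [:- g y, 1:])" unfolding p_def .
      also have "\<dots> = (\<Prod>y\<in>g ` ?O. [:- y, 1:])"
        by (subst prod.reindex) (use hom_inj[OF stab_G[OF g]] OL in \<open>auto simp: inj_on_def\<close>)
      also have "\<dots> = p" unfolding img p_def ..
      finally have "coeff (map_poly g p) i = coeff p i" by (simp only:)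
      then show "g (coeff p i) = coeff p i"
        by (simp only: coeff_map_poly[of g, OF hom_0[OF stab_G[OF g]]])
    qed
  qed
  moreover have "poly p x = 0"
  proof -
    obtain e where "e \<in> stab F" "\<forall>x\<in>L. e x = x" using stab_ident[of F] by (elim bexE)
    then have "x \<in> ?O" using x by (metis image_eqI)
    then show ?thesis using fO unfolding p_def poly_prod by (intro prod_zero) auto
  qed
  ultimately show sub: "conjs F x \<subseteq> ?O"
  proof (intro subsetI)
    fix y assume "p \<in> polys_over F" "poly p x = 0" "y \<in> conjs F x"
    then have "poly p y = 0" by (rule F.poly_conjs[OF alg[OF x]])
    then have "\<exists>a\<in>?O. poly [:- a, 1:] y = 0"
      unfolding p_def poly_prod using fO by (simp only: prod_zero_iff)
    then show "y \<in> ?O" by auto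
  qed
  show "?O \<subseteq> conjs F x"
  proof clarify
    fix g assume g: "g \<in> stab F"
    let ?m = "minp F x"
    \<comment> \<open>By the first inclusion all conjugates lie in \<open>L\<close>, hence so do the
      coefficients; being in \<open>F\<close> as well, they are fixed by \<open>g\<close>.\<close>
    have mL: "coeff ?m i \<in> L" for i
      using F.minp_eq_prod[OF alg[OF x]] coeff_in sub OL by (metis order_trans)
    have mF: "coeff ?m i \<in> F" for i
      using F.minp_poly[OF alg[OF x]] by (simp add: polys_over_def)
    have "0 = g (poly ?m x)" using F.minp_root[OF alg[OF x]] hom_0[OF stab_G[OF g]] by simp
    also have "\<dots> = (\<Sum>i\<le>degree ?m. g (coeff ?m i) * g x ^ i)"
      using mL by (intro hom_poly stab_G[OF g] x) (simp add: polys_over_def)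
    also have "\<dots> = poly ?m (g x)"
      unfolding poly_altdef by (intro sum.cong refl) (simp add: stab_fix[OF g mF mL])
    finally show "g x \<in> conjs F x" by (simp add: conjs_def)
  qed
qed

text \<open>The elements with \<open>g x = y\<close> form a left coset of the stabilizer of
  \<open>x\<close>, translated by any \<open>h\<close> with \<open>h x = y\<close>.\<close>

lemma fiber:
  assumes "csubfield F" "x \<in> L"
  shows "\<exists>n>0. \<forall>y\<in>conjs F x. card {g\<in>stab F. g x = y} = n"
proof (intro exI conjI ballI)
  let ?S = "{g\<in>stab F. g x = x}"
  obtain e where "e \<in> stab F" "\<forall>x\<in>L. e x = x" using stab_ident[of F] by (elim bexE)
  then have e: "e \<in> ?S" using assms by simp
  have fin_S: "finite ?S" by (rule finite_subset[OF _ finite_stab[of F]]) (rule Collect_restrict)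
  show "card ?S > 0"
  proof (rule ccontr)
    assume "\<not> card ?S > 0"
    then have "?S = {}" using fin_S by (simp only: not_gr_zero card_0_eq)
    then show False using e by (simp only: empty_iff)
  qed
  fix y assume "y \<in> conjs F x"
  then obtain h where h: "h \<in> stab F" "h x = y"
    using orbit_eq_conjs[OF assms] by (metis imageE)
  have "bij_betw (cmp h) ?S {g\<in>stab F. g x = y}"
  proof (rule bij_betw_imageI)
    show "inj_on (cmp h) ?S"
      using bij_betw_imp_inj_on[OF bij_cmp_left[OF h(1)]] by (rule inj_on_subset) auto
    show "cmp h ` ?S = {g\<in>stab F. g x = y}"
    proof (intro equalityI subsetI)
      fix k assume "k \<in> cmp h ` ?S"
      then show "k \<in> {g\<in>stab F. g x = y}"
        using h cmp_stab[OF h(1)] cmp_apply[OF stab_G[OF h(1)] stab_G assms(2)] by auto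
    next
      fix k assume k: "k \<in> {g\<in>stab F. g x = y}"
      then obtain g where g: "g \<in> stab F" "k = cmp h g"
        using bij_betw_imp_surj_on[OF bij_cmp_left[OF h(1)]] by (metis (mono_tags) imageE mem_Collect_eq)
      have "h (g x) = h x"
        using k g h cmp_apply[OF stab_G[OF h(1)] stab_G[OF g(1)] assms(2)] by simp
      then have "g x = x"
        using hom_inj[OF stab_G[OF h(1)]] closed[OF stab_G[OF g(1)] assms(2)] assms(2) by blast
      then show "k \<in> cmp h ` ?S" using g by blast
    qed
  qed
  then show "card {g\<in>stab F. g x = y} = card ?S" using bij_betw_same_card by fastforce
qed

text \<open>Passes between quantities indexed by the group, which share one index set for all
  elements of \<open>L\<close>, and quantities indexed by conjugates, which do not depend on
  \<open>L\<close>.\<close>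

lemma fiber_prod:
  assumes "csubfield F" "x \<in> L"
  shows "\<exists>n>0. card (stab F) = n * card (conjs F x) \<and>
    (\<forall>\<phi> :: complex \<Rightarrow> complex. (\<Prod>g\<in>stab F. \<phi> (g x)) = (\<Prod>y\<in>conjs F x. \<phi> y) ^ n) \<and>
    (\<forall>\<phi> :: complex \<Rightarrow> real. (\<Sum>g\<in>stab F. \<phi> (g x)) = real n * (\<Sum>y\<in>conjs F x. \<phi> y)) \<and>
    (\<forall>y\<in>conjs F x. card {g\<in>stab F. g x = y} = n)"
proof -
  obtain n where n: "n > 0" "\<And>y. y \<in> conjs F x \<Longrightarrow> card {g\<in>stab F. g x = y} = n"
    using fiber[OF assms] by (elim exE conjE) blast
  have img: "(\<lambda>g. g x) ` stab F \<subseteq> conjs F x" using orbit_eq_conjs[OF assms] by simp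
  have fc: "finite (conjs F x)" by (rule csubfield.finite_conjs[OF assms(1) alg[OF assms(2)]])
  have "(\<Prod>g\<in>stab F. \<phi> (g x)) = (\<Prod>y\<in>conjs F x. \<phi> y) ^ n" for \<phi> :: "complex \<Rightarrow> complex"
  proof -
    have "(\<Prod>g\<in>stab F. \<phi> (g x)) = (\<Prod>y\<in>conjs F x. \<Prod>g\<in>{g\<in>stab F. g x = y}. \<phi> (g x))"
      by (rule prod.group[OF finite_stab fc img, symmetric])
    also have "\<dots> = (\<Prod>y\<in>conjs F x. \<phi> y ^ n)" using n(2) by (intro prod.cong refl) simp
    finally show ?thesis by (simp add: prod_power_distrib)
  qed
  moreover have "(\<Sum>g\<in>stab F. \<phi> (g x)) = real n * (\<Sum>y\<in>conjs F x. \<phi> y)" for \<phi> :: "complex \<Rightarrow> real"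
  proof -
    have "(\<Sum>g\<in>stab F. \<phi> (g x)) = (\<Sum>y\<in>conjs F x. \<Sum>g\<in>{g\<in>stab F. g x = y}. \<phi> (g x))"
      by (rule sum.group[OF finite_stab fc img, symmetric])
    also have "\<dots> = (\<Sum>y\<in>conjs F x. real n * \<phi> y)" using n(2) by (intro sum.cong refl) simp
    finally show ?thesis by (simp add: sum_distrib_left)
  qed
  moreover from this[of "\<lambda>_. 1"] have "real (card (stab F)) = real (n * card (conjs F x))" by simp
  then have "card (stab F) = n * card (conjs F x)" by (simp only: of_nat_eq_iff)
  ultimately show ?thesis using n by blast
qed

lemma stab_Rats: "stab \<rat> = G"
proof -
  have "g y = y" if that: "g \<in> G" "y \<in> \<rat>" for g y
  proof -
    note y = that(2)
    have int: "g (of_nat n) = of_nat n" for n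
      by (induction n) (simp_all add: hom_0[OF that(1)] hom_one[OF that(1)] hom_add[OF that(1)] one of_nat)
    have int': "g (of_int n) = of_int n" for n
      using int[of "nat n"] int[of "nat (- n)"] hom_neg[OF that(1) of_nat, of "nat (- n)"]
      by (cases "n \<ge> 0") simp_all
    obtain a b :: int where "b > 0" "y = of_int a / of_int b" using y by (rule Rats_cases')
    then show ?thesis
      using int' hom_mult[OF that(1) of_int inv[OF of_int], of a b] hom_inverse[OF that(1) of_int, of b]
      by (simp add: divide_inverse)
  qed
  then show ?thesis by (auto simp: stab_def)
qed

end

subsection \<open>Existence of normal extensions\<close>

text \<open>The homomorphism on \<open>adj \<theta>\<close> that sends \<theta> to \<eta>. The
  choice of the polynomial does not matter when \<eta> is a conjugate of \<theta>.\<close>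

definition aut :: "complex \<Rightarrow> complex \<Rightarrow> complex \<Rightarrow> complex" where
  "aut \<theta> \<eta> x = poly (SOME p. p \<in> polys_over \<rat> \<and> poly p \<theta> = x) \<eta>"

lemma aut_poly:
  assumes "algebraic \<theta>" "\<eta> \<in> conjs \<rat> \<theta>" "p \<in> polys_over \<rat>"
  shows "aut \<theta> \<eta> (poly p \<theta>) = poly p \<eta>"
proof -
  interpret Q: csubfield \<rat> by (rule csubfield_Rats)
  define q where "q = (SOME q. q \<in> polys_over \<rat> \<and> poly q \<theta> = poly p \<theta>)"
  have q: "q \<in> polys_over \<rat> \<and> poly q \<theta> = poly p \<theta>"
    unfolding q_def by (rule someI[of _ p]) (use assms in simp)
  then have "poly (q - p) \<theta> = 0" by simp
  then have "poly (q - p) \<eta> = 0"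
    by (rule Q.poly_conjs[OF assms(1) Q.polys_diff[OF conjunct1[OF q] assms(3)] _ assms(2)])
  then show ?thesis by (simp add: aut_def q_def)
qed

lemma aut_hom:
  assumes "algebraic \<theta>" "\<eta> \<in> conjs \<rat> \<theta>" "x \<in> adj \<theta>" "y \<in> adj \<theta>"
  shows aut_diff: "aut \<theta> \<eta> (x - y) = aut \<theta> \<eta> x - aut \<theta> \<eta> y"
    and aut_add: "aut \<theta> \<eta> (x + y) = aut \<theta> \<eta> x + aut \<theta> \<eta> y"
    and aut_mult: "aut \<theta> \<eta> (x * y) = aut \<theta> \<eta> x * aut \<theta> \<eta> y"
    and aut_one: "aut \<theta> \<eta> 1 = 1"
    and aut_self: "aut \<theta> \<eta> \<theta> = \<eta>"
proof -
  interpret Q: csubfield \<rat> by (rule csubfield_Rats)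
  obtain p q where pq: "p \<in> polys_over \<rat>" "q \<in> polys_over \<rat>" "x = poly p \<theta>" "y = poly q \<theta>"
    using assms(3,4) by (auto simp: adj_def)
  note ev = aut_poly[OF assms(1,2)]
  show "aut \<theta> \<eta> (x - y) = aut \<theta> \<eta> x - aut \<theta> \<eta> y"
    using ev[OF Q.polys_diff[OF pq(1,2)]] ev[OF pq(1)] ev[OF pq(2)] pq by simp
  show "aut \<theta> \<eta> (x + y) = aut \<theta> \<eta> x + aut \<theta> \<eta> y"
    using ev[OF Q.polys_add[OF pq(1,2)]] ev[OF pq(1)] ev[OF pq(2)] pq by simp
  show "aut \<theta> \<eta> (x * y) = aut \<theta> \<eta> x * aut \<theta> \<eta> y"
    using ev[OF Q.polys_mult[OF pq(1,2)]] ev[OF pq(1)] ev[OF pq(2)] pq by simp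
  show "aut \<theta> \<eta> 1 = 1" using ev[OF Q.polys_const[OF Q.one]] by simp
  show "aut \<theta> \<eta> \<theta> = \<eta>"
    using ev[OF Q.polys_pCons[OF Q.zero Q.polys_const[OF Q.one]]] by simp
qed

lemma aut_inverse:
  assumes "algebraic \<theta>" "\<eta> \<in> conjs \<rat> \<theta>" "x \<in> adj \<theta>"
  shows "aut \<theta> \<eta> (inverse x) = inverse (aut \<theta> \<eta> x)"
proof (cases "x = 0")
  case True
  have "aut \<theta> \<eta> (1 - 1) = 0"
    using aut_diff[OF assms(1,2), of 1 1] csubfield.one[OF csubfield_adj[OF assms(1)]] by simp
  then show ?thesis using True by simp
next
  case False
  have "inverse x \<in> adj \<theta>" by (rule csubfield.inv[OF csubfield_adj[OF assms(1)] assms(3)])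
  from aut_mult[OF assms this] False have "aut \<theta> \<eta> x * aut \<theta> \<eta> (inverse x) = 1"
    using aut_one[OF assms assms(3)] by simp
  then show ?thesis using inverse_unique by fastforce
qed

text \<open>Each conjugate gives one automorphism, and the restriction turns agreement on the field
  into equality of functions. For the fixed field, write \<open>x\<close> as the value of
  \<open>p\<close> at \<theta> and reduce \<open>p\<close> modulo \<open>minp F \<theta>\<close> to
  a remainder \<open>r\<close> over \<open>F\<close>. It takes the value \<open>x\<close> at all
  conjugates of \<theta> over \<open>F\<close>, which are more points than its degree allows unless
  it is the constant \<open>x\<close>.\<close>

lemma galois_of_primitive:
  assumes alg: "algebraic \<theta>" and normal: "conjs \<rat> \<theta> \<subseteq> adj \<theta>"
  shows "galois (adj \<theta>) ((\<lambda>\<eta>. restrict (aut \<theta> \<eta>) (adj \<theta>)) ` conjs \<rat> \<theta>)"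
    (is "galois ?L ?G")
proof -
  interpret Q: csubfield \<rat> by (rule csubfield_Rats)
  interpret L: csubfield ?L by (rule csubfield_adj[OF alg])
  have closed: "aut \<theta> \<eta> x \<in> ?L" if that: "\<eta> \<in> conjs \<rat> \<theta>" "x \<in> ?L" for \<eta> x
  proof -
    note x = that(2)
    obtain p where p: "p \<in> polys_over \<rat>" "x = poly p \<theta>" using x by (auto simp: adj_def)
    then have "poly p \<eta> \<in> ?L"
      using polys_over_mono[OF L.Rats_subset] normal that(1) by (intro L.poly_in) auto
    then show ?thesis using aut_poly[OF alg that(1) p(1)] p(2) by simp
  qed
  show ?thesis
  proof
    show "algebraic x" if "x \<in> ?L" for x by (rule adj_algebraic[OF alg that])
    show "finite ?G" using Q.finite_conjs[OF alg] by blast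
    fix g assume "g \<in> ?G"
    then obtain \<eta> where \<eta>: "\<eta> \<in> conjs \<rat> \<theta>" "g = restrict (aut \<theta> \<eta>) ?L" by blast
    show "g x \<in> ?L" if "x \<in> ?L" for x using closed \<eta> that by simp
    show "g (x - y) = g x - g y" "g (x * y) = g x * g y" if "x \<in> ?L" "y \<in> ?L" for x y
      using aut_hom[OF alg \<eta>(1) that] \<eta>(2) that L.diff L.mult by simp_all
    show "g 1 = 1" using aut_one[OF alg \<eta>(1) L.one L.one] \<eta>(2) L.one by simp
    fix h assume "h \<in> ?G"
    then obtain \<eta>' where \<eta>': "\<eta>' \<in> conjs \<rat> \<theta>" "h = restrict (aut \<theta> \<eta>') ?L" by blast
    show "g = h" if "\<And>x. x \<in> ?L \<Longrightarrow> g x = h x"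
      using that \<eta>(2) \<eta>'(2) by (auto intro!: restrict_ext)
    show "\<exists>k\<in>?G. \<forall>x\<in>?L. k x = g (h x)"
    proof -
      \<comment> \<open>With \<open>\<eta>' = poly r \<theta>\<close>, the composite automorphism
        sends \<theta> to \<open>poly r \<eta>\<close>.\<close>
      obtain r where r: "r \<in> polys_over \<rat>" "\<eta>' = poly r \<theta>"
        using \<eta>'(1) normal by (auto simp: adj_def)
      have "poly (pcompose (minp \<rat> \<theta>) r) \<theta> = 0"
        using \<eta>'(1) r(2) by (simp add: poly_pcompose conjs_def)
      then have "poly (pcompose (minp \<rat> \<theta>) r) \<eta> = 0"
        by (rule Q.poly_conjs[OF alg Q.polys_pcompose[OF Q.minp_poly[OF alg] r(1)] _ \<eta>(1)])
      then have I: "poly r \<eta> \<in> conjs \<rat> \<theta>" by (simp add: poly_pcompose conjs_def)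
      have "aut \<theta> (poly r \<eta>) x = g (h x)" if x: "x \<in> ?L" for x
      proof -
        obtain p where p: "p \<in> polys_over \<rat>" "x = poly p \<theta>" using x by (auto simp: adj_def)
        have "h x = poly (pcompose p r) \<theta>"
          using aut_poly[OF alg \<eta>'(1) p(1)] p x \<eta>'(2) r(2) by (simp add: poly_pcompose)
        moreover have "h x \<in> ?L" using closed[OF \<eta>'(1) x] \<eta>'(2) x by simp
        ultimately have "g (h x) = poly (pcompose p r) \<eta>"
          using aut_poly[OF alg \<eta>(1) Q.polys_pcompose[OF p(1) r(1)]] \<eta>(2) by simp
        then show ?thesis using aut_poly[OF alg I p(1)] p(2) by (simp add: poly_pcompose)
      qed
      then show ?thesis using I by (intro bexI[of _ "restrict (aut \<theta> (poly r \<eta>)) ?L"]) auto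
    qed
  next
    have "aut \<theta> \<theta> x = x" if "x \<in> ?L" for x
    proof -
      obtain p where p: "p \<in> polys_over \<rat>" "x = poly p \<theta>" using \<open>x \<in> ?L\<close> by (auto simp: adj_def)
      then show ?thesis using aut_poly[OF alg Q.self_conjs[OF alg] p(1)] by simp
    qed
    then show "\<exists>e\<in>?G. \<forall>x\<in>?L. e x = x"
      using Q.self_conjs[OF alg] by (intro bexI[of _ "restrict (aut \<theta> \<theta>) ?L"]) auto
  next
    fix F x
    assume F: "csubfield F" and x: "x \<in> ?L"
      and fix_x: "\<And>g. g \<in> ?G \<Longrightarrow> (\<And>y. y \<in> F \<inter> ?L \<Longrightarrow> g y = y) \<Longrightarrow> g x = x"
    interpret F: csubfield F by fact
    have sub: "conjs F \<theta> \<subseteq> conjs \<rat> \<theta>" by (rule F.conjs_mono[OF csubfield_Rats F.Rats_subset alg])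
    obtain p where p: "p \<in> polys_over \<rat>" "x = poly p \<theta>" using x by (auto simp: adj_def)
    have px: "poly p \<eta> = x" if \<eta>: "\<eta> \<in> conjs F \<theta>" for \<eta>
    proof -
      have \<eta>Q: "\<eta> \<in> conjs \<rat> \<theta>" using sub \<eta> by blast
      have "restrict (aut \<theta> \<eta>) ?L x = x"
      proof (rule fix_x)
        show "restrict (aut \<theta> \<eta>) ?L \<in> ?G" using \<eta>Q by (rule imageI)
        fix y assume y: "y \<in> F \<inter> ?L"
        then obtain q where q: "q \<in> polys_over \<rat>" "y = poly q \<theta>" by (auto simp: adj_def)
        have "q - [:y:] \<in> polys_over F"
          using q(1) polys_over_mono[OF F.Rats_subset] y by (intro F.polys_diff F.polys_const) auto
        moreover have "poly (q - [:y:]) \<theta> = 0" using q(2) by simp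
        ultimately have "poly (q - [:y:]) \<eta> = 0" by (rule F.poly_conjs[OF alg _ _ \<eta>])
        then show "restrict (aut \<theta> \<eta>) ?L y = y"
          using aut_poly[OF alg \<eta>Q q(1)] q(2) y by simp
      qed
      then show ?thesis using aut_poly[OF alg \<eta>Q p(1)] p(2) x by simp
    qed
    have "p \<in> polys_over F" using p(1) polys_over_mono[OF F.Rats_subset] by blast
    from F.polys_division[OF F.minp_poly[OF alg] F.minp_nz[OF alg] this]
    obtain q r where qr: "q \<in> polys_over F" "r \<in> polys_over F" "p = q * minp F \<theta> + r"
      "r = 0 \<or> degree r < degree (minp F \<theta>)"
      by (elim bexE conjE)
    have "poly (r - [:x:]) \<eta> = 0" if "\<eta> \<in> conjs F \<theta>" for \<eta>
    proof -
      have "poly p \<eta> = poly r \<eta>" unfolding qr(3) using that by (simp add: conjs_def)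
      then show ?thesis using px[OF that] by simp
    qed
    then have roots: "conjs F \<theta> \<subseteq> {\<eta>. poly (r - [:x:]) \<eta> = 0}" by blast
    have "r - [:x:] = 0"
    proof (rule ccontr)
      assume nz: "r - [:x:] \<noteq> 0"
      have "card (conjs F \<theta>) \<le> card {\<eta>. poly (r - [:x:]) \<eta> = 0}"
        by (rule card_mono[OF poly_roots_finite[OF nz] roots])
      also have "\<dots> \<le> degree (r - [:x:])" by (rule card_poly_roots_bound[OF nz])
      also have "\<dots> < degree (minp F \<theta>)"
        using qr(4) F.degree_minp_pos[OF alg]
        by (intro degree_diff_less) auto
      finally show False using F.degree_minp[OF alg] by simp
    qed
    then have "coeff r 0 = x" by (metis coeff_pCons_0 eq_iff_diff_eq_0)
    then show "x \<in> F" using qr(2) by (auto simp: polys_over_def)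
  qed
qed

text \<open>Let \<theta> generate the field of all conjugates \<open>S\<close> of elements of
  \<open>A\<close>. For a conjugate \<eta> of \<theta>, the elements that the embedding sending
  \<theta> to \<eta> maps back into \<open>adj \<theta>\<close> form a field. It contains
  \<open>S\<close>, because conjugates go to conjugates; hence it contains \<theta>, and \<eta> lies
  in \<open>adj \<theta>\<close>.\<close>

lemma galois_exists:
  assumes "finite A" "A \<subseteq> Qbar"
  shows "\<exists>L G. galois L G \<and> A \<subseteq> L"
proof -
  interpret Q: csubfield \<rat> by (rule csubfield_Rats)
  define S where "S = (\<Union>a\<in>A. conjs \<rat> a)"
  have algA: "algebraic a" if "a \<in> A" for a using that assms(2) by (auto simp: Qbar_def)
  have "finite S" unfolding S_def using assms(1) Q.finite_conjs[OF algA] by blast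
  moreover have "S \<subseteq> Qbar" using Q.algebraic_conjs[OF algA] by (auto simp: S_def Qbar_def)
  ultimately obtain \<theta> where \<theta>: "algebraic \<theta>" "S \<subseteq> adj \<theta>"
    and gen: "\<And>F. csubfield F \<Longrightarrow> S \<subseteq> F \<Longrightarrow> \<theta> \<in> F"
    using primitive_element[of S] by blast
  interpret L: csubfield "adj \<theta>" by (rule csubfield_adj[OF \<theta>(1)])
  have "conjs \<rat> \<theta> \<subseteq> adj \<theta>"
  proof
    fix \<eta> assume \<eta>: "\<eta> \<in> conjs \<rat> \<theta>"
    define E where "E = {x \<in> adj \<theta>. aut \<theta> \<eta> x \<in> adj \<theta>}"
    have "csubfield E"
    proof
      show "1 \<in> E" unfolding E_def using aut_one[OF \<theta>(1) \<eta> L.one L.one] L.one by simp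
      show "x - y \<in> E" "x * y \<in> E" if "x \<in> E" "y \<in> E" for x y
        using that aut_hom[OF \<theta>(1) \<eta>, of x y] L.diff L.mult by (simp_all add: E_def)
      show "inverse x \<in> E" if "x \<in> E" for x
        using that aut_inverse[OF \<theta>(1) \<eta>, of x] L.inv by (simp add: E_def)
    qed
    moreover have "S \<subseteq> E"
    proof
      fix s assume s: "s \<in> S"
      then obtain a where a: "a \<in> A" "s \<in> conjs \<rat> a" by (auto simp: S_def)
      obtain r where r: "r \<in> polys_over \<rat>" "s = poly r \<theta>" using s \<theta>(2) by (auto simp: adj_def)
      have "poly (pcompose (minp \<rat> a) r) \<theta> = 0" using a(2) r(2) by (simp add: poly_pcompose conjs_def)
      then have "poly (pcompose (minp \<rat> a) r) \<eta> = 0"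
        by (rule Q.poly_conjs[OF \<theta>(1) Q.polys_pcompose[OF Q.minp_poly[OF algA[OF a(1)]] r(1)] _ \<eta>])
      then have "aut \<theta> \<eta> s \<in> conjs \<rat> a"
        using aut_poly[OF \<theta>(1) \<eta> r(1)] r(2) by (simp add: poly_pcompose conjs_def)
      then have "aut \<theta> \<eta> s \<in> S" using a(1) by (auto simp: S_def)
      then show "s \<in> E" using s \<theta>(2) by (auto simp: E_def)
    qed
    ultimately have "\<theta> \<in> E" by (rule gen)
    then show "\<eta> \<in> adj \<theta>" using aut_self[OF \<theta>(1) \<eta> L.one L.one] by (simp add: E_def)
  qed
  then have "galois (adj \<theta>) ((\<lambda>\<eta>. restrict (aut \<theta> \<eta>) (adj \<theta>)) ` conjs \<rat> \<theta>)"
    by (rule galois_of_primitive[OF \<theta>(1)])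
  moreover have "A \<subseteq> adj \<theta>"
    using Q.self_conjs[OF algA] \<theta>(2) by (auto simp: S_def)
  ultimately show ?thesis by blast
qed

subsection \<open>Bounds for the height\<close>

lemma log_plus_nonneg: "log_plus t \<ge> 0"
  by (simp add: log_plus_def)

lemma log_plus_mult:
  assumes "a \<ge> 0" "b \<ge> 0"
  shows "log_plus (a * b) \<le> log_plus a + log_plus b"
proof -
  have "1 \<le> max 1 a * max 1 b" using mult_mono[of 1 "max 1 a" 1 "max 1 b"] by simp
  moreover have "a * b \<le> max 1 a * max 1 b" using assms by (intro mult_mono) auto
  ultimately have "ln (max 1 (a * b)) \<le> ln (max 1 a * max 1 b)" by simp
  also have "\<dots> = ln (max 1 a) + ln (max 1 b)" by (simp add: ln_mult)
  finally show ?thesis by (simp add: log_plus_def)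
qed

lemma log_plus_power:
  assumes "a \<ge> 0"
  shows "log_plus (a ^ n) = real n * log_plus a"
proof (cases "a \<ge> 1")
  case True
  then have "max 1 (a ^ n) = a ^ n" using one_le_power[of a n] by simp
  then show ?thesis using True by (simp add: log_plus_def ln_realpow)
next
  case False
  then have "max 1 (a ^ n) = 1" using assms power_le_one[of a n] by simp
  then show ?thesis using False by (simp add: log_plus_def)
qed

lemma log_plus_inverse:
  assumes "a > 0"
  shows "log_plus (inverse a) = log_plus a - ln a"
proof (cases "a \<ge> 1")
  case True
  then have "inverse a \<le> 1" by (simp add: field_simps)
  then show ?thesis using True by (simp add: log_plus_def)
next
  case False
  then have "inverse a \<ge> 1" using assms by (simp add: field_simps)
  then show ?thesis using False assms by (simp add: log_plus_def ln_inverse max_absorb2)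
qed

text \<open>
  \<open>height_le x r\<close> says that the absolute logarithmic height of \<open>x\<close> is at most \<open>r\<close>: a positive integer
  \<open>c\<close> all of whose products with products of conjugates of \<open>x\<^sup>k\<close> are integral bounds the
  contribution of the finite places of \<open>x\<^sup>k\<close>. Admitting \<open>k > 1\<close> makes it evident that heights
  scale under powers.
\<close>

definition height_le :: "complex \<Rightarrow> real \<Rightarrow> bool" where
  "height_le x r \<longleftrightarrow> (\<exists>k c :: nat. k > 0 \<and> c > 0 \<and>
     (\<forall>S\<subseteq>conjs \<rat> x. algebraic_int (of_nat c * (\<Prod>y\<in>S. y ^ k))) \<and>
     ln (real c) / real k + (\<Sum>y\<in>conjs \<rat> x. log_plus (norm y)) \<le> r * real (card (conjs \<rat> x)))"

lemma height_leE:
  assumes "height_le x r"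
  obtains k c :: nat where "k > 0" "c > 0"
    "\<And>S. S \<subseteq> conjs \<rat> x \<Longrightarrow> algebraic_int (of_nat c * (\<Prod>y\<in>S. y ^ k))"
    "ln (real c) / real k + (\<Sum>y\<in>conjs \<rat> x. log_plus (norm y)) \<le> r * real (card (conjs \<rat> x))"
  using assms unfolding height_le_def by (elim exE conjE) simp

section \<open>Height bounds relative to a Galois group\<close>

context galois
begin

text \<open>The bound of \<open>height_le\<close> with one conjugate for each group element,
  repetitions included. Two elements of \<open>L\<close> then have a common index set, which the
  estimate for products requires.\<close>

definition fam_le :: "complex \<Rightarrow> real \<Rightarrow> bool" where
  "fam_le x r \<longleftrightarrow> (\<exists>k c :: nat. k > 0 \<and> c > 0 \<and>
     (\<forall>S\<subseteq>G. algebraic_int (of_nat c * (\<Prod>g\<in>S. g x ^ k))) \<and>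
     ln (real c) / real k + (\<Sum>g\<in>G. log_plus (norm (g x))) \<le> r * real (card G))"

lemma fam_leI:
  assumes "k > 0" "c > 0" "\<And>S. S \<subseteq> G \<Longrightarrow> algebraic_int (of_nat c * (\<Prod>g\<in>S. g x ^ k))"
    "ln (real c) / real k + (\<Sum>g\<in>G. log_plus (norm (g x))) \<le> r * real (card G)"
  shows "fam_le x r"
  unfolding fam_le_def using assms by (intro exI[of _ k] exI[of _ c]) simp

lemma fam_leE:
  assumes "fam_le x r"
  obtains k c :: nat where "k > 0" "c > 0" "\<And>S. S \<subseteq> G \<Longrightarrow> algebraic_int (of_nat c * (\<Prod>g\<in>S. g x ^ k))"
    "ln (real c) / real k + (\<Sum>g\<in>G. log_plus (norm (g x))) \<le> r * real (card G)"
  using assms unfolding fam_le_def by (elim exE conjE) simp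

text \<open>A subset of the group hits a conjugate \<open>y\<close> some \<open>m y \<le> n\<close>
  times. The product over it splits into \<open>n\<close> layers, layer \<open>j\<close> consisting
  of the conjugates hit more than \<open>j\<close> times. The integer \<open>c\<close> serves each
  layer, so \<open>c ^ n\<close> serves the whole.\<close>

lemma fam_le_if_height_le:
  assumes x: "x \<in> L" and h: "height_le x r"
  shows "fam_le x r"
proof -
  let ?C = "conjs \<rat> x"
  have fc: "finite ?C" by (rule csubfield.finite_conjs[OF csubfield_Rats alg[OF x]])
  obtain n where n: "n > 0" "card G = n * card ?C"
    "\<And>\<phi> :: complex \<Rightarrow> real. (\<Sum>g\<in>G. \<phi> (g x)) = real n * (\<Sum>y\<in>?C. \<phi> y)"
    "\<And>y. y \<in> ?C \<Longrightarrow> card {g\<in>G. g x = y} = n"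
    using fiber_prod[OF csubfield_Rats x] unfolding stab_Rats by (elim exE conjE) simp
  obtain k c :: nat where kc: "k > 0" "c > 0"
    "\<And>S. S \<subseteq> ?C \<Longrightarrow> algebraic_int (of_nat c * (\<Prod>y\<in>S. y ^ k))"
    "ln (real c) / real k + (\<Sum>y\<in>?C. log_plus (norm y)) \<le> r * real (card ?C)"
    using height_leE[OF h] by blast
  show ?thesis
  proof (rule fam_leI[of k "c ^ n"])
    show "k > 0" "c ^ n > 0" using kc(1,2) by auto
    show "ln (real (c ^ n)) / real k + (\<Sum>g\<in>G. log_plus (norm (g x))) \<le> r * real (card G)"
    proof -
      have "ln (real (c ^ n)) / real k + (\<Sum>g\<in>G. log_plus (norm (g x)))
          = real n * (ln (real c) / real k + (\<Sum>y\<in>?C. log_plus (norm y)))"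
        using n(3)[of "\<lambda>y. log_plus (norm y)"] kc(2) by (simp add: ln_realpow distrib_left)
      also have "\<dots> \<le> real n * (r * real (card ?C))"
        using kc(4) by (intro mult_left_mono) auto
      finally show ?thesis using n(2) by (simp add: mult_ac)
    qed
    fix S assume S: "S \<subseteq> G"
    define m where "m y = card {g\<in>S. g x = y}" for y
    have fS: "finite S" using S fin finite_subset by blast
    have mn: "m y \<le> n" if "y \<in> ?C" for y
      unfolding m_def n(4)[OF that, symmetric] using S fin by (intro card_mono) auto
    have img: "(\<lambda>g. g x) ` S \<subseteq> ?C"
      using orbit_eq_conjs[OF csubfield_Rats x] S unfolding stab_Rats by blast
    have "(\<Prod>g\<in>S. g x ^ k) = (\<Prod>y\<in>?C. \<Prod>g\<in>{g\<in>S. g x = y}. g x ^ k)"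
      by (rule prod.group[OF fS fc img, symmetric])
    also have "\<dots> = (\<Prod>y\<in>?C. (y ^ k) ^ m y)"
      by (intro prod.cong refl) (simp add: m_def)
    also have "\<dots> = (\<Prod>y\<in>?C. \<Prod>j<n. if j < m y then y ^ k else 1)"
    proof (intro prod.cong refl)
      fix y assume "y \<in> ?C"
      then have "{..<n} \<inter> {j. j < m y} = {..<m y}" using mn by fastforce
      then show "(y ^ k) ^ m y = (\<Prod>j<n. if j < m y then y ^ k else 1)"
        by (simp add: prod.If_cases)
    qed
    also have "\<dots> = (\<Prod>j<n. \<Prod>y\<in>?C. if j < m y then y ^ k else 1)" by (rule prod.swap)
    also have "\<dots> = (\<Prod>j<n. \<Prod>y\<in>{y\<in>?C. j < m y}. y ^ k)"
      by (rule prod.cong[OF refl]) (rule prod.inter_filter[OF fc, symmetric])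
    finally have "of_nat (c ^ n) * (\<Prod>g\<in>S. g x ^ k) = (\<Prod>j<n. of_nat c * (\<Prod>y\<in>{y\<in>?C. j < m y}. y ^ k))"
      by (simp add: prod.distrib)
    also have "algebraic_int \<dots>" by (intro algebraic_int_prod kc(3)) auto
    finally show "algebraic_int (of_nat (c ^ n) * (\<Prod>g\<in>S. g x ^ k))" .
  qed
qed

text \<open>A set of conjugates is lifted to its full preimage, in which each conjugate occurs
  \<open>n\<close> times. The exponent \<open>k * n\<close> absorbs this multiplicity; with exponent
  \<open>k\<close> an \<open>n\<close>-th root of \<open>c\<close> would be called for.\<close>

lemma height_le_if_fam_le:
  assumes x: "x \<in> L" and h: "fam_le x r"
  shows "height_le x r"
proof -
  let ?C = "conjs \<rat> x"
  have fc: "finite ?C" by (rule csubfield.finite_conjs[OF csubfield_Rats alg[OF x]])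
  obtain n where n: "n > 0" "card G = n * card ?C"
    "\<And>\<phi> :: complex \<Rightarrow> real. (\<Sum>g\<in>G. \<phi> (g x)) = real n * (\<Sum>y\<in>?C. \<phi> y)"
    "\<And>y. y \<in> ?C \<Longrightarrow> card {g\<in>G. g x = y} = n"
    using fiber_prod[OF csubfield_Rats x] unfolding stab_Rats by (elim exE conjE) simp
  obtain k c :: nat where kc: "k > 0" "c > 0"
    "\<And>S. S \<subseteq> G \<Longrightarrow> algebraic_int (of_nat c * (\<Prod>g\<in>S. g x ^ k))"
    "ln (real c) / real k + (\<Sum>g\<in>G. log_plus (norm (g x))) \<le> r * real (card G)"
    using fam_leE[OF h] by blast
  have "algebraic_int (of_nat c * (\<Prod>y\<in>S. y ^ (k * n)))" if S: "S \<subseteq> ?C" for S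
  proof -
    let ?T = "{g\<in>G. g x \<in> S}"
    have "(\<Prod>g\<in>?T. g x ^ k) = (\<Prod>y\<in>S. \<Prod>g\<in>{g\<in>?T. g x = y}. g x ^ k)"
      by (rule prod.group[symmetric]) (use fin S fc finite_subset in auto)
    also have "\<dots> = (\<Prod>y\<in>S. y ^ (k * n))"
    proof (intro prod.cong refl)
      fix y assume y: "y \<in> S"
      then have "{g\<in>?T. g x = y} = {g\<in>G. g x = y}" by auto
      then have "card {g\<in>?T. g x = y} = n" using n(4) S y by auto
      then show "(\<Prod>g\<in>{g\<in>?T. g x = y}. g x ^ k) = y ^ (k * n)" by (simp add: power_mult)
    qed
    finally have "(\<Prod>g\<in>?T. g x ^ k) = (\<Prod>y\<in>S. y ^ (k * n))" .
    moreover have "?T \<subseteq> G" by auto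
    ultimately show ?thesis using kc(3)[of ?T] by (simp only:)
  qed
  moreover have "ln (real c) / real (k * n) + (\<Sum>y\<in>?C. log_plus (norm y)) \<le> r * real (card ?C)"
  proof -
    have "real n * (ln (real c) / real (k * n) + (\<Sum>y\<in>?C. log_plus (norm y)))
        = ln (real c) / real k + (\<Sum>g\<in>G. log_plus (norm (g x)))"
      using n(3)[of "\<lambda>y. log_plus (norm y)"] n(1) by (simp add: distrib_left)
    also have "\<dots> \<le> real n * (r * real (card ?C))" using kc(4) n(2) by (simp add: mult_ac)
    finally show ?thesis using n(1) by simp
  qed
  ultimately show ?thesis unfolding height_le_def
    using kc(1,2) n(1) by (intro exI[of _ "k * n"] exI[of _ c]) simp
qed

text \<open>The exponents are brought to the common multiple \<open>k * l\<close>. Raising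
  \<open>c\<close> and \<open>d\<close> to the complementary powers leaves the contributions
  \<open>ln c / k\<close> and \<open>ln d / l\<close> unchanged.\<close>

lemma fam_le_mult:
  assumes xy: "x \<in> L" "y \<in> L" and "fam_le x r" "fam_le y s"
  shows "fam_le (x * y) (r + s)"
proof -
  obtain k c :: nat where kc: "k > 0" "c > 0"
    "\<And>S. S \<subseteq> G \<Longrightarrow> algebraic_int (of_nat c * (\<Prod>g\<in>S. g x ^ k))"
    "ln (real c) / real k + (\<Sum>g\<in>G. log_plus (norm (g x))) \<le> r * real (card G)"
    using fam_leE[OF assms(3)] by blast
  obtain l d :: nat where ld: "l > 0" "d > 0"
    "\<And>S. S \<subseteq> G \<Longrightarrow> algebraic_int (of_nat d * (\<Prod>g\<in>S. g y ^ l))"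
    "ln (real d) / real l + (\<Sum>g\<in>G. log_plus (norm (g y))) \<le> s * real (card G)"
    using fam_leE[OF assms(4)] by blast
  show ?thesis
  proof (rule fam_leI[of "k * l" "c ^ l * d ^ k"])
    show "k * l > 0" "c ^ l * d ^ k > 0" using kc(1,2) ld(1,2) by auto
    fix S assume S: "S \<subseteq> G"
    have "(\<Prod>g\<in>S. g (x * y) ^ (k * l)) = (\<Prod>g\<in>S. (g x ^ k) ^ l * (g y ^ l) ^ k)"
    proof (intro prod.cong refl)
      fix g assume "g \<in> S"
      then have "g (x * y) = g x * g y" using S hom_mult[of g x y] xy by blast
      then show "g (x * y) ^ (k * l) = (g x ^ k) ^ l * (g y ^ l) ^ k"
        by (simp add: power_mult_distrib mult.commute flip: power_mult)
    qed
    also have "\<dots> = (\<Prod>g\<in>S. g x ^ k) ^ l * (\<Prod>g\<in>S. g y ^ l) ^ k"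
      by (simp add: prod.distrib prod_power_distrib)
    finally have "of_nat (c ^ l * d ^ k) * (\<Prod>g\<in>S. g (x * y) ^ (k * l)) =
      (of_nat c * (\<Prod>g\<in>S. g x ^ k)) ^ l * (of_nat d * (\<Prod>g\<in>S. g y ^ l)) ^ k"
      by (simp add: power_mult_distrib)
    then show "algebraic_int (of_nat (c ^ l * d ^ k) * (\<Prod>g\<in>S. g (x * y) ^ (k * l)))"
      using algebraic_int_times[OF algebraic_int_power[OF kc(3)[OF S]] algebraic_int_power[OF ld(3)[OF S]]]
      by (simp only:)
  next
    have "ln (real (c ^ l * d ^ k)) = real l * ln (real c) + real k * ln (real d)"
      using kc(1,2) ld(1,2) by (simp add: ln_mult ln_realpow)
    then have "ln (real (c ^ l * d ^ k)) / real (k * l) = ln (real c) / real k + ln (real d) / real l"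
      using kc(1) ld(1) by (simp only: add_divide_distrib of_nat_mult) simp
    moreover have "(\<Sum>g\<in>G. log_plus (norm (g (x * y)))) \<le> (\<Sum>g\<in>G. log_plus (norm (g x)) + log_plus (norm (g y)))"
    proof (intro sum_mono)
      fix g assume "g \<in> G"
      then have "g (x * y) = g x * g y" using hom_mult[of g x y] xy by blast
      then show "log_plus (norm (g (x * y))) \<le> log_plus (norm (g x)) + log_plus (norm (g y))"
        by (simp add: norm_mult log_plus_mult)
    qed
    ultimately show "ln (real (c ^ l * d ^ k)) / real (k * l) + (\<Sum>g\<in>G. log_plus (norm (g (x * y))))
        \<le> (r + s) * real (card G)"
      using kc(4) ld(4) by (simp add: sum.distrib distrib_right)
  qed
qed

lemma fam_le_one: "fam_le 1 0"
  by (rule fam_leI[of 1 1]) (auto simp: hom_one subset_eq log_plus_def)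

lemma fam_le_power:
  assumes "x \<in> L" "fam_le x r"
  shows "fam_le (x ^ n) (real n * r)"
proof (induction n)
  case (Suc n)
  have "fam_le (x * x ^ n) (r + real n * r)"
    using assms Suc.IH by (intro fam_le_mult power)
  then show ?case by (simp add: distrib_right)
qed (simp add: fam_le_one)

lemma fam_le_prod:
  assumes "finite I" "\<And>i. i \<in> I \<Longrightarrow> f i \<in> L" "\<And>i. i \<in> I \<Longrightarrow> fam_le (f i) r"
  shows "fam_le (prod f I) (real (card I) * r)"
  using assms
proof (induction I rule: finite_induct)
  case (insert i I)
  have "fam_le (f i * prod f I) (r + real (card I) * r)"
    using insert by (intro fam_le_mult prod) auto
  then show ?case using insert.hyps by (simp add: distrib_right)
qed (simp add: fam_le_one)

lemma fam_le_root:
  assumes "x \<in> L" "fam_le (x ^ n) r" "n > 0"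
  shows "fam_le x (r / real n)"
proof -
  obtain k c :: nat where kc: "k > 0" "c > 0"
    "\<And>S. S \<subseteq> G \<Longrightarrow> algebraic_int (of_nat c * (\<Prod>g\<in>S. g (x ^ n) ^ k))"
    "ln (real c) / real k + (\<Sum>g\<in>G. log_plus (norm (g (x ^ n)))) \<le> r * real (card G)"
    using fam_leE[OF assms(2)] by blast
  show ?thesis
  proof (rule fam_leI[of "n * k" c])
    show "n * k > 0" "c > 0" using kc(1,2) assms(3) by auto
    fix S assume S: "S \<subseteq> G"
    have "(\<Prod>g\<in>S. g (x ^ n) ^ k) = (\<Prod>g\<in>S. g x ^ (n * k))"
    proof (intro prod.cong refl)
      fix g assume "g \<in> S"
      then have "g (x ^ n) = g x ^ n" using S hom_power[of g x n] assms(1) by blast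
      then show "g (x ^ n) ^ k = g x ^ (n * k)" by (simp add: power_mult)
    qed
    then show "algebraic_int (of_nat c * (\<Prod>g\<in>S. g x ^ (n * k)))" using kc(3)[OF S] by simp
  next
    have "(\<Sum>g\<in>G. log_plus (norm (g (x ^ n)))) = (\<Sum>g\<in>G. real n * log_plus (norm (g x)))"
    proof (intro sum.cong refl)
      fix g assume "g \<in> G"
      then have "g (x ^ n) = g x ^ n" using hom_power[of g x n] assms(1) by blast
      then show "log_plus (norm (g (x ^ n))) = real n * log_plus (norm (g x))"
        by (simp add: norm_power log_plus_power)
    qed
    then have "real n * (ln (real c) / real (n * k) + (\<Sum>g\<in>G. log_plus (norm (g x)))) \<le> r * real (card G)"
      using kc(4) assms(3) by (simp add: distrib_left sum_distrib_left)
    then show "ln (real c) / real (n * k) + (\<Sum>g\<in>G. log_plus (norm (g x))) \<le> r / real n * real (card G)"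
      using assms(3) by (simp add: field_simps)
  qed
qed

lemma stab_norm_fixed:
  assumes "g \<in> stab F" "x \<in> L"
  shows "g (\<Prod>h\<in>stab F. h x) = (\<Prod>h\<in>stab F. h x)"
proof -
  have "g (\<Prod>h\<in>stab F. h x) = (\<Prod>h\<in>stab F. g (h x))"
    by (rule hom_prod) (use assms stab_G closed in auto)
  also have "\<dots> = (\<Prod>h\<in>stab F. cmp g h x)"
    using cmp_apply assms stab_G by (intro prod.cong refl) simp
  also have "\<dots> = (\<Prod>h\<in>stab F. h x)"
    by (rule prod.reindex_bij_betw[OF bij_cmp_left[OF assms(1)], of "\<lambda>h. h x"])
  finally show ?thesis .
qed

lemma stab_norm_in:
  assumes "csubfield F" "x \<in> L"
  shows "(\<Prod>h\<in>stab F. h x) \<in> F"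
proof (rule fixed[OF assms(1)])
  show "(\<Prod>h\<in>stab F. h x) \<in> L" using assms closed stab_G by (intro prod) blast
  fix g assume "g \<in> G" "\<And>y. y \<in> F \<inter> L \<Longrightarrow> g y = y"
  then have "g \<in> stab F" by (simp add: stab_def)
  then show "g (\<Prod>h\<in>stab F. h x) = (\<Prod>h\<in>stab F. h x)" by (rule stab_norm_fixed[OF _ assms(2)])
qed

text \<open>Passage to complements: \<open>c * N ^ k\<close> is rational and integral, hence an
  integer, and divided by the \<open>k\<close>-th power of the product over \<open>S\<close> it
  becomes \<open>c\<close> times that of the product over \<open>G - S\<close>. The term
  \<open>ln (norm N)\<close> that it adds is exactly what the archimedean sum loses, as in the
  product formula.\<close>

lemma fam_le_inverse:
  assumes x: "x \<in> L" "x \<noteq> 0" and "fam_le x r"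
  shows "fam_le (inverse x) r"
proof -
  obtain k c :: nat where kc: "k > 0" "c > 0"
    "\<And>S. S \<subseteq> G \<Longrightarrow> algebraic_int (of_nat c * (\<Prod>g\<in>S. g x ^ k))"
    "ln (real c) / real k + (\<Sum>g\<in>G. log_plus (norm (g x))) \<le> r * real (card G)"
    using fam_leE[OF assms(3)] by blast
  define N where "N = (\<Prod>g\<in>G. g x)"
  have nz: "g x \<noteq> 0" if "g \<in> G" for g using hom_nz[OF that x] .
  have N0: "N \<noteq> 0" unfolding N_def using nz fin by (auto simp: prod_zero_iff)
  have "N \<in> \<rat>" unfolding N_def using stab_norm_in[OF csubfield_Rats x(1)] by (simp only: stab_Rats)
  then have "of_nat c * N ^ k \<in> \<rat>" by (intro Rats_mult Rats_of_nat Rats_power)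
  moreover have "algebraic_int (of_nat c * N ^ k)"
    using kc(3)[OF subset_refl] by (simp add: N_def prod_power_distrib)
  ultimately have "of_nat c * N ^ k \<in> \<int>" using rational_algebraic_int_is_int by blast
  then obtain z where z: "of_nat c * N ^ k = of_int z" by (rule Ints_cases)
  have z0: "z \<noteq> 0" using z N0 kc(2) by auto
  define c' where "c' = nat \<bar>z\<bar>"
  have c': "of_nat c' = of_int z \<or> of_nat c' = - (of_int z :: complex)"
    by (cases "z \<ge> 0") (auto simp: c'_def of_nat_nat)
  have rc': "real c' = real c * norm N ^ k"
  proof -
    have "real c' = norm (of_int z :: complex)" by (simp add: c'_def)
    also have "\<dots> = real c * norm N ^ k" unfolding z[symmetric] by (simp add: norm_mult norm_power)
    finally show ?thesis .
  qed
  show ?thesis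
  proof (rule fam_leI[of k c'])
    show "k > 0" "c' > 0" using kc(1,2) z0 by (auto simp: c'_def)
    fix S assume S: "S \<subseteq> G"
    have fS: "finite S" using S fin finite_subset by blast
    have "(\<Prod>g\<in>S. g (inverse x) ^ k) = (\<Prod>g\<in>S. inverse (g x ^ k))"
    proof (intro prod.cong refl)
      fix g assume "g \<in> S"
      then have "g (inverse x) = inverse (g x)" using S hom_inverse[of g x] x(1) by blast
      then show "g (inverse x) ^ k = inverse (g x ^ k)" by (simp add: power_inverse)
    qed
    also have "\<dots> = inverse (\<Prod>g\<in>S. g x ^ k)" using prod_inversef[of "\<lambda>g. g x ^ k" S] by (simp add: o_def)
    finally have inv: "(\<Prod>g\<in>S. g (inverse x) ^ k) = inverse ((\<Prod>g\<in>S. g x) ^ k)"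
      by (simp only: prod_power_distrib)
    have S0: "(\<Prod>g\<in>S. g x) \<noteq> 0" using S nz fS by (auto simp: prod_zero_iff)
    have "N = (\<Prod>g\<in>G - S. g x) * (\<Prod>g\<in>S. g x)"
      unfolding N_def by (rule prod.subset_diff[OF S fin])
    then have "of_int z * (\<Prod>g\<in>S. g (inverse x) ^ k) = of_nat c * (\<Prod>g\<in>G - S. g x) ^ k"
      unfolding z[symmetric] inv using S0 by (simp add: power_mult_distrib)
    moreover have "algebraic_int (of_nat c * (\<Prod>g\<in>G - S. g x) ^ k)"
      using kc(3)[of "G - S"] by (simp add: prod_power_distrib)
    ultimately have "algebraic_int (of_int z * (\<Prod>g\<in>S. g (inverse x) ^ k))" by (simp only:)
    then show "algebraic_int (of_nat c' * (\<Prod>g\<in>S. g (inverse x) ^ k))"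
      using c' by (metis algebraic_int_minus mult_minus_left)
  next
    have "ln (real c') = ln (real c) + real k * ln (norm N)"
      unfolding rc' using kc(2) N0 by (simp add: ln_mult ln_realpow)
    then have 1: "ln (real c') / real k = ln (real c) / real k + ln (norm N)"
      using kc(1) by (simp add: add_divide_distrib)
    have "ln (norm N) = (\<Sum>g\<in>G. ln (norm (g x)))"
      unfolding N_def prod_norm[symmetric] by (rule ln_prod) (use fin nz in auto)
    moreover have "(\<Sum>g\<in>G. log_plus (norm (g (inverse x)))) = (\<Sum>g\<in>G. log_plus (norm (g x)) - ln (norm (g x)))"
    proof (intro sum.cong refl)
      fix g assume "g \<in> G"
      then have "g (inverse x) = inverse (g x)" "g x \<noteq> 0" using hom_inverse[of g x] x(1) nz by blast+
      then show "log_plus (norm (g (inverse x))) = log_plus (norm (g x)) - ln (norm (g x))"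
        by (simp add: norm_inverse log_plus_inverse)
    qed
    ultimately show "ln (real c') / real k + (\<Sum>g\<in>G. log_plus (norm (g (inverse x)))) \<le> r * real (card G)"
      using 1 kc(4) by (simp add: sum_subtractf)
  qed
qed

text \<open>Right translation by \<open>g\<close> permutes \<open>G\<close>, so the family of
  \<open>g x\<close> is a rearrangement of the family of \<open>x\<close>.\<close>

lemma fam_le_conj:
  assumes "x \<in> L" "g \<in> G" "fam_le x r"
  shows "fam_le (g x) r"
proof -
  obtain k c :: nat where kc: "k > 0" "c > 0"
    "\<And>S. S \<subseteq> G \<Longrightarrow> algebraic_int (of_nat c * (\<Prod>g\<in>S. g x ^ k))"
    "ln (real c) / real k + (\<Sum>g\<in>G. log_plus (norm (g x))) \<le> r * real (card G)"
    using fam_leE[OF assms(3)] by blast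
  have bij: "bij_betw (\<lambda>h. cmp h g) G G"
    using bij_cmp_right[of g \<rat>] assms(2) by (simp only: stab_Rats)
  have app: "cmp h g x = h (g x)" if "h \<in> G" for h by (rule cmp_apply[OF that assms(2,1)])
  show ?thesis
  proof (rule fam_leI[OF kc(1,2)])
    fix S assume S: "S \<subseteq> G"
    have "(\<Prod>h\<in>S. h (g x) ^ k) = (\<Prod>h\<in>S. cmp h g x ^ k)"
      using S app by (intro prod.cong refl) auto
    also have "\<dots> = (\<Prod>h\<in>(\<lambda>h. cmp h g) ` S. h x ^ k)"
      using inj_on_subset[OF bij_betw_imp_inj_on[OF bij] S] by (simp add: prod.reindex)
    finally have "(\<Prod>h\<in>S. h (g x) ^ k) = (\<Prod>h\<in>(\<lambda>h. cmp h g) ` S. h x ^ k)" .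
    moreover have "(\<lambda>h. cmp h g) ` S \<subseteq> G" using bij S by (auto simp: bij_betw_def)
    ultimately show "algebraic_int (of_nat c * (\<Prod>h\<in>S. h (g x) ^ k))" using kc(3) by simp
  next
    have "(\<Sum>h\<in>G. log_plus (norm (h (g x)))) = (\<Sum>h\<in>G. log_plus (norm (cmp h g x)))"
      using app by (intro sum.cong refl) simp
    also have "\<dots> = (\<Sum>h\<in>G. log_plus (norm (h x)))"
      by (rule sum.reindex_bij_betw[OF bij, of "\<lambda>h. log_plus (norm (h x))"])
    finally show "ln (real c) / real k + (\<Sum>h\<in>G. log_plus (norm (h (g x)))) \<le> r * real (card G)"
      using kc(4) by simp
  qed
qed

end

subsection \<open>Kronecker's theorem\<close>

text \<open>Each coefficient is, up to sign, a sum of products of roots over subsets, times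
  \<open>t\<close>. The induction sorts the subsets by whether they contain \<open>a\<close>, with
  \<open>t\<close> or \<open>t * a\<close> in front.\<close>

lemma algebraic_int_coeffs_from_products:
  assumes "finite S" "\<And>T. T \<subseteq> S \<Longrightarrow> algebraic_int (t * (\<Prod>y\<in>T. y) :: complex)"
  shows "algebraic_int (coeff (smult t (\<Prod>y\<in>S. [:- y, 1:])) i)"
  using assms
proof (induction S arbitrary: t i rule: finite_induct)
  case empty
  have "algebraic_int t" using empty[of "{}"] by simp
  then show ?case by (simp add: coeff_pCons one_pCons split: nat.splits)
next
  case (insert a S)
  let ?P = "\<Prod>y\<in>S. [:- y, 1:]"
  have 1: "algebraic_int (coeff (smult t ?P) i)" for i
    by (rule insert.IH) (use insert.prems in auto)
  have 2: "algebraic_int (coeff (smult (t * a) ?P) i)" for i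
  proof (rule insert.IH)
    fix T assume T: "T \<subseteq> S"
    then have "a \<notin> T" "finite T" using insert.hyps finite_subset by blast+
    then have "t * a * (\<Prod>y\<in>T. y) = t * (\<Prod>y\<in>Set.insert a T. y)" by simp
    moreover have "algebraic_int (t * (\<Prod>y\<in>Set.insert a T. y))" using T by (intro insert.prems) auto
    ultimately show "algebraic_int (t * a * (\<Prod>y\<in>T. y))" by (simp only:)
  qed
  have "smult t (\<Prod>y\<in>Set.insert a S. [:- y, 1:]) = pCons 0 (smult t ?P) - smult (t * a) ?P"
    unfolding prod.insert[OF insert.hyps] by (simp add: smult_diff_right mult.commute)
  then show ?case
    by (simp only: coeff_diff) (intro algebraic_int_diff 2, cases i, simp_all only: coeff_pCons_0 coeff_pCons_Suc algebraic_int_0 1)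
qed

lemma finite_bounded_int_polys:
  "finite {p :: complex poly. degree p \<le> d \<and> (\<forall>i. coeff p i \<in> \<int> \<and> norm (coeff p i) \<le> B)}"
proof -
  let ?Z = "{z :: complex. z \<in> \<int> \<and> norm z \<le> B}"
  have "?Z \<subseteq> of_int ` {- \<lceil>B\<rceil>..\<lceil>B\<rceil>}"
  proof
    fix z :: complex assume z: "z \<in> ?Z"
    then obtain k where k: "z = of_int k" by (auto elim: Ints_cases)
    then have "\<bar>real_of_int k\<bar> \<le> B" using z by simp
    then have "k \<in> {- \<lceil>B\<rceil>..\<lceil>B\<rceil>}" by (auto simp: abs_le_iff) linarith+
    then show "z \<in> of_int ` {- \<lceil>B\<rceil>..\<lceil>B\<rceil>}" using k by blast
  qed
  then have "finite ?Z" by (rule finite_subset) simp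
  then have "finite (Poly ` {xs. set xs \<subseteq> ?Z \<and> length xs = Suc d})"
    by (intro finite_imageI finite_lists_length_eq)
  moreover have "{p. degree p \<le> d \<and> (\<forall>i. coeff p i \<in> \<int> \<and> norm (coeff p i) \<le> B)}
      \<subseteq> Poly ` {xs. set xs \<subseteq> ?Z \<and> length xs = Suc d}"
  proof clarify
    fix p :: "complex poly" assume p: "degree p \<le> d" "\<forall>i. coeff p i \<in> \<int> \<and> norm (coeff p i) \<le> B"
    have "p = Poly (map (coeff p) [0..<Suc d])"
      using p(1) by (intro poly_eqI) (auto simp: nth_default_def coeff_eq_0 simp del: upt_Suc)
    then show "p \<in> Poly ` {xs. set xs \<subseteq> ?Z \<and> length xs = Suc d}"
      using p(2) by (intro image_eqI[of _ _ "map (coeff p) [0..<Suc d]"]) (auto simp del: upt_Suc)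
  qed
  ultimately show ?thesis by (rule finite_subset[rotated])
qed

lemma norm_coeff_linear_prod_le:
  assumes "finite S" "\<And>y. y \<in> S \<Longrightarrow> norm y \<le> B" "B \<ge> 0"
  shows "norm (coeff (\<Prod>y\<in>S. [:- y, 1:] :: complex poly) i) \<le> (1 + B) ^ card S"
  using assms(1,2)
proof (induction S arbitrary: i rule: finite_induct)
  case empty
  then show ?case by (simp add: coeff_1)
next
  case (insert a S)
  let ?P = "\<Prod>y\<in>S. [:- y, 1:] :: complex poly"
  have IH: "norm (coeff ?P j) \<le> (1 + B) ^ card S" for j using insert by simp
  have "coeff ([:- a, 1:] * ?P) i = - (a * coeff ?P i) + (case i of 0 \<Rightarrow> 0 | Suc j \<Rightarrow> coeff ?P j)"
    by (simp add: mult_pCons_left coeff_pCons)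
  then have "norm (coeff ([:- a, 1:] * ?P) i) \<le> norm (a * coeff ?P i) + norm (case i of 0 \<Rightarrow> 0 | Suc j \<Rightarrow> coeff ?P j)"
    using norm_triangle_ineq[of "- (a * coeff ?P i)"] by simp
  also have "norm (a * coeff ?P i) \<le> B * (1 + B) ^ card S"
    unfolding norm_mult using insert.prems[of a] IH[of i] assms(3) by (intro mult_mono) simp_all
  also have "norm (case i of 0 \<Rightarrow> 0 | Suc j \<Rightarrow> coeff ?P j) \<le> (1 + B) ^ card S"
    using IH assms(3) by (cases i) simp_all
  finally show ?case using insert.hyps by (simp add: algebra_simps)
qed

text \<open>Northcott's finiteness: the minimal polynomial of such a \<open>z\<close> has integer
  coefficients, bounded in terms of its roots, and degree at most \<open>d\<close>. This serves
  Kronecker's theorem and later the finiteness of residue rings.\<close>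

lemma finite_bounded_algebraic_ints:
  "finite {z. algebraic_int z \<and> card (conjs \<rat> z) \<le> d \<and> (\<forall>y\<in>conjs \<rat> z. norm y \<le> B)}" (is "finite ?Z")
proof -
  interpret Q: csubfield \<rat> by (rule csubfield_Rats)
  define B' where "B' = max B 0"
  let ?P = "{p :: complex poly. degree p \<le> d \<and> (\<forall>i. coeff p i \<in> \<int> \<and> norm (coeff p i) \<le> (1 + B') ^ d)}"
  have "?Z \<subseteq> (\<Union>p\<in>?P - {0}. {y. poly p y = 0})"
  proof
    fix z assume z: "z \<in> ?Z"
    have zi: "algebraic_int z" and card: "card (conjs \<rat> z) \<le> d" and bound: "\<And>y. y \<in> conjs \<rat> z \<Longrightarrow> norm y \<le> B'"
      using z by (simp_all add: B'_def le_max_iff_disj)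
    have az: "algebraic z" using zi by (rule algebraic_int_imp_algebraic)
    note fz = Q.finite_conjs[OF az]
    obtain q where q: "lead_coeff q = 1" "\<forall>i. coeff q i \<in> \<int>" "poly q z = 0"
      using zi by (auto simp: algebraic_int.simps)
    have int: "algebraic_int y" if "y \<in> conjs \<rat> z" for y
    proof -
      have "q \<in> polys_over \<rat>" using q(2) Ints_subset_Rats by (auto simp: polys_over_def)
      then have "poly q y = 0" using q(3) by (rule Q.poly_conjs[OF az _ _ that])
      then show ?thesis using q by (intro algebraic_int.intros)
    qed
    have m: "minp \<rat> z = (\<Prod>y\<in>conjs \<rat> z. [:- y, 1:])" by (rule Q.minp_eq_prod[OF az])
    have "coeff (minp \<rat> z) i \<in> \<int>" for i
    proof (rule rational_algebraic_int_is_int)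
      show "coeff (minp \<rat> z) i \<in> \<rat>" using Q.minp_poly[OF az] by (simp add: polys_over_def)
      have "algebraic_int (coeff (smult 1 (\<Prod>y\<in>conjs \<rat> z. [:- y, 1:])) i)"
      proof (rule algebraic_int_coeffs_from_products[OF fz])
        fix T assume "T \<subseteq> conjs \<rat> z"
        then have "algebraic_int (\<Prod>y\<in>T. y)" using int by (intro algebraic_int_prod) blast
        then show "algebraic_int (1 * (\<Prod>y\<in>T. y))" by simp
      qed
      then show "algebraic_int (coeff (minp \<rat> z) i)" unfolding m by simp
    qed
    moreover have "norm (coeff (minp \<rat> z) i) \<le> (1 + B') ^ d" for i
    proof -
      have "norm (coeff (minp \<rat> z) i) \<le> (1 + B') ^ card (conjs \<rat> z)"
        unfolding m by (rule norm_coeff_linear_prod_le[OF fz bound]) (simp_all add: B'_def)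
      also have "\<dots> \<le> (1 + B') ^ d" using card by (rule power_increasing) (simp add: B'_def)
      finally show ?thesis .
    qed
    ultimately show "z \<in> (\<Union>p\<in>?P - {0}. {y. poly p y = 0})"
      using card Q.degree_minp[OF az] Q.minp_nz[OF az] Q.minp_root[OF az] by (intro UN_I[of "minp \<rat> z"]) simp_all
  qed
  moreover have "finite (\<Union>p\<in>?P - {0}. {y. poly p y = 0})"
    using finite_bounded_int_polys by (intro finite_UN_I) (auto intro: poly_roots_finite)
  ultimately show ?thesis by (rule finite_subset)
qed

text \<open>The conjugates of \<open>z ^ j\<close> are the \<open>j\<close>-th powers of those of
  \<open>z\<close>, so all powers of \<open>z\<close> lie in one finite set and two of them
  agree.\<close>

lemma root_of_unity_if_conjs_bounded:
  assumes z: "algebraic_int z" "z \<noteq> 0" and bound: "\<And>y. y \<in> conjs \<rat> z \<Longrightarrow> norm y \<le> 1"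
  shows "\<exists>k>0. z ^ k = 1"
proof -
  interpret Q: csubfield \<rat> by (rule csubfield_Rats)
  have alg_z: "algebraic z" using z(1) by (rule algebraic_int_imp_algebraic)
  obtain L G where LG: "galois L G" "{z} \<subseteq> L"
    using galois_exists[of "{z}"] alg_z by (auto simp: Qbar_def)
  interpret galois L G by fact
  have zL: "z \<in> L" by (rule subsetD[OF LG(2)]) (rule singletonI)
  define d where "d = card (conjs \<rat> z)"
  have fc: "finite (conjs \<rat> z)" by (rule Q.finite_conjs[OF alg_z])
  have "z ^ j \<in> {w. algebraic_int w \<and> card (conjs \<rat> w) \<le> d \<and> (\<forall>y\<in>conjs \<rat> w. norm y \<le> 1)}" for j
  proof -
    have zj: "z ^ j \<in> L" by (rule power[OF zL])
    have c: "conjs \<rat> (z ^ j) = (\<lambda>y. y ^ j) ` conjs \<rat> z"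
    proof -
      have "conjs \<rat> (z ^ j) = (\<lambda>g. g (z ^ j)) ` G"
        using orbit_eq_conjs[OF csubfield_Rats zj] by (simp only: stab_Rats)
      also have "\<dots> = (\<lambda>g. g z ^ j) ` G"
        by (rule image_cong[OF refl]) (rule hom_power[OF _ zL])
      also have "\<dots> = (\<lambda>y. y ^ j) ` (\<lambda>g. g z) ` G" by (simp only: image_image)
      also have "(\<lambda>g. g z) ` G = conjs \<rat> z"
        using orbit_eq_conjs[OF csubfield_Rats zL] by (simp only: stab_Rats)
      finally show ?thesis .
    qed
    have "card (conjs \<rat> (z ^ j)) \<le> d" unfolding d_def c using card_image_le[OF fc] by simp
    moreover have "norm y \<le> 1" if "y \<in> conjs \<rat> (z ^ j)" for y
      using that bound unfolding c by (auto simp: norm_power intro!: power_le_one)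
    ultimately show ?thesis using algebraic_int_power[OF z(1)] by simp
  qed
  then have "range (\<lambda>j. z ^ j) \<subseteq> {w. algebraic_int w \<and> card (conjs \<rat> w) \<le> d \<and> (\<forall>y\<in>conjs \<rat> w. norm y \<le> 1)}"
    by (rule image_subsetI)
  then have "finite (range (\<lambda>j. z ^ j))" using finite_bounded_algebraic_ints by (rule finite_subset)
  then have "\<not> inj (\<lambda>j. z ^ j)" by (metis finite_imageD infinite_UNIV_nat)
  then have "\<exists>i j. i \<noteq> j \<and> z ^ i = z ^ j" unfolding inj_def by metis
  then obtain i j where ij: "i < j" "z ^ i = z ^ j" by (metis linorder_neqE_nat)
  have "z ^ j = z ^ i * z ^ (j - i)" using ij(1) by (simp flip: power_add)
  then have "z ^ i * z ^ (j - i) = z ^ i" using ij(2) by (simp only:)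
  then show ?thesis using z(2) ij(1) by (intro exI[of _ "j - i"]) simp
qed

text \<open>No archimedean term can be positive, so all conjugates lie in the closed unit disc. If a
  coefficient of the minimal polynomial has denominator \<open>b\<close>, then \<open>b ^ k\<close>
  divides \<open>c\<close>; as the \<open>k\<close>-th root of \<open>c\<close> can be made smaller
  than 2, \<open>b = 1\<close> and \<open>z\<close> is integral.\<close>

lemma root_of_unity_if_height_zero:
  assumes z: "algebraic z" "z \<noteq> 0" and small: "\<And>\<epsilon>. \<epsilon> > 0 \<Longrightarrow> height_le z \<epsilon>"
  shows "\<exists>k>0. z ^ k = 1"
proof -
  interpret Q: csubfield \<rat> by (rule csubfield_Rats)
  let ?C = "conjs \<rat> z"
  have fc: "finite ?C" by (rule Q.finite_conjs[OF z(1)])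
  have d: "card ?C > 0" using fc Q.self_conjs[OF z(1)] by (auto simp: card_gt_0_iff)
  have bound: "norm y \<le> 1" if y: "y \<in> ?C" for y
  proof -
    have "log_plus (norm y) \<le> \<epsilon>" if \<epsilon>: "\<epsilon> > 0" for \<epsilon>
    proof -
      have "\<epsilon> / real (card ?C) > 0" using \<epsilon> d by simp
      from height_leE[OF small[OF this]] obtain k c :: nat where kc: "k > 0" "c > 0"
        "ln (real c) / real k + (\<Sum>y\<in>?C. log_plus (norm y)) \<le> \<epsilon> / real (card ?C) * real (card ?C)"
        by metis
      have "log_plus (norm y) \<le> (\<Sum>y\<in>?C. log_plus (norm y))"
        by (rule member_le_sum[OF y]) (use fc log_plus_nonneg in auto)
      moreover have "ln (real c) / real k \<ge> 0" using kc by (intro divide_nonneg_pos) auto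
      ultimately show ?thesis using kc(3) d by simp
    qed
    then have "log_plus (norm y) \<le> 0" by (rule field_le_epsilon[of _ 0, simplified])
    then show ?thesis by (simp add: log_plus_def)
  qed
  \<comment> \<open>This bounds the \<open>k\<close>-th root of \<open>c\<close> by the square root
    of 2, which is below the least nontrivial denominator.\<close>
  define \<epsilon> where "\<epsilon> = ln 2 / (2 * real (card ?C))"
  have "\<epsilon> > 0" using d by (simp add: \<epsilon>_def)
  from height_leE[OF small[OF this]] obtain k c :: nat where kc: "k > 0" "c > 0"
    "\<And>S. S \<subseteq> ?C \<Longrightarrow> algebraic_int (of_nat c * (\<Prod>y\<in>S. y ^ k))"
    "ln (real c) / real k + (\<Sum>y\<in>?C. log_plus (norm y)) \<le> \<epsilon> * real (card ?C)"
    by blast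
  have "(\<Sum>y\<in>?C. log_plus (norm y)) \<ge> 0" by (intro sum_nonneg log_plus_nonneg)
  then have "ln (real c) / real k \<le> ln 2 / 2" using kc(4) d by (simp add: \<epsilon>_def)
  then have lc: "ln (real c) \<le> real k * (ln 2 / 2)" using kc(1) by (simp add: field_simps)
  \<comment> \<open>With this factor, the \<open>k\<close>-th power of \<open>t\<close> times a
    product of conjugates is one of the given algebraic integers, so \<open>t\<close> times the
    product is integral.\<close>
  define t where "t = complex_of_real (root k (real c))"
  have tk: "t ^ k = of_nat c"
  proof -
    have "t ^ k = complex_of_real (root k (real c) ^ k)" by (simp only: t_def of_real_power)
    also have "root k (real c) ^ k = real c" using kc(1) by simp
    finally show ?thesis by simp
  qed
  have coeffs: "algebraic_int (coeff (smult t (minp \<rat> z)) i)" for i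
    unfolding Q.minp_eq_prod[OF z(1)]
  proof (rule algebraic_int_coeffs_from_products[OF fc])
    fix T assume T: "T \<subseteq> ?C"
    have "(t * (\<Prod>y\<in>T. y)) ^ k = of_nat c * (\<Prod>y\<in>T. y ^ k)"
      unfolding power_mult_distrib tk prod_power_distrib ..
    then have "algebraic_int ((t * (\<Prod>y\<in>T. y)) ^ k)" using kc(3)[OF T] by (simp only:)
    then show "algebraic_int (t * (\<Prod>y\<in>T. y))" using kc(1) by (rule algebraic_int_power_root)
  qed
  have "coeff (minp \<rat> z) i \<in> \<int>" for i
  proof -
    let ?e = "coeff (minp \<rat> z) i"
    have "?e \<in> \<rat>" using Q.minp_poly[OF z(1)] by (simp add: polys_over_def)
    then obtain a b :: int where ab: "b > 0" "Rings.coprime a b" "?e = of_int a / of_int b"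
      by (rule Rats_cases')
    have "algebraic_int ((t * ?e) ^ k)" using algebraic_int_power[OF coeffs[of i]] by (simp only: coeff_smult)
    moreover have eq: "(t * ?e) ^ k = of_nat c * of_int a ^ k / of_int b ^ k"
      unfolding power_mult_distrib tk ab(3) power_divide by simp
    moreover have "of_nat c * of_int a ^ k / of_int b ^ k \<in> (\<rat> :: complex set)"
      by (intro Rats_divide Rats_mult Rats_power Rats_of_int Rats_of_nat)
    ultimately have "of_nat c * of_int a ^ k / of_int b ^ k \<in> (\<int> :: complex set)"
      using rational_algebraic_int_is_int by metis
    then obtain w where "of_nat c * of_int a ^ k / of_int b ^ k = (of_int w :: complex)" by (rule Ints_cases)
    then have "of_int (int c * a ^ k) = (of_int (w * b ^ k) :: complex)"
      using ab(1) by (simp add: field_simps)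
    then have "int c * a ^ k = w * b ^ k" by (simp only: of_int_eq_iff)
    then have "b ^ k dvd int c * a ^ k" by simp
    moreover have "Rings.coprime (b ^ k) (a ^ k)" using ab(2) by (simp add: coprime_commute)
    ultimately have "b ^ k dvd int c" by (simp add: coprime_dvd_mult_left_iff)
    then have "b ^ k \<le> int c" using kc(2) by (intro zdvd_imp_le) auto
    then have "real_of_int b ^ k \<le> real c" by (metis of_int_le_iff of_int_of_nat_eq of_int_power)
    then have "ln (real_of_int b ^ k) \<le> ln (real c)" using ab(1) kc(2) by (subst ln_le_cancel_iff) auto
    then have "real k * ln (real_of_int b) \<le> real k * (ln 2 / 2)"
      using lc ab(1) by (simp add: ln_realpow)
    then have "ln (real_of_int b) \<le> ln 2 / 2" using kc(1) by simp
    also have "\<dots> < ln 2" by simp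
    finally have "real_of_int b < 2" using ab(1) by (subst (asm) ln_less_cancel_iff) auto
    then have "b = 1" using ab(1) by simp
    then show ?thesis using ab(3) by simp
  qed
  then have "algebraic_int z"
    using Q.minp_monic[OF z(1)] Q.minp_root[OF z(1)] by (intro algebraic_int.intros) auto
  then show ?thesis using z(2) bound by (rule root_of_unity_if_conjs_bounded)
qed

subsection \<open>Norms and twists\<close>

text \<open>
  \<open>twist F x\<close> is the power of \<open>x\<close> by its degree over \<open>F\<close>, divided by its norm to \<open>F\<close>: up to scaling,
  it is the complementary projection to the one onto the divisible hull of \<open>F\<^sup>\<times>\<close>.
\<close>

definition twist :: "complex set \<Rightarrow> complex \<Rightarrow> complex" where
  "twist F x = x ^ card (conjs F x) * inverse (\<Prod>y\<in>conjs F x. y)"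

lemma norm_in_field:
  assumes "csubfield F" "algebraic x"
  shows "(\<Prod>y\<in>conjs F x. y) \<in> F"
proof -
  interpret F: csubfield F by fact
  have "poly (minp F x) 0 \<in> F" by (rule F.poly_in[OF F.minp_poly[OF assms(2)] F.zero])
  moreover have "poly (minp F x) 0 = (-1) ^ card (conjs F x) * (\<Prod>y\<in>conjs F x. y)"
    unfolding F.minp_eq_prod[OF assms(2)] poly_prod by (simp add: prod_uminus)
  ultimately have "(-1) ^ card (conjs F x) * (\<Prod>y\<in>conjs F x. y) \<in> F" by (simp only:)
  then show ?thesis
    using F.neg[of "- (\<Prod>y\<in>conjs F x. y)"] by (cases "even (card (conjs F x))") simp_all
qed

lemma conjs_nz:
  assumes "csubfield F" "algebraic x" "x \<noteq> 0" "y \<in> conjs F x"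
  shows "y \<noteq> 0"
proof
  interpret F: csubfield F by fact
  assume "y = 0"
  then have "conjs F 0 = conjs F x" using F.conjs_conjs[OF assms(2,4)] by simp
  then have "x \<in> conjs F 0" using F.self_conjs[OF assms(2)] by simp
  moreover have "poly [:0, 1:] x = 0"
  proof (rule F.poly_conjs[of 0])
    show "algebraic (0 :: complex)" by (rule algebraic_rational) simp
    show "[:0, 1:] \<in> polys_over F" by (intro F.polys_pCons F.polys_0 F.zero F.one)
  qed (use calculation in auto)
  ultimately show False using assms(3) by simp
qed

lemma norm_nz:
  assumes "csubfield F" "algebraic x" "x \<noteq> 0"
  shows "(\<Prod>y\<in>conjs F x. y) \<noteq> 0"
  using csubfield.finite_conjs[OF assms(1,2)] conjs_nz[OF assms] by (auto simp: prod_zero_iff)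

text \<open>Built from the fields and \<open>x\<close> alone, so that the resulting element can be
  fixed before \<epsilon> and a Galois field are chosen.\<close>

primrec twists :: "(nat \<Rightarrow> complex set) \<Rightarrow> complex \<Rightarrow> nat \<Rightarrow> complex" where
  "twists K x 0 = x"
| "twists K x (Suc n) = twist (K (Suc n)) (twists K x n)"

text \<open>The exponent of \<open>x\<close> itself that accumulates in the twists.\<close>

primrec twist_degree :: "(nat \<Rightarrow> complex set) \<Rightarrow> complex \<Rightarrow> nat \<Rightarrow> nat" where
  "twist_degree K x 0 = 1"
| "twist_degree K x (Suc n) = twist_degree K x n * card (conjs (K (Suc n)) (twists K x n))"

lemma algebraic_power: "algebraic (x :: complex) \<Longrightarrow> algebraic (x ^ n)"
  using csubfield.power[OF csubfield_Qbar] by (simp add: Qbar_def)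

lemma algebraic_twist:
  assumes "csubfield F" "F \<subseteq> Qbar" "algebraic x"
  shows "algebraic (twist F x)"
  unfolding twist_def using norm_in_field[OF assms(1,3)] assms(2,3)
  by (intro algebraic_times algebraic_power algebraic_inverse') (auto simp: Qbar_def)

text \<open>One more twist raises the earlier cofactors to a power, which keeps them in their
  fields, and contributes the inverse of a norm as the new cofactor.\<close>

lemma twists_decomposition:
  assumes "\<And>i. i \<in> {1..N} \<Longrightarrow> csubfield (K i) \<and> K i \<subseteq> Qbar" "algebraic x" "x \<noteq> 0" "n \<le> N"
  shows "algebraic (twists K x n) \<and> twists K x n \<noteq> 0 \<and> twist_degree K x n > 0 \<and>
    (\<exists>\<kappa>. (\<forall>i\<in>{1..n}. \<kappa> i \<in> K i - {0}) \<and> twists K x n = x ^ twist_degree K x n * (\<Prod>i=1..n. \<kappa> i))"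
  using assms(4)
proof (induction n)
  case 0
  then show ?case using assms by simp
next
  case (Suc n)
  let ?z = "twists K x n"
  have F: "csubfield (K (Suc n))" "K (Suc n) \<subseteq> Qbar" using assms(1)[of "Suc n"] Suc.prems by auto
  note IH' = Suc.IH[OF Suc_leD[OF Suc.prems]]
  have IH: "algebraic ?z" "?z \<noteq> 0" "twist_degree K x n > 0" using IH' by simp_all
  obtain \<kappa> where \<kappa>0: "\<forall>i\<in>{1..n}. \<kappa> i \<in> K i - {0}" "?z = x ^ twist_degree K x n * (\<Prod>i=1..n. \<kappa> i)"
    using IH' by (elim conjE exE)
  note \<kappa> = bspec[OF \<kappa>0(1)] \<kappa>0(2)
  define d where "d = card (conjs (K (Suc n)) ?z)"
  define \<nu> where "\<nu> = (\<Prod>y\<in>conjs (K (Suc n)) ?z. y)"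
  have d: "d > 0"
    using csubfield.finite_conjs[OF F(1) IH(1)] csubfield.self_conjs[OF F(1) IH(1)] by (auto simp: d_def card_gt_0_iff)
  have \<nu>: "\<nu> \<in> K (Suc n)" "\<nu> \<noteq> 0"
    using norm_in_field[OF F(1) IH(1)] norm_nz[OF F(1) IH(1,2)] by (simp_all add: \<nu>_def)
  define \<kappa>' where "\<kappa>' i = (if i = Suc n then inverse \<nu> else \<kappa> i ^ d)" for i
  have \<kappa>'_in: "\<kappa>' i \<in> K i - {0}" if i: "i \<in> {1..Suc n}" for i
  proof (cases "i = Suc n")
    case True
    then show ?thesis using \<nu> csubfield.inv[OF F(1)] by (simp add: \<kappa>'_def)
  next
    case False
    then have "i \<in> {1..n}" "i \<in> {1..N}" using i Suc.prems by auto
    then show ?thesis using \<kappa>(1)[of i] csubfield.power[of "K i" "\<kappa> i" d] assms(1)[of i] False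
      by (simp add: \<kappa>'_def)
  qed
  have eq: "twists K x (Suc n) = x ^ twist_degree K x (Suc n) * (\<Prod>i=1..Suc n. \<kappa>' i)"
  proof -
    have "(\<Prod>i=1..n. \<kappa>' i) = (\<Prod>i=1..n. \<kappa> i) ^ d"
      unfolding prod_power_distrib by (intro prod.cong refl) (simp add: \<kappa>'_def)
    then have "(\<Prod>i=1..Suc n. \<kappa>' i) = (\<Prod>i=1..n. \<kappa> i) ^ d * inverse \<nu>"
      by (simp add: \<kappa>'_def)
    moreover have "twists K x (Suc n) = ?z ^ d * inverse \<nu>" by (simp add: twist_def d_def \<nu>_def)
    moreover have "?z ^ d = (x ^ twist_degree K x n) ^ d * (\<Prod>i=1..n. \<kappa> i) ^ d"
      unfolding power_mult_distrib[symmetric] by (rule arg_cong[OF \<kappa>(2)])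
    moreover have "twist_degree K x (Suc n) = twist_degree K x n * d" by (simp add: d_def)
    ultimately show ?thesis by (simp only: power_mult mult.assoc)
  qed
  have a: "algebraic (twists K x (Suc n))" using algebraic_twist[OF F IH(1)] by simp
  have nz: "twists K x (Suc n) \<noteq> 0" using IH(2) \<nu>(2) by (simp add: twist_def \<nu>_def)
  have "twist_degree K x (Suc n) > 0" using d IH(3) by (simp add: d_def)
  then show ?case using a nz eq \<kappa>'_in by (intro conjI exI[of _ \<kappa>'] ballI)
qed

subsection \<open>Galois extensions\<close>

lemma root_of_linear_factors:
  assumes "poly (\<Prod>a\<in>#A. [:- a, 1:]) y = 0"
  shows "(y :: complex) \<in># A"
  using assms by (induction A) auto

text \<open>The minimal polynomial of \<open>b\<close> is irreducible by minimality of its degree,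
  so normality splits it in \<open>E\<close>.\<close>

lemma galois_conjs_subset:
  assumes "galois_extension M E" "algebraic b" "b \<in> E"
  shows "conjs M b \<subseteq> E"
proof
  interpret M: csubfield M using assms(1) csubfield_subfield by (simp add: galois_extension_def)
  let ?m = "minp M b"
  have "irreducible_over M ?m"
    unfolding irreducible_over_def
  proof (intro conjI ballI impI)
    show "?m \<in> polys_over M" "degree ?m > 0"
      using M.minp_poly[OF assms(2)] M.degree_minp_pos[OF assms(2)] by auto
    fix q r assume qr: "q \<in> polys_over M" "r \<in> polys_over M" "?m = q * r"
    have nz: "q \<noteq> 0" "r \<noteq> 0" using qr(3) M.minp_nz[OF assms(2)] by auto
    have deg: "degree ?m = degree q + degree r" unfolding qr(3) by (rule degree_mult_eq[OF nz])
    have "poly q b = 0 \<or> poly r b = 0" using M.minp_root[OF assms(2)] unfolding qr(3) by simp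
    then show "degree q = 0 \<or> degree r = 0"
      using M.minp_least[OF assms(2) qr(1) nz(1)] M.minp_least[OF assms(2) qr(2) nz(2)] deg by linarith
  qed
  then have "splits_in E ?m"
    using assms M.minp_root[OF assms(2)] unfolding galois_extension_def normal_extension_def by blast
  then obtain c A where A: "set_mset A \<subseteq> E" "?m = smult c (\<Prod>a\<in>#A. [:- a, 1:])"
    unfolding splits_in_def by (elim bexE exE conjE)
  have c: "c \<noteq> 0" using A(2) M.minp_nz[OF assms(2)] by auto
  fix y assume "y \<in> conjs M b"
  then have "c * poly (\<Prod>a\<in>#A. [:- a, 1:]) y = 0" unfolding conjs_def A(2) by simp
  then have "y \<in># A" using c by (intro root_of_linear_factors) simp
  then show "y \<in> E" using A(1) by blast
qed

section \<open>Twists through a finite Galois group\<close>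

context galois
begin

text \<open>In contrast to \<open>twist\<close>, the exponent is the same for all \<open>x\<close>,
  which makes the map multiplicative on \<open>L\<close>.\<close>

definition gtwist :: "complex set \<Rightarrow> complex \<Rightarrow> complex" where
  "gtwist F x = x ^ card (stab F) * inverse (\<Prod>h\<in>stab F. h x)"

lemma gnorm_closed: "x \<in> L \<Longrightarrow> (\<Prod>h\<in>stab F. h x) \<in> L"
  by (rule prod) (rule closed[OF stab_G])

lemma gtwist_closed: "x \<in> L \<Longrightarrow> gtwist F x \<in> L"
  unfolding gtwist_def by (intro mult power inv gnorm_closed)

lemma gnorm_nz: "x \<in> L \<Longrightarrow> x \<noteq> 0 \<Longrightarrow> (\<Prod>h\<in>stab F. h x) \<noteq> 0"
  using hom_nz stab_G finite_stab by (auto simp: prod_zero_iff)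

lemma gtwist_nz: "x \<in> L \<Longrightarrow> x \<noteq> 0 \<Longrightarrow> gtwist F x \<noteq> 0"
  using gnorm_nz by (simp add: gtwist_def)

lemma gtwist_mult:
  assumes "x \<in> L" "y \<in> L"
  shows "gtwist F (x * y) = gtwist F x * gtwist F y"
proof -
  have "(\<Prod>h\<in>stab F. h (x * y)) = (\<Prod>h\<in>stab F. h x * h y)"
    by (rule prod.cong[OF refl]) (rule hom_mult[OF stab_G assms])
  then show ?thesis by (simp add: gtwist_def prod.distrib power_mult_distrib)
qed

lemma gtwist_one: "gtwist F 1 = 1"
proof -
  have "(\<Prod>h\<in>stab F. h 1) = (\<Prod>h\<in>stab F. 1)"
    by (rule prod.cong[OF refl]) (rule hom_one[OF stab_G])
  then show ?thesis by (simp add: gtwist_def)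
qed

lemma gtwist_power: "x \<in> L \<Longrightarrow> gtwist F (x ^ n) = gtwist F x ^ n"
  by (induction n) (simp_all add: gtwist_one gtwist_mult power)

text \<open>Each conjugate over \<open>F\<close> occurs \<open>n\<close> times in the product over
  the group, and the order of the group is \<open>n\<close> times the degree.\<close>

lemma gtwist_eq_twist_power:
  assumes "csubfield F" "x \<in> L"
  shows "\<exists>n>0. card (stab F) = n * card (conjs F x) \<and> gtwist F x = twist F x ^ n"
proof -
  obtain n where n: "n > 0" "card (stab F) = n * card (conjs F x)"
    "\<And>\<phi> :: complex \<Rightarrow> complex. (\<Prod>g\<in>stab F. \<phi> (g x)) = (\<Prod>y\<in>conjs F x. \<phi> y) ^ n"
    using fiber_prod[OF assms] by (elim exE conjE) simp
  have "gtwist F x = twist F x ^ n"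
    unfolding gtwist_def twist_def n(2) n(3)[of "\<lambda>y. y"]
    by (simp add: power_mult_distrib power_inverse mult.commute[of n] power_mult)
  then show ?thesis using n by blast
qed

lemma gtwist_kill:
  assumes "x \<in> F" "x \<in> L" "x \<noteq> 0"
  shows "gtwist F x = 1"
proof -
  have "(\<Prod>h\<in>stab F. h x) = (\<Prod>h\<in>stab F. x)"
    by (rule prod.cong[OF refl]) (rule stab_fix[OF _ assms(1,2)])
  then show ?thesis using assms(3) by (simp add: gtwist_def)
qed

lemma galois_stab_subset:
  assumes "galois_extension M E" "M \<subseteq> F" "g \<in> stab F" "b \<in> E" "b \<in> L"
  shows "g b \<in> E"
proof -
  have M: "csubfield M" using assms(1) csubfield_subfield by (simp add: galois_extension_def)
  have "g \<in> stab M" using assms(2,3) by (auto simp: stab_def)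
  then have "g b \<in> conjs M b" using orbit_eq_conjs[OF M assms(5)] by blast
  then show ?thesis using galois_conjs_subset[OF assms(1) alg[OF assms(5)] assms(4)] by blast
qed

text \<open>
  If \<open>F / (F \<inter> F')\<close> is normal, then the stabilizer of \<open>F'\<close> maps \<open>F\<close> to itself; if \<open>F' / (F \<inter> F')\<close>
  is normal, then the stabilizer of \<open>F\<close> normalizes that of \<open>F'\<close>.
\<close>

lemma gtwist_preserves:
  assumes F: "csubfield F" and F': "csubfield F'" and a: "a \<in> F" "a \<in> L"
    and gal: "galois_extension (F \<inter> F') F \<or> galois_extension (F \<inter> F') F'"
  shows "gtwist F' a \<in> F"
proof -
  interpret F: csubfield F by fact
  have "(\<Prod>h\<in>stab F'. h a) \<in> F"
    using gal
  proof
    assume "galois_extension (F \<inter> F') F"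
    then show ?thesis
      using galois_stab_subset[of "F \<inter> F'" F F' _ a] a by (intro F.prod) auto
  next
    assume gal': "galois_extension (F \<inter> F') F'"
    show ?thesis
    proof (rule fixed[OF F gnorm_closed[OF a(2)]])
      fix g assume "g \<in> G" "\<And>y. y \<in> F \<inter> L \<Longrightarrow> g y = y"
      then have g: "g \<in> stab F" by (simp add: stab_def)
      obtain g' where g': "g' \<in> stab F" "\<And>x. x \<in> L \<Longrightarrow> g (g' x) = x" "\<And>x. x \<in> L \<Longrightarrow> g' (g x) = x"
        using stab_inverse[OF g] by (elim bexE conjE) simp
      note gG = stab_G[OF g] and g'G = stab_G[OF g'(1)]
      \<comment> \<open>Conjugation by \<open>g\<close>. It preserves \<open>stab F'\<close> because
        \<open>g'\<close> maps \<open>F' \<inter> L\<close> into \<open>F'\<close>. As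
        \<open>g'\<close> fixes \<open>a\<close>, applying \<open>g\<close> to the factor
        \<open>h a\<close> gives the factor \<open>c h a\<close>, so \<open>g\<close> only permutes
        the factors.\<close>
      define c where "c h = cmp g (cmp h g')" for h
      have cG: "c h \<in> G" if "h \<in> G" for h unfolding c_def by (intro cmp_G gG g'G that)
      have c: "c h x = g (h (g' x))" if "h \<in> G" "x \<in> L" for h x
        unfolding c_def cmp_apply[OF gG cmp_G[OF that(1) g'G] that(2)] cmp_apply[OF that(1) g'G that(2)] ..
      have cst: "c h \<in> stab F'" if h: "h \<in> stab F'" for h
        unfolding stab_def
      proof (intro CollectI conjI ballI)
        show "c h \<in> G" by (rule cG[OF stab_G[OF h]])
        fix b assume b: "b \<in> F' \<inter> L"
        have "g' b \<in> F'" by (rule galois_stab_subset[OF gal' _ g'(1)]) (use b in auto)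
        moreover have "g' b \<in> L" using closed[OF g'G] b by blast
        ultimately have "h (g' b) = g' b" by (rule stab_fix[OF h])
        then show "c h b = b" using c[OF stab_G[OF h], of b] g'(2)[of b] b by simp
      qed
      have "inj_on c (stab F')"
      proof (rule inj_onI)
        fix h k assume hk: "h \<in> stab F'" "k \<in> stab F'" "c h = c k"
        note hG = stab_G[OF hk(1)] and kG = stab_G[OF hk(2)]
        show "h = k"
        proof (rule ext[OF hG kG])
          fix x assume x: "x \<in> L"
          then have gx: "g x \<in> L" by (rule closed[OF gG])
          have "g (h x) = g (k x)"
            using c[OF hG gx] c[OF kG gx] hk(3) g'(3)[OF x] by simp
          then show "h x = k x" by (rule hom_inj[OF gG closed[OF hG x] closed[OF kG x]])
        qed
      qed
      then have bij: "bij_betw c (stab F') (stab F')"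
        using endo_inj_surj[OF finite_stab, of c F'] cst by (auto simp: bij_betw_def)
      have ga: "g' a = a" by (rule stab_fix[OF g'(1) a])
      have "g (\<Prod>h\<in>stab F'. h a) = (\<Prod>h\<in>stab F'. g (h a))"
        by (rule hom_prod[OF gG]) (rule closed[OF stab_G a(2)])
      also have "\<dots> = (\<Prod>h\<in>stab F'. c h a)"
        using c[OF stab_G a(2)] ga by (intro prod.cong refl) simp
      also have "\<dots> = (\<Prod>h\<in>stab F'. h a)"
        by (rule prod.reindex_bij_betw[OF bij, of "\<lambda>h. h a"])
      finally show "g (\<Prod>h\<in>stab F'. h a) = (\<Prod>h\<in>stab F'. h a)" .
    qed
  qed
  then show ?thesis unfolding gtwist_def using a(1) by (intro F.mult F.power F.inv)
qed

text \<open>The power of \<open>x\<close> and the inverse of its norm contribute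
  \<open>card (stab F) * r\<close> each, whence the factor 2.\<close>

lemma fam_le_gtwist:
  assumes "x \<in> L" "x \<noteq> 0" "fam_le x r"
  shows "fam_le (gtwist F x) (2 * real (card (stab F)) * r)"
proof -
  have "fam_le (\<Prod>h\<in>stab F. h x) (real (card (stab F)) * r)"
    by (rule fam_le_prod[OF finite_stab])
       (rule closed[OF stab_G assms(1)] fam_le_conj[OF assms(1) stab_G assms(3)], assumption)+
  then have "fam_le (gtwist F x) (real (card (stab F)) * r + real (card (stab F)) * r)"
    unfolding gtwist_def using assms
    by (intro fam_le_mult fam_le_power fam_le_inverse power inv gnorm_closed gnorm_nz)
  moreover have "real (card (stab F)) * r + real (card (stab F)) * r = 2 * real (card (stab F)) * r" by simp
  ultimately show ?thesis by (simp only:)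
qed

primrec gtwists :: "(nat \<Rightarrow> complex set) \<Rightarrow> complex \<Rightarrow> nat \<Rightarrow> complex" where
  "gtwists K x 0 = x"
| "gtwists K x (Suc n) = gtwist (K (Suc n)) (gtwists K x n)"

lemma gtwists_closed: "x \<in> L \<Longrightarrow> gtwists K x n \<in> L"
  by (induction n) (simp_all add: gtwist_closed)

lemma gtwists_nz: "x \<in> L \<Longrightarrow> x \<noteq> 0 \<Longrightarrow> gtwists K x n \<noteq> 0"
  by (induction n) (simp_all add: gtwist_nz gtwists_closed)

lemma gtwists_mult: "x \<in> L \<Longrightarrow> y \<in> L \<Longrightarrow> gtwists K (x * y) n = gtwists K x n * gtwists K y n"
  by (induction n) (simp_all add: gtwist_mult gtwists_closed)

lemma gtwists_one: "gtwists K 1 n = 1"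
  by (induction n) (simp_all add: gtwist_one)

lemma gtwists_power: "x \<in> L \<Longrightarrow> gtwists K (x ^ k) n = gtwists K x n ^ k"
  by (induction k) (simp_all add: gtwists_one gtwists_mult power)

lemma gtwists_inverse:
  assumes "x \<in> L" "x \<noteq> 0"
  shows "gtwists K (inverse x) n = inverse (gtwists K x n)"
proof -
  have "gtwists K x n * gtwists K (inverse x) n = 1"
    using gtwists_mult[OF assms(1) inv[OF assms(1)], of K n] assms(2) gtwists_one by simp
  then show ?thesis using inverse_unique by fastforce
qed

lemma gtwists_prod:
  assumes "\<And>i. i \<in> I \<Longrightarrow> f i \<in> L"
  shows "gtwists K (prod f I) n = (\<Prod>i\<in>I. gtwists K (f i) n)"
  using assms by (induction I rule: infinite_finite_induct) (simp_all add: gtwists_one gtwists_mult prod)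

lemma fam_le_gtwists:
  assumes "x \<in> L" "x \<noteq> 0" "fam_le x r"
  shows "fam_le (gtwists K x n) (2 ^ n * (\<Prod>i=1..n. real (card (stab (K i)))) * r)"
proof (induction n)
  case (Suc n)
  have "fam_le (gtwists K x (Suc n)) (2 * real (card (stab (K (Suc n)))) * (2 ^ n * (\<Prod>i=1..n. real (card (stab (K i)))) * r))"
    unfolding gtwists.simps using Suc assms by (intro fam_le_gtwist gtwists_closed gtwists_nz)
  then show ?case by (simp add: mult_ac)
qed (use assms in simp)

text \<open>The exponent \<open>E\<close> depends on \<open>L\<close>, and so does the product of
  the group orders, but their quotient is the intrinsic \<open>twist_degree\<close>.\<close>

lemma gtwists_eq_twists_power:
  assumes "\<And>i. i \<in> {1..N} \<Longrightarrow> csubfield (K i)" "x \<in> L" "n \<le> N"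
  shows "\<exists>E>0. twists K x n \<in> L \<and> gtwists K x n = twists K x n ^ E \<and>
    (\<Prod>i=1..n. card (stab (K i))) = E * twist_degree K x n"
  using assms(3)
proof (induction n)
  case 0
  then show ?case using assms by (intro exI[of _ 1]) simp
next
  case (Suc n)
  obtain E where E: "E > 0" "twists K x n \<in> L" "gtwists K x n = twists K x n ^ E"
    "(\<Prod>i=1..n. card (stab (K i))) = E * twist_degree K x n"
    using Suc.IH[OF Suc_leD[OF Suc.prems]] by (elim exE conjE)
  have F: "csubfield (K (Suc n))" using assms(1) Suc.prems by simp
  obtain e where e: "e > 0" "card (stab (K (Suc n))) = e * card (conjs (K (Suc n)) (twists K x n))"
    "gtwist (K (Suc n)) (twists K x n) = twist (K (Suc n)) (twists K x n) ^ e"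
    using gtwist_eq_twist_power[OF F E(2)] by (elim exE conjE)
  have sub: "conjs (K (Suc n)) (twists K x n) \<subseteq> L"
    unfolding orbit_eq_conjs[OF F E(2), symmetric]
    by (rule image_subsetI) (rule closed[OF stab_G E(2)])
  have "(\<Prod>y\<in>conjs (K (Suc n)) (twists K x n). y) \<in> L" by (rule prod) (rule subsetD[OF sub])
  then have "twists K x (Suc n) \<in> L"
    unfolding twists.simps twist_def using E(2) by (intro mult power inv)
  moreover have "gtwists K x (Suc n) = twists K x (Suc n) ^ (e * E)"
    by (simp add: E(3) gtwist_power[OF E(2)] e(3) power_mult)
  moreover have "(\<Prod>i=1..Suc n. card (stab (K i))) = e * E * twist_degree K x (Suc n)"
    using E(4) e(2) by simp
  ultimately show ?case using E(1) e(1) by (intro exI[of _ "e * E"]) simp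
qed

text \<open>Along the iteration the element stays in \<open>K j\<close> by
  \<open>gtwist_preserves\<close>, becomes 1 at the twist belonging to \<open>K j\<close>, and
  remains 1 because twists fix 1.\<close>

lemma gtwists_kill:
  assumes K: "\<And>i. i \<in> {1..N} \<Longrightarrow> csubfield (K i)"
    and gal: "\<And>i j. i \<in> {1..N} \<Longrightarrow> j \<in> {1..N} \<Longrightarrow> i \<noteq> j \<Longrightarrow>
      galois_extension (K i \<inter> K j) (K i) \<or> galois_extension (K i \<inter> K j) (K j)"
    and j: "j \<in> {1..N}" and b: "b \<in> K j" "b \<in> L" "b \<noteq> 0"
  shows "gtwists K b N = 1"
proof -
  have "gtwists K b n \<in> K j \<and> (n \<ge> j \<longrightarrow> gtwists K b n = 1)" if "n \<le> N" for n
    using that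
  proof (induction n)
    case 0
    then show ?case using b j by simp
  next
    case (Suc n)
    let ?y = "gtwists K b n"
    have y: "?y \<in> K j" "?y \<in> L" "?y \<noteq> 0" "n \<ge> j \<Longrightarrow> ?y = 1"
      using Suc gtwists_closed[OF b(2)] gtwists_nz[OF b(2,3)] by auto
    show ?case
    proof (cases "Suc n = j")
      case True
      have "gtwist (K j) ?y = 1" by (rule gtwist_kill[OF y(1-3)])
      then have "gtwists K b (Suc n) = 1" using True gtwists.simps(2)[of K b n] by (simp only:)
      then show ?thesis using csubfield.one[OF K[OF j]] by simp
    next
      case False
      have "gtwist (K (Suc n)) ?y \<in> K j"
        using Suc.prems False by (intro gtwist_preserves K j y gal) auto
      moreover have "gtwist (K (Suc n)) ?y = 1" if "Suc n \<ge> j"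
        using y(4) that False gtwist_one by simp
      ultimately show ?thesis by simp
    qed
  qed
  then show ?thesis using j by simp
qed

end

text \<open>The element \<open>z\<close> and the exponent \<open>D\<close> are fixed first. For each
  \<epsilon> a Galois field containing \<alpha> and the values of \<beta> is chosen; there the
  twists kill \<beta> and leave a height bound for a power of the twisted \<alpha>, whose exponent
  cancels against the factor \<open>\<bar>m\<bar>\<close> of the hypothesis.\<close>

lemma approximation_theorem:
  fixes K :: "nat \<Rightarrow> complex set"
  assumes K: "\<And>i. i \<in> {1..N} \<Longrightarrow> csubfield (K i) \<and> K i \<subseteq> Qbar"
    and gal: "\<And>i j. i \<in> {1..N} \<Longrightarrow> j \<in> {1..N} \<Longrightarrow> i \<noteq> j \<Longrightarrow>
      galois_extension (K i \<inter> K j) (K i) \<or> galois_extension (K i \<inter> K j) (K j)"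
    and \<alpha>: "algebraic \<alpha>" "\<alpha> \<noteq> 0"
    and approx: "\<And>\<epsilon>::real. \<epsilon> > 0 \<Longrightarrow> \<exists>(m::int) \<beta>. m \<noteq> 0 \<and> (\<forall>i\<in>{1..N}. \<beta> i \<in> K i - {0}) \<and>
      height_le (\<alpha> powi m * (\<Prod>i=1..N. inverse (\<beta> i))) (\<epsilon> * real_of_int \<bar>m\<bar>)"
  shows "\<exists>q::int. q \<noteq> 0 \<and> \<alpha> powi q \<in> units_product K N"
proof -
  have cK: "csubfield (K i)" if "i \<in> {1..N}" for i using K[OF that] by simp
  define z where "z = twists K \<alpha> N"
  define D where "D = twist_degree K \<alpha> N"
  obtain \<kappa> where z0: "algebraic z" "z \<noteq> 0" "D > 0" "\<forall>i\<in>{1..N}. \<kappa> i \<in> K i - {0}"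
    "z = \<alpha> ^ D * (\<Prod>i=1..N. \<kappa> i)"
  proof -
    note dec = twists_decomposition[of N K \<alpha> N, OF _ \<alpha> order_refl]
    have "algebraic z \<and> z \<noteq> 0 \<and> D > 0 \<and>
      (\<exists>\<kappa>. (\<forall>i\<in>{1..N}. \<kappa> i \<in> K i - {0}) \<and> z = \<alpha> ^ D * (\<Prod>i=1..N. \<kappa> i))"
      unfolding z_def D_def by (rule dec) (fact K)
    then show ?thesis by (elim conjE exE) (rule that)
  qed
  note z = z0(1-3) bspec[OF z0(4)] z0(5)
  have "height_le z \<epsilon>" if \<epsilon>: "\<epsilon> > 0" for \<epsilon>
  proof -
    \<comment> \<open>The bound reached for \<open>z\<close> is
      \<open>2 ^ N * C * \<epsilon>' / E\<close>; as \<open>C = E * D\<close>, this choice makes it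
      equal to \<epsilon>, whatever \<open>L\<close> is.\<close>
    define \<epsilon>' where "\<epsilon>' = \<epsilon> / (2 ^ N * real D)"
    have "\<epsilon>' > 0" using \<epsilon> z(3) by (simp add: \<epsilon>'_def)
    from approx[OF this] obtain m :: int and \<beta> where m0: "m \<noteq> 0" "\<forall>i\<in>{1..N}. \<beta> i \<in> K i - {0}"
      "height_le (\<alpha> powi m * (\<Prod>i=1..N. inverse (\<beta> i))) (\<epsilon>' * real_of_int \<bar>m\<bar>)"
      by (elim exE conjE)
    note m = m0(1) bspec[OF m0(2)] m0(3)
    define n where "n = nat \<bar>m\<bar>"
    have n: "n > 0" "real_of_int \<bar>m\<bar> = real n" using m(1) by (simp_all add: n_def)
    have "\<beta> i \<in> Qbar" if i: "i \<in> {1..N}" for i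
      using m(2)[OF i] K[OF i] by blast
    moreover have "\<alpha> \<in> Qbar" using \<alpha>(1) by (simp add: Qbar_def)
    ultimately have "Set.insert \<alpha> (\<beta> ` {1..N}) \<subseteq> Qbar"
      by (intro insert_subsetI image_subsetI)
    from galois_exists[OF _ this] obtain L G
      where LG: "galois L G" "Set.insert \<alpha> (\<beta> ` {1..N}) \<subseteq> L" by auto
    interpret galois L G by (rule LG(1))
    have \<alpha>L: "\<alpha> \<in> L" and \<beta>L: "\<And>i. i \<in> {1..N} \<Longrightarrow> \<beta> i \<in> L" using LG(2) by auto
    define C where "C = (\<Prod>i=1..N. card (stab (K i)))"
    define \<gamma> where "\<gamma> = \<alpha> powi m * (\<Prod>i=1..N. inverse (\<beta> i))"
    \<comment> \<open>A negative exponent \<open>m\<close> is replaced by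
      \<open>n = \<bar>m\<bar>\<close>; the inverse that appears keeps the height bound.\<close>
    have pow: "\<alpha> powi m = \<alpha> ^ n \<or> \<alpha> powi m = inverse (\<alpha> ^ n)"
      by (cases "m \<ge> 0") (auto simp: power_int_def n_def power_inverse)
    then have pL: "\<alpha> powi m \<in> L" using power[OF \<alpha>L, of n] inv[OF power[OF \<alpha>L, of n]] by auto
    have p0: "\<alpha> powi m \<noteq> 0" using \<alpha>(2) by simp
    have \<gamma>L: "\<gamma> \<in> L" unfolding \<gamma>_def using pL \<beta>L by (intro mult prod inv)
    have \<gamma>0: "\<gamma> \<noteq> 0" unfolding \<gamma>_def using p0 m(2) by (auto simp: prod_zero_iff)
    have "gtwists K \<gamma> N = gtwists K (\<alpha> powi m) N"
    proof -
      have "gtwists K (inverse (\<beta> i)) N = 1" if i: "i \<in> {1..N}" for i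
      proof -
        have b: "\<beta> i \<in> K i" "\<beta> i \<noteq> 0" using m(2)[OF i] by simp_all
        have "gtwists K (\<beta> i) N = 1"
          by (rule gtwists_kill[of N K i]) (fact cK gal i \<beta>L[OF i] b)+
        then show ?thesis using gtwists_inverse[OF \<beta>L[OF i] b(2)] by simp
      qed
      then have "gtwists K (\<Prod>i=1..N. inverse (\<beta> i)) N = 1"
        using gtwists_prod[of "{1..N}" "\<lambda>i. inverse (\<beta> i)" K N] \<beta>L inv by simp
      then show ?thesis unfolding \<gamma>_def
        using gtwists_mult[OF pL prod, of "{1..N}" "\<lambda>i. inverse (\<beta> i)" K N] \<beta>L inv by simp
    qed
    moreover have "fam_le (gtwists K \<gamma> N) (2 ^ N * (\<Prod>i=1..N. real (card (stab (K i)))) * (\<epsilon>' * real n))"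
      using m(3) n(2) \<gamma>L \<gamma>0 by (intro fam_le_gtwists fam_le_if_height_le) (simp_all add: \<gamma>_def)
    ultimately have "fam_le (gtwists K (\<alpha> powi m) N) (2 ^ N * real C * \<epsilon>' * real n)"
      by (simp add: C_def mult.assoc)
    then have "fam_le (gtwists K (\<alpha> ^ n) N) (2 ^ N * real C * \<epsilon>' * real n)"
      using pow
    proof (elim disjE)
      assume f: "fam_le (gtwists K (\<alpha> powi m) N) (2 ^ N * real C * \<epsilon>' * real n)"
        and e: "\<alpha> powi m = inverse (\<alpha> ^ n)"
      have "gtwists K (\<alpha> ^ n) N = inverse (gtwists K (\<alpha> powi m) N)"
        unfolding e using gtwists_inverse[OF power[OF \<alpha>L], of n] \<alpha>(2) by simp
      then show ?thesis
        using fam_le_inverse[OF gtwists_closed[OF pL] gtwists_nz[OF pL p0] f] by (simp only:)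
    qed simp
    then have "fam_le (gtwists K \<alpha> N ^ n) (2 ^ N * real C * \<epsilon>' * real n)"
      by (simp only: gtwists_power[OF \<alpha>L])
    from fam_le_root[OF gtwists_closed[OF \<alpha>L] this n(1)]
    have f: "fam_le (gtwists K \<alpha> N) (2 ^ N * real C * \<epsilon>')" using n(1) by simp
    obtain E where E: "E > 0" "z \<in> L" "gtwists K \<alpha> N = z ^ E" "C = E * D"
    proof -
      have "\<exists>E>0. z \<in> L \<and> gtwists K \<alpha> N = z ^ E \<and> C = E * D"
        unfolding z_def C_def D_def by (rule gtwists_eq_twists_power[of N]) (fact cK \<alpha>L order_refl)+
      then show ?thesis by (elim exE conjE) (rule that)
    qed
    have "fam_le z (2 ^ N * real C * \<epsilon>' / real E)"
      using f unfolding E(3) by (rule fam_le_root[OF E(2) _ E(1)])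
    also have "2 ^ N * real C * \<epsilon>' / real E = \<epsilon>"
      using E(1,4) z(3) by (simp add: \<epsilon>'_def)
    finally show "height_le z \<epsilon>" by (rule height_le_if_fam_le[OF E(2)])
  qed
  then obtain k where k: "k > 0" "z ^ k = 1"
    using root_of_unity_if_height_zero[OF z(1,2)] by blast
  \<comment> \<open>The relation \<open>z ^ k = 1\<close> is solved for \<alpha>, giving the
    exponent \<open>D * k\<close> and the factors \<open>inverse (\<kappa> i ^ k)\<close>.\<close>
  have "(\<Prod>i=1..N. \<kappa> i) ^ k * \<alpha> ^ (D * k) = 1"
    using k(2) unfolding z(5) power_mult_distrib power_mult by (simp only: mult.commute)
  then have "\<alpha> ^ (D * k) = inverse ((\<Prod>i=1..N. \<kappa> i) ^ k)"
    by (rule inverse_unique[symmetric])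
  also have "\<dots> = (\<Prod>i=1..N. inverse (\<kappa> i ^ k))"
    using prod_inversef[of "\<lambda>i. \<kappa> i ^ k" "{1..N}"] by (simp add: o_def prod_power_distrib)
  finally have "\<alpha> powi (int (D * k)) = (\<Prod>i=1..N. inverse (\<kappa> i ^ k))" by (simp only: power_int_of_nat)
  moreover have "inverse (\<kappa> i ^ k) \<in> K i - {0}" if i: "i \<in> {1..N}" for i
    using z(4)[OF i] csubfield.inv[OF cK[OF i] csubfield.power[OF cK[OF i]], of "\<kappa> i" k] by simp
  ultimately have "\<alpha> powi (int (D * k)) \<in> units_product K N"
    unfolding units_product_def by (intro CollectI exI[of _ "\<lambda>i. inverse (\<kappa> i ^ k)"]) simp
  then show ?thesis using z(3) k(1) by (intro exI[of _ "int (D * k)"]) simp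
qed

subsection \<open>Coverings by cosets\<close>

text \<open>An upper bound for an index in terms of representatives, meaningful without quotient
  groups and without an inclusion between \<open>A\<close> and \<open>B\<close>.\<close>

definition covered :: "complex set \<Rightarrow> complex set \<Rightarrow> nat \<Rightarrow> bool" where
  "covered A B n \<longleftrightarrow> (\<exists>T. finite T \<and> card T \<le> n \<and> (\<forall>a\<in>A. \<exists>t\<in>T. a - t \<in> B))"

definition add_closed :: "complex set \<Rightarrow> bool" where
  "add_closed B \<longleftrightarrow> 0 \<in> B \<and> (\<forall>x\<in>B. \<forall>y\<in>B. x - y \<in> B)"

lemma add_closedD:
  assumes "add_closed B"
  shows add_closed_zero: "0 \<in> B" and add_closed_diff: "\<And>x y. x \<in> B \<Longrightarrow> y \<in> B \<Longrightarrow> x - y \<in> B"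
    and add_closed_neg: "\<And>x. x \<in> B \<Longrightarrow> - x \<in> B" and add_closed_add: "\<And>x y. x \<in> B \<Longrightarrow> y \<in> B \<Longrightarrow> x + y \<in> B"
proof -
  show 0: "0 \<in> B" and d: "\<And>x y. x \<in> B \<Longrightarrow> y \<in> B \<Longrightarrow> x - y \<in> B"
    using assms by (auto simp: add_closed_def)
  show n: "- x \<in> B" if "x \<in> B" for x using d[OF 0 that] by simp
  show "x + y \<in> B" if "x \<in> B" "y \<in> B" for x y using d[OF that(1) n[OF that(2)]] by simp
qed

lemma covered_trans:
  assumes "covered A B n" "covered B C m"
  shows "covered A C (n * m)"
proof -
  obtain T where T: "finite T" "card T \<le> n" "\<forall>a\<in>A. \<exists>t\<in>T. a - t \<in> B"
    using assms(1) unfolding covered_def by (elim exE conjE)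
  obtain U where U: "finite U" "card U \<le> m" "\<forall>a\<in>B. \<exists>t\<in>U. a - t \<in> C"
    using assms(2) unfolding covered_def by (elim exE conjE)
  let ?V = "(\<lambda>(t, u). t + u) ` (T \<times> U)"
  have "card ?V \<le> card (T \<times> U)" using T U by (intro card_image_le) simp
  also have "\<dots> \<le> n * m" unfolding card_cartesian_product using T U by (intro mult_le_mono)
  finally have "card ?V \<le> n * m" .
  moreover have "\<exists>v\<in>?V. a - v \<in> C" if a: "a \<in> A" for a
  proof -
    obtain t where t: "t \<in> T" "a - t \<in> B" using T(3) a by blast
    obtain u where u: "u \<in> U" "a - t - u \<in> C" using U(3) t(2) by blast
    have "t + u \<in> ?V" using t(1) u(1) by (intro image_eqI[of _ _ "(t, u)"]) auto
    moreover have "a - (t + u) \<in> C" using u(2) by (simp add: diff_diff_eq)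
    ultimately show ?thesis by (rule bexI[rotated])
  qed
  ultimately show ?thesis unfolding covered_def using T(1) U(1) by (intro exI[of _ ?V]) simp
qed

text \<open>One representative is chosen in each fibre of \<open>f\<close>, which in the
  applications is a kind of residue map.\<close>

lemma coveredI:
  assumes "finite (f ` A)" "card (f ` A) \<le> n" "\<And>a b. a \<in> A \<Longrightarrow> b \<in> A \<Longrightarrow> f a = f b \<Longrightarrow> a - b \<in> B"
  shows "covered A B n"
proof -
  define g where "g c = (SOME a. a \<in> A \<and> f a = c)" for c
  have g: "g c \<in> A" "f (g c) = c" if "c \<in> f ` A" for c
  proof -
    have "\<exists>a. a \<in> A \<and> f a = c" using that by blast
    then have "g c \<in> A \<and> f (g c) = c" unfolding g_def by (rule someI_ex)
    then show "g c \<in> A" "f (g c) = c" by simp_all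
  qed
  have "card (g ` f ` A) \<le> n" using card_image_le[OF assms(1), of g] assms(2) by simp
  moreover have "\<exists>t\<in>g ` f ` A. a - t \<in> B" if a: "a \<in> A" for a
    using g[OF imageI[OF a]] assms(3)[OF a] a by (intro bexI[of _ "g (f a)"]) auto
  ultimately show ?thesis unfolding covered_def using assms(1) by (intro exI[of _ "g ` f ` A"]) simp
qed

lemma covered_mono: "covered A B n \<Longrightarrow> A' \<subseteq> A \<Longrightarrow> B \<subseteq> B' \<Longrightarrow> covered A' B' n"
  unfolding covered_def by (meson subsetD)

lemma covered_reps:
  assumes "covered A B n" "add_closed B"
  shows "\<exists>T\<subseteq>A. finite T \<and> card T \<le> n \<and> (\<forall>a\<in>A. \<exists>t\<in>T. a - t \<in> B)"
proof -
  obtain T where T: "finite T" "card T \<le> n" "\<forall>a\<in>A. \<exists>t\<in>T. a - t \<in> B"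
    using assms(1) unfolding covered_def by (elim exE conjE)
  define g where "g t = (SOME a. a \<in> A \<and> a - t \<in> B)" for t
  have g: "g t \<in> A" "g t - t \<in> B" if "a \<in> A" "a - t \<in> B" for a t
  proof -
    have "g t \<in> A \<and> g t - t \<in> B" unfolding g_def by (rule someI[of _ a]) (use that in simp)
    then show "g t \<in> A" "g t - t \<in> B" by simp_all
  qed
  let ?T = "{t\<in>T. \<exists>a\<in>A. a - t \<in> B}"
  have "card (g ` ?T) \<le> card ?T" using T(1) by (intro card_image_le) simp
  also have "\<dots> \<le> card T" using T(1) by (intro card_mono) auto
  finally have "card (g ` ?T) \<le> n" using T(2) by simp
  moreover have "\<exists>t\<in>g ` ?T. a - t \<in> B" if a: "a \<in> A" for a
  proof -
    obtain t where t: "t \<in> T" "a - t \<in> B" using T(3) a by blast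
    have "a - g t = (a - t) - (g t - t)" by simp
    then have "a - g t \<in> B" using add_closed_diff[OF assms(2) t(2) g(2)[OF a t(2)]] by simp
    then show ?thesis using t a by blast
  qed
  moreover have "g ` ?T \<subseteq> A" using g(1) by blast
  ultimately show ?thesis using T(1) by (intro exI[of _ "g ` ?T"]) simp
qed

lemma covered_card:
  assumes "covered A B n" "add_closed B" "S \<subseteq> A" "\<And>s t. s \<in> S \<Longrightarrow> t \<in> S \<Longrightarrow> s - t \<in> B \<Longrightarrow> s = t"
  shows "card S \<le> n"
proof -
  obtain T where T: "finite T" "card T \<le> n" "\<forall>a\<in>A. \<exists>t\<in>T. a - t \<in> B"
    using assms(1) unfolding covered_def by (elim exE conjE)
  have "\<forall>a\<in>S. \<exists>t. t \<in> T \<and> a - t \<in> B" using T(3) assms(3) by blast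
  from bchoice[OF this] obtain f where f: "\<forall>a\<in>S. f a \<in> T \<and> a - f a \<in> B" by blast
  have "inj_on f S"
  proof (rule inj_onI)
    fix a b assume ab: "a \<in> S" "b \<in> S" "f a = f b"
    have "a - f a \<in> B" "b - f b \<in> B" using f ab(1,2) by auto
    from add_closed_diff[OF assms(2) this] have "a - b \<in> B" unfolding ab(3) by simp
    then show "a = b" by (rule assms(4)[OF ab(1,2)])
  qed
  then have "card S \<le> card T" using f T(1) by (intro card_inj_on_le) auto
  then show ?thesis using T(2) by simp
qed

text \<open>Applied to the powers of an element, this stands for the finiteness of a residue
  ring.\<close>

lemma covered_pigeonhole:
  assumes "covered A B n" "add_closed B" "\<And>j::nat. x j \<in> A"
  shows "\<exists>i j. i < j \<and> x j - x i \<in> B"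
proof -
  obtain T where T: "finite T" "card T \<le> n" "\<forall>a\<in>A. \<exists>t\<in>T. a - t \<in> B"
    using assms(1) unfolding covered_def by (elim exE conjE)
  have "\<forall>j. \<exists>t. t \<in> T \<and> x j - t \<in> B" using T(3) assms(3) by blast
  from choice[OF this] obtain f where f: "\<And>j. f j \<in> T \<and> x j - f j \<in> B" by blast
  have "finite (range f)" using f T(1) by (intro finite_subset[of "range f" T]) auto
  then have "\<not> inj f" by (metis finite_imageD infinite_UNIV_nat)
  then have "\<exists>i j. i \<noteq> j \<and> f i = f j" unfolding inj_def by metis
  then obtain i j where ij: "i < j" "f i = f j" by (metis linorder_neqE_nat)
  have "(x j - f j) - (x i - f i) \<in> B" using f by (rule_tac add_closed_diff[OF assms(2)]) simp_all
  then have "x j - x i \<in> B" unfolding ij(2) by simp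
  then show ?thesis using ij(1) by blast
qed

subsection \<open>Prime ideals of rings of integers\<close>

text \<open>The finiteness of the degree enters through \<open>fin_quot\<close>: the integers modulo
  \<open>m\<close> are finite. The ideals of maximal kind and the coinciding powers used below all
  come from it.\<close>

locale number_field = csubfield K for K +
  fixes R :: "complex set"
  assumes R_def: "R = {y \<in> K. algebraic_int y}"
    and fraction: "y \<in> K \<Longrightarrow> \<exists>m::nat. m > 0 \<and> of_nat m * y \<in> R"
    and fin_quot: "m > 0 \<Longrightarrow> \<exists>n. covered R ((\<lambda>r. of_nat m * r) ` R) n"
begin

abbreviation "OK \<equiv> ring_of_integers K"

lemma R_K: "r \<in> R \<Longrightarrow> r \<in> K"
  by (simp add: R_def)

lemma R_one: "1 \<in> R" and R_zero: "0 \<in> R"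
  by (simp_all add: R_def one zero)

lemma R_diff: "r \<in> R \<Longrightarrow> s \<in> R \<Longrightarrow> r - s \<in> R"
  by (simp add: R_def diff algebraic_int_diff)

lemma R_add: "r \<in> R \<Longrightarrow> s \<in> R \<Longrightarrow> r + s \<in> R"
  by (simp add: R_def add algebraic_int_add)

lemma R_mult: "r \<in> R \<Longrightarrow> s \<in> R \<Longrightarrow> r * s \<in> R"
  by (simp add: R_def mult algebraic_int_times)

lemma R_neg: "r \<in> R \<Longrightarrow> - r \<in> R"
  using R_diff[OF R_zero] by simp

lemma R_power: "r \<in> R \<Longrightarrow> r ^ n \<in> R"
  by (simp add: R_def power algebraic_int_power)

lemma R_of_nat: "of_nat n \<in> R"
  by (simp add: R_def of_nat)

lemma R_sum: "(\<And>i. i \<in> I \<Longrightarrow> f i \<in> R) \<Longrightarrow> sum f I \<in> R"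
  by (simp add: R_def sum algebraic_int_sum)

lemma add_closed_principal: "add_closed ((\<lambda>r. a * r) ` R)"
proof -
  have "a * r - a * s \<in> (\<lambda>r. a * r) ` R" if "r \<in> R" "s \<in> R" for r s
    using R_diff[OF that] by (intro image_eqI[of _ _ "r - s"]) (simp_all add: right_diff_distrib)
  then show ?thesis using R_zero by (auto simp: add_closed_def intro!: image_eqI[of 0 _ 0])
qed

lemma nat_multiple:
  assumes "a \<in> R" "a \<noteq> 0"
  shows "\<exists>m::nat. m > 0 \<and> (\<exists>b\<in>R. of_nat m = a * b)"
proof -
  obtain m :: nat where m: "m > 0" "of_nat m * inverse a \<in> R"
    using fraction[OF inv[OF R_K[OF assms(1)]]] by blast
  then show ?thesis using assms(2) by (intro exI[of _ m] conjI bexI[of _ "of_nat m * inverse a"]) auto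
qed

lemma fin_quot_principal:
  assumes "a \<in> R" "a \<noteq> 0"
  shows "\<exists>n. covered R ((\<lambda>r. a * r) ` R) n"
proof -
  obtain m b where m: "m > 0" "b \<in> R" "of_nat m = a * b" using nat_multiple[OF assms] by blast
  obtain n where "covered R ((\<lambda>r. of_nat m * r) ` R) n" using fin_quot[OF m(1)] by blast
  moreover have "(\<lambda>r. of_nat m * r) ` R \<subseteq> (\<lambda>r. a * r) ` R"
    using R_mult[OF m(2)] by (auto simp: m(3) mult.assoc)
  ultimately show ?thesis using covered_mono by blast
qed

text \<open>Complete integral closedness: as \<open>R\<close> modulo \<open>a\<close> is finite, two
  of the \<open>a * z ^ n\<close> are congruent. So \<open>z ^ j - z ^ i\<close> lies in
  \<open>R\<close>, and \<open>z\<close> is a root of a monic polynomial with integral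
  coefficients.\<close>

lemma integral_if_powers_bounded:
  assumes "a \<in> R" "a \<noteq> 0" "z \<in> K" "\<And>n. a * z ^ n \<in> R"
  shows "z \<in> R"
proof -
  obtain n where "covered R ((\<lambda>r. a * r) ` R) n" using fin_quot_principal[OF assms(1,2)] by blast
  from covered_pigeonhole[OF this add_closed_principal, of "\<lambda>n. a * z ^ n", OF assms(4)]
  obtain i j where ij: "i < j" "a * z ^ j - a * z ^ i \<in> (\<lambda>r. a * r) ` R" by (elim exE conjE)
  obtain r where r: "r \<in> R" "a * z ^ j - a * z ^ i = a * r" using ij(2) by (elim imageE)
  have "a * (z ^ j - z ^ i) = a * r" using r(2) by (simp only: right_diff_distrib)
  then have e: "z ^ j - z ^ i = r" using assms(2) by simp
  have c: "coeff (monom 1 j - monom 1 i :: complex poly) k = (if k = j then 1 else 0) - (if k = i then 1 else 0)" for k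
    by simp
  have deg: "degree (monom 1 j - monom 1 i :: complex poly) = j"
    using ij(1) by (intro antisym degree_le le_degree) (auto simp: c)
  have "algebraic_int z"
  proof (rule algebraic_int_root)
    show "algebraic_int r" using r(1) by (simp add: R_def)
    show "poly (monom 1 j - monom 1 i) z = r" using e by (simp add: poly_monom)
    show "\<forall>k. coeff (monom 1 j - monom 1 i :: complex poly) k \<in> \<int>" by (simp add: c)
    show "lead_coeff (monom 1 j - monom 1 i :: complex poly) = 1" unfolding deg using ij(1) by simp
    show "degree (monom 1 j - monom 1 i :: complex poly) > 0" unfolding deg using ij(1) by simp
  qed
  then show ?thesis using assms(3) by (simp add: R_def)
qed

definition prime_ideal :: "complex set \<Rightarrow> bool" where
  "prime_ideal P \<longleftrightarrow> P \<subseteq> R \<and> add_closed P \<and> (\<forall>r\<in>R. \<forall>p\<in>P. r * p \<in> P) \<and> 1 \<notin> P \<and>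
     (\<forall>a\<in>R. \<forall>b\<in>R. a * b \<in> P \<longrightarrow> a \<in> P \<or> b \<in> P) \<and> (\<exists>a\<in>P. a \<noteq> 0)"

lemma OK_simps:
  "carrier OK = R" "x \<otimes>\<^bsub>OK\<^esub> y = x * y" "x \<oplus>\<^bsub>OK\<^esub> y = x + y" "\<one>\<^bsub>OK\<^esub> = 1" "\<zero>\<^bsub>OK\<^esub> = 0"
  by (simp_all add: ring_of_integers_def ring_of_type_algebra_def R_def)

lemma cring_OK: "cring OK"
proof (rule cringI)
  show "abelian_group OK"
    by (rule abelian_groupI) (use R_add R_neg R_zero in \<open>auto simp: OK_simps intro!: bexI[of _ "- _"]\<close>)
  show "Group.comm_monoid OK"
    by (rule comm_monoidI) (use R_mult R_one in \<open>auto simp: OK_simps\<close>)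
qed (auto simp: OK_simps distrib_right)

lemma prime_ideal_if_finite_place:
  assumes "P \<in> finite_places K"
  shows "prime_ideal P"
proof -
  have pi: "primeideal P OK" and nz: "P \<noteq> {0}" using assms by (auto simp: finite_places_def)
  interpret primeideal P OK by (rule pi)
  have sub: "P \<subseteq> R" using a_subset by (simp add: OK_simps)
  note sub_P = ideal.axioms(1)[OF primeideal.axioms(1)[OF pi]]
  have zero: "0 \<in> P" using additive_subgroup.zero_closed[OF sub_P] by (simp add: OK_simps)
  have neg: "- p \<in> P" if p: "p \<in> P" for p
    using I_l_closed[OF p, of "- 1"] R_neg[OF R_one] by (simp add: OK_simps)
  have diff': "p - q \<in> P" if "p \<in> P" "q \<in> P" for p q
    using additive_subgroup.a_closed[OF sub_P that(1) neg[OF that(2)]] by (simp add: OK_simps)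
  have one': "1 \<notin> P" using I_notcarr one_imp_carrier by (auto simp: OK_simps)
  have pr: "a \<in> P \<or> b \<in> P" if "a \<in> R" "b \<in> R" "a * b \<in> P" for a b
    using I_prime[of a b] that by (simp add: OK_simps)
  have ab: "r * p \<in> P" if "r \<in> R" "p \<in> P" for r p
    using I_l_closed[of p r] that by (simp add: OK_simps)
  have ex: "\<exists>a\<in>P. a \<noteq> 0"
  proof (rule ccontr)
    assume "\<not> (\<exists>a\<in>P. a \<noteq> 0)"
    then have "P = {0}" using zero by auto
    then show False using nz by simp
  qed
  show ?thesis
    unfolding prime_ideal_def add_closed_def
    by (intro conjI ballI impI) (simp_all add: sub zero ex one' diff' ab pr)
qed

lemma finite_place_if_prime_ideal:
  assumes "prime_ideal P"
  shows "P \<in> finite_places K"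
proof -
  have P: "P \<subseteq> R" "add_closed P" "\<And>r p. r \<in> R \<Longrightarrow> p \<in> P \<Longrightarrow> r * p \<in> P" "1 \<notin> P"
    "\<exists>a\<in>P. a \<noteq> 0"
    using assms unfolding prime_ideal_def by simp_all
  have pr: "a \<in> P \<or> b \<in> P" if "a \<in> R" "b \<in> R" "a * b \<in> P" for a b
    using assms that unfolding prime_ideal_def by blast
  interpret cring OK by (rule cring_OK)
  have minus: "\<ominus>\<^bsub>OK\<^esub> p = - p" if "p \<in> R" for p
    by (rule minus_equality) (use that R_neg in \<open>auto simp: OK_simps\<close>)
  have "ideal P OK"
  proof (rule idealI)
    show "ring OK" by (rule ring_axioms)
    show "subgroup P (add_monoid OK)"
    proof (rule add.subgroupI)
      show "P \<subseteq> carrier OK" "P \<noteq> {}" using P(1,5) by (auto simp: OK_simps)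
      show "\<ominus>\<^bsub>OK\<^esub> p \<in> P" if "p \<in> P" for p
        using minus[of p] add_closed_neg[OF P(2) that] P(1) that by auto
      show "p \<oplus>\<^bsub>OK\<^esub> q \<in> P" if "p \<in> P" "q \<in> P" for p q
        using add_closed_add[OF P(2) that] by (simp add: OK_simps)
    qed
    show "r \<otimes>\<^bsub>OK\<^esub> p \<in> P" "p \<otimes>\<^bsub>OK\<^esub> r \<in> P" if "p \<in> P" "r \<in> carrier OK" for p r
      using P(3)[of r p] that by (simp_all add: OK_simps mult.commute)
  qed
  then have "primeideal P OK"
    by (rule primeidealI) (use cring_OK P(4) pr R_one in \<open>auto simp: OK_simps\<close>)
  then show ?thesis using P(5) by (auto simp: finite_places_def)
qed

end

section \<open>Residue fields and local uniformizers\<close>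

locale prime_place = number_field +
  fixes P
  assumes prime_P: "prime_ideal P"
begin

lemma P_R: "p \<in> P \<Longrightarrow> p \<in> R"
  and add_closed_P: "add_closed P"
  and P_absorb: "r \<in> R \<Longrightarrow> p \<in> P \<Longrightarrow> r * p \<in> P"
  and one_notin_P: "1 \<notin> P"
  and P_prime: "a \<in> R \<Longrightarrow> b \<in> R \<Longrightarrow> a * b \<in> P \<Longrightarrow> a \<in> P \<or> b \<in> P"
  and P_nontrivial: "\<exists>a\<in>P. a \<noteq> 0"
  using prime_P unfolding prime_ideal_def by blast+

lemma notin_P_mult: "a \<in> R - P \<Longrightarrow> b \<in> R - P \<Longrightarrow> a * b \<in> R - P"
  using P_prime[of a b] R_mult[of a b] by blast

lemma one_R_P: "1 \<in> R - P"
  using R_one one_notin_P by simp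

lemma notin_P_power: "a \<in> R - P \<Longrightarrow> a ^ n \<in> R - P"
proof (induction n)
  case 0
  then show ?case using one_R_P by simp
next
  case (Suc n)
  then show ?case using notin_P_mult[of a "a ^ n"] by simp
qed

lemma covered_P: "\<exists>n. covered R P n"
proof -
  obtain a where a: "a \<in> P" "a \<noteq> 0" using P_nontrivial by blast
  obtain n where "covered R ((\<lambda>r. a * r) ` R) n"
    using fin_quot_principal[OF P_R[OF a(1)] a(2)] by blast
  moreover have "(\<lambda>r. a * r) ` R \<subseteq> P" using P_absorb[OF _ a(1)] by (auto simp: mult.commute)
  ultimately show ?thesis using covered_mono by blast
qed

text \<open>A finite domain is a field: two powers of \<open>s\<close> agree modulo
  \<open>P\<close>, and the smaller one cancels because \<open>P\<close> is prime.\<close>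

lemma inverse_mod_P:
  assumes "s \<in> R - P"
  shows "\<exists>t\<in>R. 1 - s * t \<in> P"
proof -
  obtain n where "covered R P n" using covered_P by blast
  from covered_pigeonhole[OF this add_closed_P, of "\<lambda>j. s ^ j", OF R_power[OF DiffD1[OF assms]]]
  obtain i j where ij: "i < j" "s ^ j - s ^ i \<in> P" by (elim exE conjE)
  have e: "s ^ i * (1 - s * s ^ (j - i - 1)) = - (s ^ j - s ^ i)"
  proof -
    have "s ^ i * (s * s ^ (j - i - 1)) = s ^ (i + Suc (j - i - 1))" by (simp only: power_add power_Suc)
    also have "i + Suc (j - i - 1) = j" using ij(1) by simp
    finally show ?thesis by (simp add: right_diff_distrib)
  qed
  then have "s ^ i * (1 - s * s ^ (j - i - 1)) \<in> P" using add_closed_neg[OF add_closed_P ij(2)] by (simp only:)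
  moreover have "s ^ (j - i - 1) \<in> R" "s ^ i \<in> R - P" using R_power[of s] notin_P_power[OF assms] assms by auto
  ultimately show ?thesis
    using P_prime[of "s ^ i" "1 - s * s ^ (j - i - 1)"] R_diff[OF R_one R_mult, of s "s ^ (j - i - 1)"] assms by blast
qed

text \<open>
  Some \<open>b\<close> has annihilator exactly \<open>P\<close> modulo a nonzero principal ideal contained in \<open>P\<close>.
\<close>

lemma annihilated_element:
  assumes a: "a \<in> P" "a \<noteq> 0"
  shows "\<exists>b\<in>R. b \<notin> (\<lambda>r. a * r) ` R \<and> (\<forall>p\<in>P. p * b \<in> (\<lambda>r. a * r) ` R)"
proof -
  let ?A = "(\<lambda>r. a * r) ` R"
  note aR = P_R[OF a(1)]
  note A_add = add_closed_principal[of a]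
  have A_absorb: "r * x \<in> ?A" if rx: "r \<in> R" "x \<in> ?A" for r x
  proof -
    obtain y where y: "y \<in> R" "x = a * y" using rx(2) by (elim imageE)
    then show ?thesis using R_mult[OF rx(1) y(1)] by (intro image_eqI[of _ _ "r * y"]) (simp_all add: mult_ac)
  qed
  have A_P: "?A \<subseteq> P" using P_absorb[OF _ a(1)] by (auto simp: mult.commute)
  have A_R: "?A \<subseteq> R" using R_mult[OF aR] by auto
  obtain n where n: "covered R ?A n" using fin_quot_principal[OF aR a(2)] by blast
  obtain T where T: "T \<subseteq> R" "finite T" "\<forall>r\<in>R. \<exists>t\<in>T. r - t \<in> ?A"
    using covered_reps[OF n A_add] by blast
  define colon where "colon b = {r\<in>R. r * b \<in> ?A}" for b
  have colonI: "r \<in> colon c" if "r \<in> R" "y \<in> ?A" "y = r * c" for r c y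
    using that unfolding colon_def by (simp only: mem_Collect_eq)
  have colonD: "r \<in> R" "r * c \<in> ?A" if "r \<in> colon c" for r c
    using that unfolding colon_def by (simp_all only: mem_Collect_eq)
  let ?Q = "\<lambda>b. b \<in> R \<and> colon b \<subseteq> P"
  have Q1: "?Q 1" using A_P R_one by (auto simp: colon_def)
  \<comment> \<open>An ideal containing \<open>?A\<close> is determined by the representatives in
    \<open>T\<close> that it contains. Maximizing their number yields a \<open>b\<close> whose
    annihilator modulo \<open>?A\<close> is maximal among those inside \<open>P\<close>.\<close>
  have "card (T \<inter> colon b) < Suc (card T)" for b
    unfolding less_Suc_eq_le by (rule card_mono[OF T(2) Int_lower1])
  then have "\<exists>b. ?Q b \<and> (\<forall>b'. ?Q b' \<longrightarrow> card (T \<inter> colon b') \<le> card (T \<inter> colon b))"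
    by (intro ex_has_greatest_nat[of ?Q 1 "\<lambda>b. card (T \<inter> colon b)" "Suc (card T)", OF Q1]) simp
  then obtain b where b: "b \<in> R" "colon b \<subseteq> P"
    and b_max: "\<forall>b'. ?Q b' \<longrightarrow> card (T \<inter> colon b') \<le> card (T \<inter> colon b)"
    by (elim exE conjE)
  have maxeq: "colon b' \<subseteq> colon b" if b': "b' \<in> R" "colon b \<subseteq> colon b'" "colon b' \<subseteq> P" for b'
  proof
    fix r assume r: "r \<in> colon b'"
    have eq: "T \<inter> colon b = T \<inter> colon b'"
      by (rule card_seteq) (use T(2) b'(2) b_max b' in auto)
    have A_colon: "x \<in> colon c" if "x \<in> ?A" "c \<in> R" for x c
      using that A_R A_absorb[OF that(2,1)] by (auto simp: colon_def mult.commute)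
    have colon_diff: "x - y \<in> colon c" if "x \<in> colon c" "y \<in> colon c" for x y c
      using that R_diff[of x y] add_closed_diff[OF A_add, of "x * c" "y * c"] by (simp add: colon_def left_diff_distrib)
    have colon_add: "x + y \<in> colon c" if "x \<in> colon c" "y \<in> colon c" for x y c
      using that R_add[of x y] add_closed_add[OF A_add, of "x * c" "y * c"] by (simp add: colon_def distrib_right)
    have "r \<in> R" using r by (simp add: colon_def)
    then obtain t where t: "t \<in> T" "r - t \<in> ?A" using T(3) by blast
    have "t = r - (r - t)" by simp
    then have "t \<in> colon b'" using colon_diff[OF r A_colon[OF t(2) b'(1)]] by simp
    then have "t \<in> colon b" using eq t(1) by blast
    then have "t + (r - t) \<in> colon b" by (rule colon_add) (rule A_colon[OF t(2) b(1)])
    then show "r \<in> colon b" by simp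
  qed
  have "p * b \<in> ?A" if p: "p \<in> P" for p
  proof -
    have pR: "p \<in> R" by (rule P_R[OF p])
    have powP: "p ^ Suc k \<in> P" for k using P_absorb[OF R_power[OF pR, of k] p] by (simp add: mult.commute)
    obtain i j where ij: "i < j" "p ^ j - p ^ i \<in> ?A"
      using covered_pigeonhole[OF n A_add, of "\<lambda>j. p ^ j", OF R_power[OF pR]] by (elim exE conjE)
    define d where "d = j - i - 1"
    have jd: "p ^ j = p ^ i * p ^ Suc d" using ij(1) by (simp add: d_def flip: power_add power_Suc)
    \<comment> \<open>By the periodicity of powers modulo \<open>?A\<close>, some
      \<open>b * p ^ i\<close> is annihilated by an element outside \<open>P\<close>.\<close>
    have "1 - p ^ Suc d \<in> colon (b * p ^ i)"
    proof -
      have "(1 - p ^ Suc d) * (b * p ^ i) = - (b * (p ^ j - p ^ i))" unfolding jd by (simp add: algebra_simps)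
      moreover have "- (b * (p ^ j - p ^ i)) \<in> ?A" by (rule add_closed_neg[OF A_add A_absorb[OF b(1) ij(2)]])
      ultimately show ?thesis using R_diff[OF R_one R_power[OF pR, of "Suc d"]] by (simp only: colon_def mem_Collect_eq)
    qed
    moreover have "1 - p ^ Suc d \<notin> P"
    proof
      assume "1 - p ^ Suc d \<in> P"
      from add_closed_add[OF add_closed_P this powP[of d]] show False using one_notin_P by simp
    qed
    ultimately have "\<not> colon (b * p ^ i) \<subseteq> P" by blast
    note ex = this
    \<comment> \<open>At the last exponent \<open>l\<close> before the annihilator of
      \<open>b * p ^ k\<close> leaves \<open>P\<close>, maximality equates it with
      \<open>colon b\<close>. If \<open>s\<close> outside \<open>P\<close> kills
      \<open>b * p ^ k\<close>, then \<open>s * p\<close> kills \<open>b\<close>. As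
      \<open>P\<close> is prime, \<open>colon (s * b)\<close> is inside \<open>P\<close>, hence
      equals \<open>colon b\<close> and shows that \<open>p\<close> kills \<open>b\<close>.\<close>
    define k where "k = (LEAST k. \<not> colon (b * p ^ k) \<subseteq> P)"
    have k1: "\<not> colon (b * p ^ k) \<subseteq> P" unfolding k_def using ex by (rule LeastI)
    have k2: "colon (b * p ^ l) \<subseteq> P" if "l < k" for l
      using not_less_Least[OF that[unfolded k_def]] by simp
    have "k \<noteq> 0" using k1 b(2) by (intro notI) simp
    then obtain l where l: "k = Suc l" by (cases k) simp_all
    have bpl: "b * p ^ l \<in> R" by (rule R_mult[OF b(1) R_power[OF pR]])
    have "colon b \<subseteq> colon (b * p ^ l)"
    proof
      fix r assume "r \<in> colon b"
      note r = colonD[OF this]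
      show "r \<in> colon (b * p ^ l)"
        by (rule colonI[OF r(1) A_absorb[OF R_power[OF pR] r(2)]]) (simp only: mult_ac)
    qed
    then have le1: "colon (b * p ^ l) \<subseteq> colon b"
      by (rule maxeq[OF bpl _ k2]) (simp only: l lessI)
    obtain s where s: "s \<in> colon (b * p ^ k)" "s \<notin> P" using k1 by (metis subsetI)
    have sR: "s \<in> R" using s(1) by (rule colonD)
    have "s * (b * p ^ k) = s * p * (b * p ^ l)" unfolding l by (simp only: power_Suc mult_ac)
    then have "s * p \<in> colon (b * p ^ l)" by (rule colonI[OF R_mult[OF sR pR] colonD(2)[OF s(1)]])
    then have "s * p \<in> colon b" by (rule subsetD[OF le1])
    then have sp: "s * p * b \<in> ?A" by (rule colonD)
    have sb: "s * b \<in> R" by (rule R_mult[OF sR b(1)])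
    have "colon b \<subseteq> colon (s * b)"
    proof
      fix r assume "r \<in> colon b"
      note r = colonD[OF this]
      show "r \<in> colon (s * b)"
        by (rule colonI[OF r(1) A_absorb[OF sR r(2)]]) (simp only: mult_ac)
    qed
    moreover have "colon (s * b) \<subseteq> P"
    proof
      fix t assume t: "t \<in> colon (s * b)"
      then have tR: "t \<in> R" by (rule colonD)
      have "t * s \<in> colon b"
        by (rule colonI[OF R_mult[OF tR sR] colonD(2)[OF t]]) (simp only: mult_ac)
      then have "t * s \<in> P" by (rule subsetD[OF b(2)])
      then show "t \<in> P" using P_prime[OF tR sR] s(2) by simp
    qed
    ultimately have "colon (s * b) \<subseteq> colon b" by (rule maxeq[OF sb])
    moreover have "p \<in> colon (s * b)" by (rule colonI[OF pR sp]) (simp only: mult_ac)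
    ultimately have "p \<in> colon b" by (rule subsetD)
    then show ?thesis by (rule colonD)
  qed
  moreover have "b \<notin> ?A"
  proof
    assume "b \<in> ?A"
    then have "1 \<in> colon b" by (rule colonI[OF R_one]) simp
    then show False using b(2) one_notin_P by blast
  qed
  ultimately show ?thesis using b(1) by blast
qed

text \<open>The quotient \<open>z = b / a\<close> sends \<open>P\<close> into \<open>R\<close>
  without being integral. If it sent \<open>P\<close> into \<open>P\<close>, all
  \<open>a * z ^ n\<close> would lie in \<open>P\<close> and \<open>z\<close> would be integral
  after all; so some \<open>w\<close> in \<open>P\<close> has \<open>z * w\<close> outside
  \<open>P\<close>.\<close>

lemma local_uniformizer:
  "\<exists>z w. z \<in> K \<and> (\<forall>p\<in>P. z * p \<in> R) \<and> w \<in> P \<and> z * w \<notin> P"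
proof -
  obtain a where a: "a \<in> P" "a \<noteq> 0" using P_nontrivial by (elim bexE)
  obtain b where b0: "b \<in> R" "b \<notin> (\<lambda>r. a * r) ` R" "\<forall>p\<in>P. p * b \<in> (\<lambda>r. a * r) ` R"
    using annihilated_element[OF a] by (elim bexE conjE)
  note b = b0(1,2) bspec[OF b0(3)]
  define z where "z = b / a"
  have zK: "z \<in> K" unfolding z_def using b(1) P_R[OF a(1)] by (intro divide R_K)
  have zP: "z * p \<in> R" if p: "p \<in> P" for p
  proof -
    obtain r where r: "r \<in> R" "p * b = a * r" using b(3)[OF p] by (elim imageE)
    have "z * p = (p * b) / a" by (simp add: z_def mult.commute)
    also have "\<dots> = r" unfolding r(2) using a(2) by simp
    finally show ?thesis using r(1) by simp
  qed
  have "z \<notin> R"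
  proof
    assume z: "z \<in> R"
    have "b = a * z" using a(2) by (simp add: z_def)
    then have "b \<in> (\<lambda>r. a * r) ` R" using z by (rule image_eqI)
    then show False by (rule notE[OF b(2)])
  qed
  have "\<exists>w\<in>P. z * w \<notin> P"
  proof (rule ccontr)
    assume "\<not> (\<exists>w\<in>P. z * w \<notin> P)"
    then have zw: "z * w \<in> P" if "w \<in> P" for w using that by (simp only: bex_simps not_not)
    have "a * z ^ n \<in> P" for n
    proof (induction n)
      case (Suc n)
      then show ?case using zw[OF Suc.IH] by (simp add: mult_ac)
    qed (use a in simp)
    then have "a * z ^ n \<in> R" for n by (rule P_R)
    then have "z \<in> R" by (rule integral_if_powers_bounded[OF P_R[OF a(1)] a(2) zK])
    then show False using \<open>z \<notin> R\<close> by simp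
  qed
  then obtain w where w: "w \<in> P" "z * w \<notin> P" by (elim bexE)
  show ?thesis
    by (rule exI[of _ z], rule exI[of _ w]) (intro conjI ballI zK zP w)
qed

end

text \<open>For \<open>p\<close> in \<open>P\<close> the identity
  \<open>(z * w) * p = (z * p) * w\<close>, with \<open>z * w\<close> a unit at \<open>P\<close>,
  shows that \<open>w\<close> generates the maximal ideal of the local ring.\<close>

locale uniformized_place = prime_place K R P for K R P +
  fixes z w :: complex
  assumes z_in_K: "z \<in> K" and z_P: "p \<in> P \<Longrightarrow> z * p \<in> R" and w_P: "w \<in> P" and zw_P: "z * w \<notin> P"
begin

lemma w_R: "w \<in> R"
  by (rule P_R[OF w_P])

lemma u_R_P: "z * w \<in> R - P"
  using z_P[OF w_P] zw_P by (rule DiffI)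

lemma R_P_nz: "s \<in> R - P \<Longrightarrow> s \<noteq> 0"
  using add_closed_zero[OF add_closed_P] by (metis DiffD2)

lemma w_nz: "w \<noteq> 0"
  using R_P_nz[OF u_R_P] by (metis mult_zero_right)

lemma w_power_P: "w ^ Suc n \<in> P"
  using P_absorb[OF R_power[OF w_R] w_P, of n] by (simp only: power_Suc2)

text \<open>\<open>val n y\<close> says that \<open>y\<close> has order \<open>n\<close> at \<open>P\<close>.\<close>

definition val :: "int \<Rightarrow> complex \<Rightarrow> bool" where
  "val n y \<longleftrightarrow> (\<exists>s\<in>R - P. \<exists>r\<in>R - P. s * y = r * w powi n)"

lemma valI: "s \<in> R - P \<Longrightarrow> r \<in> R - P \<Longrightarrow> s * y = r * w powi n \<Longrightarrow> val n y"
  unfolding val_def by (rule bexI[of _ s], rule bexI[of _ r])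

lemma valE:
  assumes "val n y"
  obtains s r where "s \<in> R - P" "r \<in> R - P" "s * y = r * w powi n"
  using assms unfolding val_def by (elim bexE)

lemma not_val_less:
  assumes "val n y" "val m y" "n < m"
  shows False
proof -
  obtain s r where 1: "s \<in> R - P" "r \<in> R - P" "s * y = r * w powi n" by (rule valE[OF assms(1)])
  obtain s' r' where 2: "s' \<in> R - P" "r' \<in> R - P" "s' * y = r' * w powi m" by (rule valE[OF assms(2)])
  obtain k where k: "m = n + int (Suc k)" using assms(3) by (metis zless_iff_Suc_zadd)
  have "w powi m = w powi n * w ^ Suc k"
    unfolding k using w_nz by (subst power_int_add) (simp_all only: power_int_of_nat not_False_eq_True simp_thms)
  then have "(s' * r) * w powi n = (s * (r' * w ^ Suc k)) * w powi n"
    using 1(3) 2(3) by (metis (no_types, opaque_lifting) mult.assoc mult.commute)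
  then have e: "s' * r = s * (r' * w ^ Suc k)"
    using w_nz by (metis mult_right_cancel power_int_eq_0_iff)
  have "s * (r' * w ^ Suc k) \<in> P" by (intro P_absorb w_power_P DiffD1[OF 1(1)] DiffD1[OF 2(2)])
  then have "s' * r \<in> P" by (simp only: e)
  then show False by (rule DiffD2[OF notin_P_mult[OF 2(1) 1(2)]])
qed

lemma val_unique: "val n y \<Longrightarrow> val m y \<Longrightarrow> n = m"
  using not_val_less by (metis linorder_neqE)

lemma val_divide:
  assumes "val n y" "val m y'"
  shows "val (n - m) (y / y')"
proof -
  obtain s r where 1: "s \<in> R - P" "r \<in> R - P" "s * y = r * w powi n" by (rule valE[OF assms(1)])
  obtain s' r' where 2: "s' \<in> R - P" "r' \<in> R - P" "s' * y' = r' * w powi m" by (rule valE[OF assms(2)])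
  have nz: "s \<noteq> 0" "r' \<noteq> 0" "s' \<noteq> 0" using R_P_nz 1 2 by simp_all
  have y: "y = r * w powi n / s" using 1(3) nz(1) by (simp add: field_simps)
  have y': "y' = r' * w powi m / s'" using 2(3) nz(3) by (simp add: field_simps)
  have "(s * r') * (y / y') = (r * s') * w powi (n - m)"
    unfolding y y' power_int_diff[OF disjI1[OF w_nz]] using nz by simp
  then show ?thesis by (rule valI[OF notin_P_mult[OF 1(1) 2(2)] notin_P_mult[OF 1(2) 2(1)]])
qed

section \<open>Powers of a prime ideal and orders of elements\<close>

abbreviation pw :: "nat \<Rightarrow> complex set" where
  "pw n \<equiv> P [^]\<^bsub>ideals_set OK\<^esub> n"

lemma pw_0: "pw 0 = R"
  by (simp add: nat_pow_def ideals_set_def OK_simps)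

lemma pw_Suc: "pw (Suc n) = ideal_prod OK (pw n) P"
  by (simp add: nat_pow_def ideals_set_def)

lemma pw_Suc_induct:
  assumes "y \<in> pw (Suc n)" "\<And>i j. i \<in> pw n \<Longrightarrow> j \<in> P \<Longrightarrow> Q (i * j)"
    "\<And>a b. Q a \<Longrightarrow> Q b \<Longrightarrow> Q (a + b)"
  shows "Q y"
  using assms(1) unfolding pw_Suc
  by (induction rule: ideal_prod.induct) (simp_all only: OK_simps assms(2,3))

lemma pw_Suc_mult: "i \<in> pw n \<Longrightarrow> j \<in> P \<Longrightarrow> i * j \<in> pw (Suc n)"
  using ideal_prod.prod[of i "pw n" j P OK] unfolding pw_Suc OK_simps .

lemma pw_add: "a \<in> pw n \<Longrightarrow> b \<in> pw n \<Longrightarrow> a + b \<in> pw n"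
proof (cases n)
  case 0
  assume "a \<in> pw n" "b \<in> pw n"
  then show ?thesis unfolding 0 pw_0 by (rule R_add)
next
  case (Suc m)
  assume "a \<in> pw n" "b \<in> pw n"
  then show ?thesis unfolding Suc pw_Suc
    using ideal_prod.sum[of a OK "pw m" P b] unfolding OK_simps by simp
qed

lemma pw_absorb: "r \<in> R \<Longrightarrow> y \<in> pw n \<Longrightarrow> r * y \<in> pw n"
proof (induction n arbitrary: y)
  case 0
  then show ?case unfolding pw_0 by (intro R_mult)
next
  case (Suc n)
  show ?case
  proof (rule pw_Suc_induct[OF Suc.prems(2)])
    show "r * (i * j) \<in> pw (Suc n)" if "i \<in> pw n" "j \<in> P" for i j
      using pw_Suc_mult[OF Suc.IH[OF Suc.prems(1) that(1)] that(2)] by (simp only: mult.assoc)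
    show "r * (a + b) \<in> pw (Suc n)" if "r * a \<in> pw (Suc n)" "r * b \<in> pw (Suc n)" for a b
      using pw_add[OF that] by (simp only: distrib_left)
  qed
qed

lemma power_pw: "p \<in> P \<Longrightarrow> p ^ n \<in> pw n"
proof (induction n)
  case 0
  then show ?case unfolding pw_0 using R_one by simp
next
  case (Suc n)
  then show ?case using pw_Suc_mult[OF Suc.IH[OF Suc.prems] Suc.prems] by (simp only: power_Suc2)
qed

lemma pw_z: "y \<in> pw n \<Longrightarrow> z ^ n * y \<in> R"
proof (induction n arbitrary: y)
  case 0
  then show ?case unfolding pw_0 by simp
next
  case (Suc n)
  show ?case
  proof (rule pw_Suc_induct[OF Suc.prems])
    show "z ^ Suc n * (i * j) \<in> R" if "i \<in> pw n" "j \<in> P" for i j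
    proof -
      have "(z ^ n * i) * (z * j) \<in> R" by (rule R_mult[OF Suc.IH[OF that(1)] z_P[OF that(2)]])
      moreover have "(z ^ n * i) * (z * j) = z ^ Suc n * (i * j)" by (simp only: power_Suc mult_ac)
      ultimately show ?thesis by (simp only:)
    qed
    show "z ^ Suc n * (a + b) \<in> R" if "z ^ Suc n * a \<in> R" "z ^ Suc n * b \<in> R" for a b
      using R_add[OF that] by (simp only: distrib_left)
  qed
qed

text \<open>A factor \<open>j\<close> from \<open>P\<close> is traded for the local generator by
  \<open>(z * w) * j = (z * j) * w\<close>.\<close>

lemma pw_local:
  assumes "y \<in> pw n"
  shows "\<exists>s\<in>R - P. \<exists>r\<in>R. s * y = r * w ^ n"
  using assms
proof (induction n arbitrary: y)
  case 0
  then have "y \<in> R" unfolding pw_0 .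
  then show ?case by (intro bexI[of _ 1] bexI[of _ y] one_R_P) simp_all
next
  case (Suc n)
  show ?case
  proof (rule pw_Suc_induct[OF Suc.prems])
    fix i j assume i: "i \<in> pw n" and j: "j \<in> P"
    obtain s r where sr: "s \<in> R - P" "r \<in> R" "s * i = r * w ^ n" using Suc.IH[OF i] by (elim bexE)
    have "(s * (z * w)) * (i * j) = (s * i) * (z * j) * w" by (simp only: mult_ac)
    also have "\<dots> = (r * (z * j)) * w ^ Suc n" unfolding sr(3) by (simp only: power_Suc mult_ac)
    finally show "\<exists>s\<in>R - P. \<exists>r\<in>R. s * (i * j) = r * w ^ Suc n"
      by (intro bexI[of _ "s * (z * w)"] bexI[of _ "r * (z * j)"] notin_P_mult sr u_R_P R_mult z_P j)
  next
    fix a b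
    assume "\<exists>s\<in>R - P. \<exists>r\<in>R. s * a = r * w ^ Suc n" "\<exists>s\<in>R - P. \<exists>r\<in>R. s * b = r * w ^ Suc n"
    then obtain s r s' r' where 1: "s \<in> R - P" "r \<in> R" "s * a = r * w ^ Suc n"
      and 2: "s' \<in> R - P" "r' \<in> R" "s' * b = r' * w ^ Suc n" by (elim bexE)
    have "(s * s') * (a + b) = s' * (s * a) + s * (s' * b)" by (simp only: distrib_left mult_ac)
    also have "\<dots> = (s' * r + s * r') * w ^ Suc n" unfolding 1(3) 2(3) by (simp only: distrib_right mult.assoc)
    finally show "\<exists>s\<in>R - P. \<exists>r\<in>R. s * (a + b) = r * w ^ Suc n"
      by (intro bexI[of _ "s * s'"] bexI[of _ "s' * r + s * r'"] notin_P_mult 1 2 R_add R_mult DiffD1[OF 1(1)] DiffD1[OF 2(1)])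
  qed
qed

text \<open>Modulo every power of \<open>P\<close> the element \<open>s\<close> is invertible: with
  \<open>q = 1 - s * t\<close> in \<open>P\<close>, the geometric series gives
  \<open>1 = s * t' + q ^ n\<close>, and both terms carry \<open>y\<close> into the
  \<open>n\<close>-th power of \<open>P\<close>.\<close>

lemma pw_if_local:
  assumes y: "y \<in> R" and s: "s \<in> R - P" and r: "r \<in> R" and e: "s * y = r * w ^ n"
  shows "y \<in> pw n"
proof -
  obtain t where t: "t \<in> R" "1 - s * t \<in> P" using inverse_mod_P[OF s] by (elim bexE)
  define q where "q = 1 - s * t"
  define t' where "t' = t * (\<Sum>i<n. q ^ i)"
  have qR: "q \<in> R" unfolding q_def by (rule P_R[OF t(2)])
  have t'R: "t' \<in> R" unfolding t'_def by (intro R_mult t(1) R_sum R_power qR)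
  have "1 - q ^ n = (1 - q) * (\<Sum>i<n. q ^ i)" by (rule one_diff_power_eq)
  also have "\<dots> = s * t'" by (simp only: q_def t'_def mult.assoc diff_diff_eq2 add_diff_cancel_left')
  finally have "1 = s * t' + q ^ n" by (simp add: algebra_simps)
  then have "y * 1 = y * (s * t' + q ^ n)" by (rule arg_cong)
  also have "\<dots> = t' * (s * y) + y * q ^ n" by (simp only: distrib_left mult_ac)
  finally have "y = t' * (r * w ^ n) + y * q ^ n" unfolding e by simp
  moreover have "t' * (r * w ^ n) + y * q ^ n \<in> pw n"
    using t(2) by (intro pw_add pw_absorb t'R r y power_pw w_P) (simp only: q_def)
  ultimately show ?thesis by (simp only:)
qed

lemma pw_antimono: "y \<in> pw (Suc n) \<Longrightarrow> y \<in> pw n"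
proof (erule pw_Suc_induct)
  fix i j assume i: "i \<in> pw n" and j: "j \<in> P"
  show "i * j \<in> pw n" using pw_absorb[OF P_R[OF j] i] by (simp only: mult.commute)
qed (rule pw_add)

text \<open>For an element of all powers, \<open>y * z ^ n\<close> would be integral for every
  \<open>n\<close>. This forces \<open>z\<close> to be integral and puts \<open>z * w\<close> into
  \<open>P\<close>.\<close>

lemma pw_bounded:
  assumes "y \<in> R" "y \<noteq> 0"
  shows "\<exists>n. y \<notin> pw n"
proof (rule ccontr)
  assume "\<nexists>n. y \<notin> pw n"
  then have "y \<in> pw n" for n by simp
  from pw_z[OF this] have "y * z ^ n \<in> R" for n by (simp only: mult.commute)
  then have "z \<in> R" by (rule integral_if_powers_bounded[OF assms z_in_K])
  then have "z * w \<in> P" by (rule P_absorb[OF _ w_P])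
  then show False using zw_P by simp
qed

text \<open>At the greatest \<open>n\<close> with \<open>y\<close> in \<open>pw n\<close>, a
  numerator \<open>r\<close> in \<open>P\<close> would split off another factor \<open>w\<close>
  after multiplication by \<open>z * w\<close>, and so put \<open>y\<close> into the next
  power.\<close>

lemma val_ord_integral:
  assumes y: "y \<in> R" "y \<noteq> 0"
  shows "val (int (ord_integral K P y)) y"
proof -
  obtain N where N: "y \<notin> pw N" using pw_bounded[OF y] by (elim exE)
  have "y \<notin> pw (N + d)" for d
  proof (induction d)
    case (Suc d)
    then show ?case using pw_antimono[of y "N + d"] by auto
  qed (use N in simp)
  then have bound: "n \<le> N" if "y \<in> pw n" for n
    using that by (metis le_Suc_ex linorder_le_cases)
  have y0: "y \<in> pw 0" unfolding pw_0 by (rule y(1))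
  define n where "n = (GREATEST n. y \<in> pw n)"
  have n: "y \<in> pw n" unfolding n_def using y0 bound by (rule GreatestI_nat)
  have n': "y \<notin> pw (Suc n)"
  proof
    assume "y \<in> pw (Suc n)"
    then have "Suc n \<le> n" unfolding n_def using bound by (rule Greatest_le_nat)
    then show False by simp
  qed
  obtain s r where sr: "s \<in> R - P" "r \<in> R" "s * y = r * w ^ n" using pw_local[OF n] by (elim bexE)
  have "r \<notin> P"
  proof
    assume r: "r \<in> P"
    have "(z * w * s) * y = z * w * (s * y)" by (simp only: mult.assoc)
    also have "\<dots> = (z * r) * w ^ Suc n" unfolding sr(3) by (simp only: power_Suc mult_ac)
    finally have "y \<in> pw (Suc n)" by (rule pw_if_local[OF y(1) notin_P_mult[OF u_R_P sr(1)] z_P[OF r]])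
    then show False using n' by simp
  qed
  then have "val (int n) y" using sr by (intro valI[of s r]) (simp_all add: power_int_of_nat)
  moreover have "ord_integral K P y = n" unfolding ord_integral_def n_def ..
  ultimately show ?thesis by (simp only:)
qed

text \<open>Every representation of \<open>x\<close> as a quotient yields a valuation, and
  valuations are unique. So the definite description in \<open>ord_at\<close> is met by any
  representation, here one with a natural number as denominator.\<close>

lemma val_ord_at:
  assumes x: "x \<in> K" "x \<noteq> 0"
  shows "val (ord_at K P x) x"
proof -
  let ?S = "\<lambda>k. \<exists>a\<in>carrier OK - {0}. \<exists>b\<in>carrier OK - {0}.
    x = a / b \<and> k = int (ord_integral K P a) - int (ord_integral K P b)"
  have val: "val k x" if "?S k" for k
  proof -
    obtain a b where ab: "a \<in> carrier OK - {0}" "b \<in> carrier OK - {0}" "x = a / b"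
      "k = int (ord_integral K P a) - int (ord_integral K P b)" using \<open>?S k\<close> by (elim bexE conjE)
    have "a \<in> R" "a \<noteq> 0" "b \<in> R" "b \<noteq> 0" using ab(1,2) by (simp_all add: OK_simps)
    then show ?thesis unfolding ab(3,4) by (intro val_divide val_ord_integral)
  qed
  obtain m :: nat where m: "m > 0" "of_nat m * x \<in> R" using fraction[OF x(1)] by (elim exE conjE)
  have S: "?S (int (ord_integral K P (of_nat m * x)) - int (ord_integral K P (of_nat m)))"
  proof (intro bexI conjI)
    show "x = of_nat m * x / of_nat m" using m(1) by simp
    show "of_nat m \<in> carrier OK - {0}" using m(1) R_of_nat by (simp add: OK_simps)
    show "of_nat m * x \<in> carrier OK - {0}" using m x(2) by (simp add: OK_simps)
  qed (rule refl)
  have "ord_at K P x = int (ord_integral K P (of_nat m * x)) - int (ord_integral K P (of_nat m))"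
    unfolding ord_at_def
  proof (rule the_equality)
    show "?S (int (ord_integral K P (of_nat m * x)) - int (ord_integral K P (of_nat m)))" by (rule S)
    show "k = int (ord_integral K P (of_nat m * x)) - int (ord_integral K P (of_nat m))" if "?S k" for k
      by (rule val_unique[OF val[OF that] val[OF S]])
  qed
  then show ?thesis using val[OF S] by (simp only:)
qed

end

section \<open>Fractional ideals and bounds for their index\<close>

context number_field
begin

definition unif :: "complex set \<Rightarrow> complex" where
  "unif P = (SOME w. \<exists>z. z \<in> K \<and> (\<forall>p\<in>P. z * p \<in> R) \<and> w \<in> P \<and> z * w \<notin> P)"

definition unif_inv :: "complex set \<Rightarrow> complex" where
  "unif_inv P = (SOME z. z \<in> K \<and> (\<forall>p\<in>P. z * p \<in> R) \<and> unif P \<in> P \<and> z * unif P \<notin> P)"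

lemma uniformized:
  assumes "prime_ideal P"
  shows "uniformized_place K R P (unif_inv P) (unif P)"
proof -
  interpret prime_place K R P by unfold_locales (rule assms)
  have "\<exists>w z. z \<in> K \<and> (\<forall>p\<in>P. z * p \<in> R) \<and> w \<in> P \<and> z * w \<notin> P"
    using local_uniformizer by metis
  then have "\<exists>z. z \<in> K \<and> (\<forall>p\<in>P. z * p \<in> R) \<and> unif P \<in> P \<and> z * unif P \<notin> P"
    unfolding unif_def by (rule someI_ex)
  then have "unif_inv P \<in> K \<and> (\<forall>p\<in>P. unif_inv P * p \<in> R) \<and> unif P \<in> P \<and> unif_inv P * unif P \<notin> P"
    unfolding unif_inv_def by (rule someI_ex)
  then show ?thesis by unfold_locales simp_all
qed

definition coset :: "complex set \<Rightarrow> complex \<Rightarrow> complex set" where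
  "coset P a = (\<lambda>h. h + a) ` P"

lemma ideal_norm_eq: "ideal_norm K P = card (coset P ` R)"
proof -
  have "carrier (OK Quot P) = coset P ` R"
    unfolding FactRing_def A_RCOSETS_def RCOSETS_def r_coset_def coset_def
    by (auto simp: OK_simps)
  then show ?thesis by (simp add: ideal_norm_def)
qed

lemma coset_eqD:
  assumes "add_closed P" "coset P a = coset P b"
  shows "a - b \<in> P"
proof -
  have "a \<in> coset P a" unfolding coset_def using add_closed_zero[OF assms(1)] by (rule image_eqI[rotated]) simp
  then have "a \<in> coset P b" unfolding assms(2) .
  then obtain h where "h \<in> P" "a = h + b" unfolding coset_def by (elim imageE)
  then show ?thesis by simp
qed

lemma finite_cosets:
  assumes "prime_ideal P"
  shows "finite (coset P ` R)"
proof -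
  interpret prime_place K R P by unfold_locales (rule assms)
  obtain n where "covered R P n" using covered_P by (elim exE)
  then obtain T where T: "finite T" "\<forall>a\<in>R. \<exists>t\<in>T. a - t \<in> P" unfolding covered_def by (elim exE conjE)
  have eq: "coset P a = coset P t" if d: "a - t \<in> P" for a t
  proof -
    have "h + a \<in> coset P t" if "h \<in> P" for h
      unfolding coset_def using add_closed_add[OF add_closed_P that d] by (rule image_eqI[rotated]) simp
    moreover have "h + t \<in> coset P a" if "h \<in> P" for h
      unfolding coset_def using add_closed_diff[OF add_closed_P that d] by (rule image_eqI[rotated]) simp
    ultimately show ?thesis
      by (intro equalityI image_subsetI[of P "\<lambda>h. h + a", folded coset_def] image_subsetI[of P "\<lambda>h. h + t", folded coset_def])
  qed
  have "coset P ` R \<subseteq> coset P ` T"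
  proof (rule image_subsetI)
    fix a assume a: "a \<in> R"
    obtain t where t: "t \<in> T" "a - t \<in> P" using bspec[OF T(2) a] by (elim bexE)
    show "coset P a \<in> coset P ` T" 
      unfolding eq[OF t(2)] by (rule imageI[OF t(1)])
  qed
  then show ?thesis by (rule finite_subset[OF _ finite_imageI[OF T(1)]])
qed

lemma ideal_norm_pos:
  assumes "prime_ideal P"
  shows "ideal_norm K P > 0"
proof -
  have "coset P 0 \<in> coset P ` R" using R_zero by (rule imageI)
  then have "coset P ` R \<noteq> {}" by (metis empty_iff)
  then show ?thesis unfolding ideal_norm_eq card_gt_0_iff using finite_cosets[OF assms] by simp
qed

text \<open>
  \<open>lat k\<close> is the fractional ideal of the elements whose order at each \<open>P\<close> is at least \<open>- k P\<close>.
\<close>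

definition lat :: "(complex set \<Rightarrow> nat) \<Rightarrow> complex set" where
  "lat k = {y \<in> K. \<forall>P. prime_ideal P \<longrightarrow> (\<exists>s\<in>R - P. s * y * unif P ^ k P \<in> R)}"

lemma latI: "y \<in> K \<Longrightarrow> (\<And>P. prime_ideal P \<Longrightarrow> \<exists>s\<in>R - P. s * y * unif P ^ k P \<in> R) \<Longrightarrow> y \<in> lat k"
  unfolding lat_def by simp

lemma latD:
  assumes "y \<in> lat k"
  shows "y \<in> K" "prime_ideal P \<Longrightarrow> \<exists>s\<in>R - P. s * y * unif P ^ k P \<in> R"
  using assms unfolding lat_def by simp_all

text \<open>Integrality is local. For a non-integral \<open>y\<close> the denominators form a proper
  ideal \<open>J\<close>. A proper ideal above \<open>J\<close> that meets as many residue classes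
  as possible is prime, and integrality of \<open>y\<close> at it produces a denominator outside
  it.\<close>

lemma lat_0_R: "lat (\<lambda>_. 0) \<subseteq> R"
proof
  fix y assume y: "y \<in> lat (\<lambda>_. 0)"
  define J where "J = {d \<in> R. d * y \<in> R}"
  show "y \<in> R"
  proof (rule ccontr)
    assume yR: "y \<notin> R"
    obtain m :: nat where m: "m > 0" "of_nat m * y \<in> R" using fraction[OF latD(1)[OF y]] by (elim exE conjE)
    let ?M = "(\<lambda>r. of_nat m * r) ` R"
    obtain n where n: "covered R ?M n" using fin_quot[OF m(1)] by (elim exE)
    obtain T where T: "finite T" "\<forall>r\<in>R. \<exists>t\<in>T. r - t \<in> ?M"
      using n unfolding covered_def by (elim exE conjE)
    let ?I = "\<lambda>I. I \<subseteq> R \<and> add_closed I \<and> (\<forall>r\<in>R. \<forall>p\<in>I. r * p \<in> I) \<and> 1 \<notin> I \<and> J \<subseteq> I"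
    have J: "?I J"
    proof (intro conjI ballI)
      show "J \<subseteq> R" by (simp add: J_def)
      show "add_closed J"
        unfolding add_closed_def J_def using R_zero R_diff by (auto simp: left_diff_distrib)
      show "1 \<notin> J" using yR by (simp add: J_def)
      show "r * p \<in> J" if "r \<in> R" "p \<in> J" for r p
        using that R_mult[of r p] R_mult[of r "p * y"] by (simp add: J_def mult.assoc)
    qed simp
    have "card (T \<inter> I) < Suc (card T)" for I
      unfolding less_Suc_eq_le by (rule card_mono[OF T(1) Int_lower1])
    then have "\<exists>I. ?I I \<and> (\<forall>I'. ?I I' \<longrightarrow> card (T \<inter> I') \<le> card (T \<inter> I))"
      by (intro ex_has_greatest_nat[of ?I J "\<lambda>I. card (T \<inter> I)" "Suc (card T)", OF J]) simp
    then obtain I where I: "I \<subseteq> R" "add_closed I" "\<forall>r\<in>R. \<forall>p\<in>I. r * p \<in> I" "1 \<notin> I" "J \<subseteq> I"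
      and max: "\<forall>I'. ?I I' \<longrightarrow> card (T \<inter> I') \<le> card (T \<inter> I)" by (elim exE conjE)
    have absorb: "r * p \<in> I" if "r \<in> R" "p \<in> I" for r p by (rule bspec[OF bspec[OF I(3) that(1)] that(2)])
    have mJ: "of_nat m \<in> J" using m(2) R_of_nat by (simp add: J_def)
    have M_I: "?M \<subseteq> I"
    proof (rule image_subsetI)
      fix r assume "r \<in> R"
      from absorb[OF this subsetD[OF I(5) mJ]] show "of_nat m * r \<in> I" by (simp only: mult.commute)
    qed
    \<comment> \<open>Otherwise \<open>I\<close> and \<open>a\<close> generate a larger ideal, which
      is still proper, since \<open>1\<close> in it would put \<open>b\<close> into
      \<open>I\<close>. By maximality it contains the same representatives as \<open>I\<close>, and
      the representative of \<open>a\<close> then puts \<open>a\<close> into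
      \<open>I\<close>.\<close>
    have prime: "a \<in> I \<or> b \<in> I" if ab: "a \<in> R" "b \<in> R" "a * b \<in> I" for a b
    proof (rule ccontr)
      assume "\<not> (a \<in> I \<or> b \<in> I)"
      then have nI: "a \<notin> I" "b \<notin> I" by simp_all
      define I' where "I' = {j + r * a | j r. j \<in> I \<and> r \<in> R}"
      have I'I: "j + r * a \<in> I'" if "j \<in> I" "r \<in> R" for j r using that unfolding I'_def by blast
      have I'E: "\<exists>j r. x = j + r * a \<and> j \<in> I \<and> r \<in> R" if "x \<in> I'" for x using that unfolding I'_def by simp
      have sub: "I \<subseteq> I'"
      proof
        fix j assume "j \<in> I"
        from I'I[OF this R_zero] show "j \<in> I'" by simp
      qed
      have aI': "a \<in> I'" using I'I[OF add_closed_zero[OF I(2)] R_one] by simp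
      have one: "1 \<notin> I'"
      proof
        assume "1 \<in> I'"
        then obtain j r where jr: "1 = j + r * a" "j \<in> I" "r \<in> R" using I'E by metis
        have "b = b * (j + r * a)" unfolding jr(1)[symmetric] by simp
        also have "\<dots> = b * j + r * (a * b)" by (simp only: distrib_left mult_ac)
        also have "\<dots> \<in> I" by (rule add_closed_add[OF I(2) absorb[OF ab(2) jr(2)] absorb[OF jr(3) ab(3)]])
        finally show False using nI(2) by simp
      qed
      have "?I I'"
      proof (intro conjI ballI)
        show "I' \<subseteq> R"
        proof
          fix x assume "x \<in> I'"
          then obtain j r where "x = j + r * a" "j \<in> I" "r \<in> R" using I'E by metis
          then show "x \<in> R" using R_add[OF subsetD[OF I(1)] R_mult[OF _ ab(1)]] by simp
        qed
        show "add_closed I'"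
          unfolding add_closed_def
        proof (intro conjI ballI)
          show "0 \<in> I'" by (rule subsetD[OF sub add_closed_zero[OF I(2)]])
          fix x x' assume "x \<in> I'" "x' \<in> I'"
          then obtain j r j' r' where e: "x = j + r * a" "j \<in> I" "r \<in> R" "x' = j' + r' * a" "j' \<in> I" "r' \<in> R"
            using I'E by metis
          have "x - x' = (j - j') + (r - r') * a" unfolding e(1,4) by (simp add: left_diff_distrib)
          then show "x - x' \<in> I'" using I'I[OF add_closed_diff[OF I(2) e(2,5)] R_diff[OF e(3,6)]] by simp
        qed
        show "r * p \<in> I'" if r: "r \<in> R" and p: "p \<in> I'" for r p
        proof -
          obtain j r' where e: "p = j + r' * a" "j \<in> I" "r' \<in> R" using I'E[OF p] by (elim exE conjE)
          have "r * p = r * j + (r * r') * a" unfolding e(1) by (simp only: distrib_left mult.assoc)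
          then show ?thesis using I'I[OF absorb[OF r e(2)] R_mult[OF r e(3)]] by simp
        qed
        show "1 \<notin> I'" by (rule one)
        show "J \<subseteq> I'" using I(5) sub by (rule subset_trans)
      qed
      then have "card (T \<inter> I') \<le> card (T \<inter> I)" using max by simp
      then have eq: "T \<inter> I = T \<inter> I'"
        by (intro card_seteq) (use T(1) sub in auto)
      obtain t where t: "t \<in> T" "a - t \<in> ?M" using bspec[OF T(2) ab(1)] by (elim bexE)
      have dI: "a - t \<in> I" by (rule subsetD[OF M_I t(2)])
      have "t = 1 * t" by simp
      have "t = - (a - t) + 1 * a" by simp
      then have "t \<in> I'" using I'I[OF add_closed_neg[OF I(2) dI] R_one] by (simp only:)
      then have "t \<in> I" using t(1) eq by (metis IntD2 IntI)
      from add_closed_add[OF I(2) this dI] have "a \<in> I" by simp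
      then show False using nI(1) by simp
    qed
    have "prime_ideal I"
      unfolding prime_ideal_def
    proof (intro conjI ballI impI I(1,2,4))
      show "\<exists>a\<in>I. a \<noteq> 0" using subsetD[OF I(5) mJ] m(1) by (intro bexI[of _ "of_nat m"]) simp_all
    qed (simp_all add: absorb prime)
    from latD(2)[OF y this] obtain s where s: "s \<in> R - I" "s * y * unif I ^ 0 \<in> R" by (elim bexE)
    then have "s \<in> J" by (simp add: J_def)
    then show False using s(1) I(5) by (metis DiffD2 subsetD)
  qed
qed

text \<open>The residue modulo \<open>P\<close> of \<open>y\<close> times the
  \<open>(k P + 1)\<close>-th power of the uniformizer separates the cosets: if two residues agree,
  one power of the uniformizer can be removed from the difference.\<close>

lemma lat_step:
  assumes P: "prime_ideal P"
  shows "covered (lat (k(P := Suc (k P)))) (lat k) (ideal_norm K P)"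
proof -
  let ?k = "k(P := Suc (k P))" and ?w = "unif P" and ?z = "unif_inv P"
  interpret uniformized_place K R P ?z ?w by (rule uniformized[OF P])
  \<comment> \<open>The product with the power of \<open>?w\<close> is integral only locally; a
    representative in \<open>R\<close> of its residue exists because denominators outside
    \<open>P\<close> are invertible modulo \<open>P\<close>.\<close>
  define f where "f y = (SOME r. r \<in> R \<and> (\<exists>s\<in>R - P. s * (y * ?w ^ Suc (k P) - r) \<in> P))" for y
  have f: "f y \<in> R \<and> (\<exists>s\<in>R - P. s * (y * ?w ^ Suc (k P) - f y) \<in> P)" if y: "y \<in> lat ?k" for y
    unfolding f_def
  proof (rule someI_ex)
    let ?Y = "y * ?w ^ Suc (k P)"
    have "\<exists>s\<in>R - P. s * y * ?w ^ ?k P \<in> R" by (rule latD(2)[OF y P])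
    then obtain s where s: "s \<in> R - P" "s * y * ?w ^ Suc (k P) \<in> R" by auto
    obtain t where t: "t \<in> R" "1 - s * t \<in> P" using inverse_mod_P[OF s(1)] by (elim bexE)
    have sY: "s * ?Y \<in> R" using s(2) by (simp only: mult.assoc)
    have "s * (?Y - t * (s * ?Y)) = (s * ?Y) * (1 - s * t)" by (simp add: algebra_simps)
    then have "s * (?Y - t * (s * ?Y)) \<in> P" using P_absorb[OF sY t(2)] by (simp only:)
    then show "\<exists>r. r \<in> R \<and> (\<exists>s\<in>R - P. s * (?Y - r) \<in> P)"
      using s(1) by (intro exI[of _ "t * (s * ?Y)"] conjI R_mult[OF t(1) sY] bexI[of _ s])
  qed
  show ?thesis
  proof (rule coveredI[of "\<lambda>y. coset P (f y)"])
    have sub: "(\<lambda>y. coset P (f y)) ` lat ?k \<subseteq> coset P ` R"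
      using f by (intro image_subsetI imageI) simp
    then show "finite ((\<lambda>y. coset P (f y)) ` lat ?k)" by (rule finite_subset[OF _ finite_cosets[OF P]])
    show "card ((\<lambda>y. coset P (f y)) ` lat ?k) \<le> ideal_norm K P"
      unfolding ideal_norm_eq by (rule card_mono[OF finite_cosets[OF P] sub])
    fix y y' assume y: "y \<in> lat ?k" and y': "y' \<in> lat ?k" and eq: "coset P (f y) = coset P (f y')"
    show "y - y' \<in> lat k"
    proof (rule latI)
      show "y - y' \<in> K" by (rule diff[OF latD(1)[OF y] latD(1)[OF y']])
      fix Q assume Q: "prime_ideal Q"
      interpret Q: prime_place K R Q by unfold_locales (rule Q)
      show "\<exists>s\<in>R - Q. s * (y - y') * unif Q ^ k Q \<in> R"
      proof (cases "Q = P")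
        case False
        obtain s where s: "s \<in> R - Q" "s * y * unif Q ^ ?k Q \<in> R" using latD(2)[OF y Q] by (elim bexE)
        obtain s' where s': "s' \<in> R - Q" "s' * y' * unif Q ^ ?k Q \<in> R" using latD(2)[OF y' Q] by (elim bexE)
        have kQ: "?k Q = k Q" using False by simp
        have "(s * s') * (y - y') * unif Q ^ k Q = s' * (s * y * unif Q ^ k Q) - s * (s' * y' * unif Q ^ k Q)"
          by (simp add: algebra_simps)
        moreover have "s' * (s * y * unif Q ^ k Q) - s * (s' * y' * unif Q ^ k Q) \<in> R"
          by (rule R_diff[OF R_mult[OF DiffD1[OF s'(1)] s(2)[unfolded kQ]]
              R_mult[OF DiffD1[OF s(1)] s'(2)[unfolded kQ]]])
        ultimately show ?thesis
          by (intro bexI[of _ "s * s'"] Q.notin_P_mult[OF s(1) s'(1)]) (simp only:)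
      next
        case True
        let ?Y = "y * ?w ^ Suc (k P)" and ?Y' = "y' * ?w ^ Suc (k P)"
        obtain s where s: "s \<in> R - P" "s * (?Y - f y) \<in> P" using conjunct2[OF f[OF y]] by (elim bexE)
        obtain s' where s': "s' \<in> R - P" "s' * (?Y' - f y') \<in> P" using conjunct2[OF f[OF y']] by (elim bexE)
        have d: "f y - f y' \<in> P" by (rule coset_eqD[OF add_closed_P eq])
        let ?p = "s' * (s * (?Y - f y)) - s * (s' * (?Y' - f y')) + (s * s') * (f y - f y')"
        have p: "?p \<in> P"
          by (rule add_closed_add[OF add_closed_P add_closed_diff[OF add_closed_P
                P_absorb[OF DiffD1[OF s'(1)] s(2)] P_absorb[OF DiffD1[OF s(1)] s'(2)]]
              P_absorb[OF R_mult[OF DiffD1[OF s(1)] DiffD1[OF s'(1)]] d]])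
        \<comment> \<open>Multiplication by \<open>?z\<close> turns one factor \<open>?w\<close>
          into the unit \<open>?z * ?w\<close>, which lowers the exponent from
          \<open>Suc (k P)\<close> to \<open>k P\<close>.\<close>
        have "?p = (s * s') * (y - y') * ?w ^ Suc (k P)" by (simp add: algebra_simps)
        then have "?z * ?p = (?z * ?w * (s * s')) * (y - y') * ?w ^ k P" by (simp only: power_Suc mult_ac)
        then have "(?z * ?w * (s * s')) * (y - y') * ?w ^ k P \<in> R" using z_P[OF p] by (simp only:)
        then show ?thesis unfolding True
          by (intro bexI[of _ "?z * ?w * (s * s')"] notin_P_mult u_R_P s s')
      qed
    qed
  qed
qed

lemma lat_add_place:
  assumes P: "prime_ideal P" and "k P = 0"
  shows "covered (lat (k(P := n))) (lat k) (ideal_norm K P ^ n)"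
proof (induction n)
  case 0
  have "k(P := 0) = k" using assms(2) by (metis fun_upd_triv)
  then show ?case unfolding covered_def
    by (intro exI[of _ "{0}"]) simp
next
  case (Suc n)
  have "covered (lat ((k(P := n))(P := Suc ((k(P := n)) P)))) (lat (k(P := n))) (ideal_norm K P)"
    by (rule lat_step[OF P])
  then have "covered (lat (k(P := Suc n))) (lat (k(P := n))) (ideal_norm K P)" by simp
  from covered_trans[OF this Suc.IH] show ?case by (simp only: power_Suc)
qed

text \<open>The index is built up place by place; the start is \<open>lat_0_R\<close>.\<close>

lemma lat_covered:
  assumes "finite S" "\<And>P. P \<in> S \<Longrightarrow> prime_ideal P"
  shows "covered (lat (\<lambda>P. if P \<in> S then k P else 0)) R (\<Prod>P\<in>S. ideal_norm K P ^ k P)"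
  using assms
proof (induction S rule: finite_induct)
  case empty
  have "a - 0 \<in> R" if "a \<in> lat (\<lambda>_. 0)" for a using subsetD[OF lat_0_R that] by simp
  then show ?case unfolding covered_def by (intro exI[of _ "{0}"]) simp
next
  case (insert P S)
  let ?k = "\<lambda>Q. if Q \<in> S then k Q else 0"
  have e: "(\<lambda>Q. if Q \<in> Set.insert P S then k Q else 0) = ?k(P := k P)"
    using insert.hyps(2) by (intro ext) simp
  have prP: "prime_ideal P" by (rule insert.prems) (rule insertI1)
  have "?k P = 0" using insert.hyps(2) by simp
  from lat_add_place[of P ?k, OF prP this]
  have 1: "covered (lat (?k(P := k P))) (lat ?k) (ideal_norm K P ^ k P)" .
  have 2: "covered (lat ?k) R (\<Prod>P\<in>S. ideal_norm K P ^ k P)"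
    by (rule insert.IH) (rule insert.prems, erule insertI2)
  show ?case unfolding e prod.insert[OF insert.hyps] by (rule covered_trans[OF 1 2])
qed

lemma lat_zero: "0 \<in> lat k"
proof (rule latI[OF zero])
  fix Q assume "prime_ideal Q"
  then interpret Q: prime_place K R Q by unfold_locales
  show "\<exists>s\<in>R - Q. s * 0 * unif Q ^ k Q \<in> R" using Q.one_R_P R_zero by (intro bexI[of _ 1]) simp_all
qed

lemma lat_diff:
  assumes y: "y \<in> lat k" and y': "y' \<in> lat k"
  shows "y - y' \<in> lat k"
proof (rule latI)
  show "y - y' \<in> K" by (rule diff[OF latD(1)[OF y] latD(1)[OF y']])
  fix Q assume Q: "prime_ideal Q"
  interpret Q: prime_place K R Q by unfold_locales (rule Q)
  obtain s where s: "s \<in> R - Q" "s * y * unif Q ^ k Q \<in> R" using latD(2)[OF y Q] by (elim bexE)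
  obtain s' where s': "s' \<in> R - Q" "s' * y' * unif Q ^ k Q \<in> R" using latD(2)[OF y' Q] by (elim bexE)
  have "(s * s') * (y - y') * unif Q ^ k Q = s' * (s * y * unif Q ^ k Q) - s * (s' * y' * unif Q ^ k Q)"
    by (simp add: algebra_simps)
  moreover have "s' * (s * y * unif Q ^ k Q) - s * (s' * y' * unif Q ^ k Q) \<in> R"
    by (rule R_diff[OF R_mult[OF DiffD1[OF s'(1)] s(2)] R_mult[OF DiffD1[OF s(1)] s'(2)]])
  ultimately show "\<exists>s\<in>R - Q. s * (y - y') * unif Q ^ k Q \<in> R"
    by (intro bexI[of _ "s * s'"] Q.notin_P_mult[OF s(1) s'(1)]) (simp only:)
qed

lemma add_closed_lat: "add_closed (lat k)"
  unfolding add_closed_def by (intro conjI ballI lat_zero lat_diff)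

end

lemma add_closed_int_mult:
  assumes "add_closed B" "y \<in> B"
  shows "of_int n * y \<in> B"
proof (induction n rule: int_induct[of _ 0])
  case base then show ?case using add_closed_zero[OF assms(1)] by simp
next
  case (step1 i) then show ?case using add_closed_add[OF assms(1) step1.IH assms(2)] by (simp add: distrib_right)
next
  case (step2 i) then show ?case using add_closed_diff[OF assms(1) step2.IH assms(2)] by (simp add: left_diff_distrib)
qed

lemma add_closed_sum:
  assumes "add_closed B" "\<And>i. i \<in> I \<Longrightarrow> f i \<in> B"
  shows "sum f I \<in> B"
  using assms(2)
proof (induction I rule: infinite_finite_induct)
  case (insert i I)
  have "f i \<in> B" "sum f I \<in> B" using insert by simp_all
  then show ?case using add_closed_add[OF assms(1)] insert.hyps by simp
qed (simp_all add: add_closed_zero[OF assms(1)])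

section \<open>Denominators and the finite part of the height\<close>

context number_field
begin

text \<open>If \<open>of_nat m * x\<close> is integral, every prime at which \<open>x\<close> has a
  pole contains \<open>m\<close>; such primes are determined by the representatives modulo
  \<open>m\<close> that they contain.\<close>

lemma finite_negative_places:
  assumes x: "x \<in> K" "x \<noteq> 0"
  shows "finite {P \<in> finite_places K. ord_at K P x < 0}" (is "finite ?S")
proof -
  obtain m :: nat where m: "m > 0" "of_nat m * x \<in> R" using fraction[OF x(1)] by (elim exE conjE)
  let ?M = "(\<lambda>r. of_nat m * r) ` R"
  obtain n where n: "covered R ?M n" using fin_quot[OF m(1)] by (elim exE)
  obtain T where T: "finite T" "\<forall>r\<in>R. \<exists>t\<in>T. r - t \<in> ?M"
    using n unfolding covered_def by (elim exE conjE)
  have MP: "?M \<subseteq> P" if "P \<in> ?S" for P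
  proof -
    have P: "prime_ideal P" "ord_at K P x < 0" using that prime_ideal_if_finite_place by simp_all
    interpret uniformized_place K R P "unif_inv P" "unif P" by (rule uniformized[OF P(1)])
    obtain s r where sr: "s \<in> R - P" "r \<in> R - P" "s * x = r * unif P powi ord_at K P x"
      using val_ord_at[OF x] by (rule valE)
    obtain j where j: "- ord_at K P x = int (Suc j)" using P(2) by (metis neg_0_less_iff_less pos_int_cases Suc_pred)
    have "unif P powi ord_at K P x * unif P ^ Suc j = unif P powi (ord_at K P x + int (Suc j))"
      using w_nz by (simp only: power_int_add power_int_of_nat not_False_eq_True simp_thms)
    also have "\<dots> = 1" unfolding j[symmetric] by simp
    finally have e: "unif P powi ord_at K P x * unif P ^ Suc j = 1" .
    have "(s * (of_nat m * x)) * unif P ^ Suc j = of_nat m * ((s * x) * unif P ^ Suc j)" by (simp only: mult_ac)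
    also have "\<dots> = of_nat m * r" unfolding sr(3) mult.assoc e by simp
    finally have "of_nat m * r \<in> P"
      using P_absorb[OF R_mult[OF DiffD1[OF sr(1)] m(2)] w_power_P[of j]] by (simp only:)
    then have "of_nat m \<in> P" using P_prime[OF R_of_nat DiffD1[OF sr(2)]] sr(2) by simp
    show "?M \<subseteq> P"
    proof (rule image_subsetI)
      fix r assume "r \<in> R"
      from P_absorb[OF this \<open>of_nat m \<in> P\<close>] show "of_nat m * r \<in> P" by (subst mult.commute)
    qed
  qed
  have sub: "P \<subseteq> Q" if P: "P \<in> ?S" and Q: "Q \<in> ?S" and eq: "P \<inter> T = Q \<inter> T" for P Q
  proof
    have "P \<in> finite_places K" "Q \<in> finite_places K" using P Q by simp_all
    note pP = prime_ideal_if_finite_place[OF this(1), unfolded prime_ideal_def]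
      and pQ = prime_ideal_if_finite_place[OF this(2), unfolded prime_ideal_def]
    have aP: "add_closed P" "P \<subseteq> R" by (rule conjunct1[OF conjunct2[OF pP]], rule conjunct1[OF pP])
    have aQ: "add_closed Q" by (rule conjunct1[OF conjunct2[OF pQ]])
    fix r assume r: "r \<in> P"
    obtain t where t: "t \<in> T" "r - t \<in> ?M" using bspec[OF T(2) subsetD[OF aP(2) r]] by (elim bexE)
    have "r - (r - t) \<in> P" by (rule add_closed_diff[OF aP(1) r subsetD[OF MP[OF P] t(2)]])
    then have "t \<in> P \<inter> T" using t(1) by simp
    then have "t \<in> Q" unfolding eq by simp
    from add_closed_add[OF aQ this subsetD[OF MP[OF Q] t(2)]] show "r \<in> Q" by simp
  qed
  have "inj_on (\<lambda>P. P \<inter> T) ?S"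
  proof (rule inj_onI)
    fix P Q assume h: "P \<in> ?S" "Q \<in> ?S" "P \<inter> T = Q \<inter> T"
    show "P = Q" by (rule equalityI[OF sub[OF h] sub[OF h(2,1) h(3)[symmetric]]])
  qed
  moreover have "(\<lambda>P. P \<inter> T) ` ?S \<subseteq> Pow T" by (rule image_subsetI) simp
  moreover have "finite (Pow T)" using T(1) by simp
  ultimately show ?thesis by (rule inj_on_finite)
qed

text \<open>The norm of the denominator ideal of \<open>x\<close>.\<close>

definition denominator_norm :: "complex \<Rightarrow> nat" where
  "denominator_norm x = (\<Prod>P\<in>{P \<in> finite_places K. ord_at K P x < 0}. ideal_norm K P ^ nat (- ord_at K P x))"

lemma denominator_norm_pos: "denominator_norm x > 0"
  unfolding denominator_norm_def
  by (rule prod_pos) (simp add: ideal_norm_pos prime_ideal_if_finite_place)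

lemma infsum_finite_places:
  assumes x: "x \<in> K" "x \<noteq> 0"
  shows "(\<Sum>\<^sub>\<infinity>P\<in>finite_places K. log_plus (abs_at K P x)) = ln (real (denominator_norm x))"
proof -
  let ?S = "{P \<in> finite_places K. ord_at K P x < 0}"
  have fS: "finite ?S" by (rule finite_negative_places[OF x])
  have N: "real (ideal_norm K P) \<ge> 1" if "P \<in> finite_places K" for P
    using ideal_norm_pos[OF prime_ideal_if_finite_place[OF that]] by linarith
  have "(\<Sum>\<^sub>\<infinity>P\<in>finite_places K. log_plus (abs_at K P x)) = (\<Sum>\<^sub>\<infinity>P\<in>?S. ln (real (ideal_norm K P ^ nat (- ord_at K P x))))"
  proof (rule infsum_cong_neutral)
    fix P assume "P \<in> finite_places K - ?S"
    then have P: "P \<in> finite_places K" "ord_at K P x \<ge> 0" by auto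
    then have "abs_at K P x = inverse (real (ideal_norm K P) ^ nat (ord_at K P x))"
      using P(2) x by (simp add: abs_at_def power_int_def power_inverse)
    also have "\<dots> \<le> 1" using one_le_power[OF N[OF P(1)]] by (simp add: inverse_le_1_iff)
    finally show "log_plus (abs_at K P x) = 0" by (simp add: log_plus_def)
  next
    fix P assume "P \<in> finite_places K \<inter> ?S"
    then have P: "P \<in> finite_places K" "ord_at K P x < 0" by simp_all
    then have "abs_at K P x = real (ideal_norm K P) ^ nat (- ord_at K P x)"
      using x by (simp add: abs_at_def power_int_def)
    then show "log_plus (abs_at K P x) = ln (real (ideal_norm K P ^ nat (- ord_at K P x)))"
      using one_le_power[OF N[OF P(1)]] by (simp add: log_plus_def max_absorb2)
  qed auto
  also have "\<dots> = (\<Sum>P\<in>?S. ln (real (ideal_norm K P ^ nat (- ord_at K P x))))" by (rule infsum_finite[OF fS])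
  also have "\<dots> = ln (\<Prod>P\<in>?S. real (ideal_norm K P ^ nat (- ord_at K P x)))"
  proof (rule ln_prod[OF fS, symmetric])
    fix P assume "P \<in> ?S"
    then have "real (ideal_norm K P) > 0" using N[of P] by simp
    then show "real (ideal_norm K P ^ nat (- ord_at K P x)) \<noteq> 0" by simp
  qed
  finally show ?thesis by (simp only: denominator_norm_def of_nat_prod)
qed

lemma powers_in_lat:
  assumes x: "x \<in> K" "x \<noteq> 0" and i: "i \<le> n"
  shows "x ^ i \<in> lat (\<lambda>P. if P \<in> {P \<in> finite_places K. ord_at K P x < 0} then n * nat (- ord_at K P x) else 0)"
    (is "_ \<in> lat ?k")
proof (rule latI)
  show "x ^ i \<in> K" by (rule power[OF x(1)])
  fix P assume P: "prime_ideal P"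
  interpret uniformized_place K R P "unif_inv P" "unif P" by (rule uniformized[OF P])
  let ?w = "unif P" and ?v = "ord_at K P x"
  obtain s r where sr: "s \<in> R - P" "r \<in> R - P" "s * x = r * ?w powi ?v"
    using val_ord_at[OF x] by (rule valE)
  have nonneg: "?v * int i + int (?k P) \<ge> 0"
  proof (cases "?v < 0")
    case True
    then have "?k P = n * nat (- ?v)" using finite_place_if_prime_ideal[OF P] by simp
    then have "int (?k P) = int n * (- ?v)" using True by simp
    moreover have "int i * (- ?v) \<le> int n * (- ?v)" using i True by (intro mult_right_mono) auto
    ultimately show ?thesis by (simp add: mult.commute)
  next
    case False
    then show ?thesis by simp
  qed
  have "s ^ i * x ^ i * ?w ^ ?k P = (s * x) ^ i * ?w ^ ?k P" by (simp only: power_mult_distrib)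
  also have "\<dots> = r ^ i * ((?w powi ?v) ^ i * ?w ^ ?k P)" unfolding sr(3) by (simp only: power_mult_distrib mult.assoc)
  also have "(?w powi ?v) ^ i * ?w ^ ?k P = ?w powi (?v * int i) * ?w powi int (?k P)"
    by (simp only: power_int_mult power_int_of_nat)
  also have "\<dots> = ?w powi (?v * int i + int (?k P))" by (rule power_int_add[symmetric]) (simp only: w_nz simp_thms not_False_eq_True)
  also have "\<dots> = ?w ^ nat (?v * int i + int (?k P))" using nonneg by (simp only: power_int_def if_True)
  also have "r ^ i * \<dots> \<in> R" by (rule R_mult[OF R_power[OF DiffD1[OF sr(2)]] R_power[OF w_R]])
  finally show "\<exists>s\<in>R - P. s * x ^ i * ?w ^ ?k P \<in> R"
    by (intro bexI[of _ "s ^ i"] notin_P_power[OF sr(1)])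
qed

text \<open>The bound is geometric in \<open>n\<close> with ratio \<open>denominator_norm x\<close>,
  which makes the later comparison of growth rates sharp enough.\<close>

lemma powers_covered:
  assumes x: "x \<in> K" "x \<noteq> 0"
  shows "\<exists>A. add_closed A \<and> (\<forall>i\<le>n. x ^ i \<in> A) \<and> covered A R (denominator_norm x ^ n)"
proof -
  let ?S = "{P \<in> finite_places K. ord_at K P x < 0}"
  have "covered (lat (\<lambda>P. if P \<in> ?S then n * nat (- ord_at K P x) else 0)) R
      (\<Prod>P\<in>?S. ideal_norm K P ^ (n * nat (- ord_at K P x)))"
    by (rule lat_covered[OF finite_negative_places[OF x]]) (simp add: prime_ideal_if_finite_place)
  moreover have "(\<Prod>P\<in>?S. ideal_norm K P ^ (n * nat (- ord_at K P x))) = denominator_norm x ^ n"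
    unfolding denominator_norm_def prod_power_distrib
    by (rule prod.cong[OF refl]) (simp add: mult.commute flip: power_mult)
  ultimately show ?thesis using powers_in_lat[OF x, of _ n] add_closed_lat
    by (intro exI[of _ "lat (\<lambda>P. if P \<in> ?S then n * nat (- ord_at K P x) else 0)"] conjI allI impI) (simp_all only:)
qed

text \<open>
  The elements \<open>\<Sum> a\<^sub>i x\<^sup>i\<close> with \<open>d \<le> i < d + n\<close> and \<open>0 \<le> a\<^sub>i < c\<close> are pairwise incongruent modulo the
  integer combinations of \<open>1, \<dots>, x\<^sup>d\<^sup>-\<^sup>1\<close>; comparing with the number of cosets as \<open>n \<rightarrow> \<infinity>\<close> bounds \<open>c\<close>.
\<close>

lemma leading_coeff_le_denominator_norm:
  assumes x: "x \<in> K" "x \<noteq> 0" and c: "c > 0"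
    and lead: "\<And>q :: int poly. poly (map_poly of_int q) x = 0 \<Longrightarrow> int c dvd lead_coeff q"
    and cov: "covered R {\<Sum>i<d. of_int (a i) * x ^ i | a :: nat \<Rightarrow> int. True} C"
  shows "c \<le> denominator_norm x"
proof (rule ccontr)
  let ?Z = "{\<Sum>i<d. of_int (a i) * x ^ i | a :: nat \<Rightarrow> int. True}"
  let ?N = "denominator_norm x"
  assume "\<not> c \<le> ?N"
  have Z: "add_closed ?Z"
    unfolding add_closed_def
  proof (intro conjI ballI)
    show "0 \<in> ?Z" by (intro CollectI exI[of _ "\<lambda>_. 0"]) simp
    fix u v assume "u \<in> ?Z" "v \<in> ?Z"
    then obtain a b :: "nat \<Rightarrow> int" where "u = (\<Sum>i<d. of_int (a i) * x ^ i)" "v = (\<Sum>i<d. of_int (b i) * x ^ i)"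
      by (elim CollectE exE conjE)
    then show "u - v \<in> ?Z"
      by (intro CollectI exI[of _ "\<lambda>i. a i - b i"]) (simp add: sum_subtractf left_diff_distrib)
  qed
  have bound: "c ^ n \<le> ?N ^ (d + n) * C" for n
  proof -
    let ?F = "{d..<d + n} \<rightarrow>\<^sub>E {0..<int c}"
    define \<phi> where "\<phi> a = (\<Sum>i\<in>{d..<d + n}. of_int (a i) * x ^ i)" for a :: "nat \<Rightarrow> int"
    obtain A where A: "add_closed A" "\<And>i. i \<le> d + n \<Longrightarrow> x ^ i \<in> A" "covered A R (?N ^ (d + n))"
      using powers_covered[OF x, of "d + n"] by metis
    have incong: "a = b" if ab: "a \<in> ?F" "b \<in> ?F" "\<phi> a - \<phi> b \<in> ?Z" for a b
    proof (rule ccontr)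
      assume "a \<noteq> b"
      obtain g :: "nat \<Rightarrow> int" where g: "\<phi> a - \<phi> b = (\<Sum>i<d. of_int (g i) * x ^ i)" using ab(3) by (elim CollectE exE conjE)
      define D where "D = {i \<in> {d..<d + n}. a i \<noteq> b i}"
      have fD: "finite D" by (simp add: D_def)
      have "D \<noteq> {}"
      proof
        assume "D = {}"
        then have "a i = b i" if "i \<in> {d..<d + n}" for i using that unfolding D_def by blast
        then have "a = b" using ab(1,2) by (intro PiE_ext)
        then show False using \<open>a \<noteq> b\<close> by simp
      qed
      define j where "j = Max D"
      have jD: "j \<in> D" unfolding j_def by (rule Max_in[OF fD \<open>D \<noteq> {}\<close>])
      have jmax: "i \<le> j" if "i \<in> D" for i unfolding j_def by (rule Max_ge[OF fD that])
      \<comment> \<open>The congruence is read as an integer polynomial \<open>q\<close> vanishing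
        at \<open>x\<close>. Its leading coefficient \<open>a j - b j\<close> is a nonzero multiple
        of \<open>c\<close> of absolute value less than \<open>c\<close>.\<close>
      define h where "h i = (if i < d then - g i else if i < d + n then a i - b i else 0)" for i
      define q where "q = (\<Sum>i<d + n. monom (h i) i)"
      have cq: "coeff q i = h i" for i
      proof -
        have "coeff q i = (\<Sum>k<d + n. if k = i then h k else 0)"
          unfolding q_def coeff_sum coeff_monom by (rule sum.cong[OF refl]) simp
        also have "\<dots> = h i" by (simp add: h_def)
        finally show ?thesis .
      qed
      have j: "d \<le> j" "j < d + n" "a j \<noteq> b j" using jD by (simp_all add: D_def)
      have "degree q = j"
      proof (rule antisym)
        show "j \<le> degree q" by (rule le_degree) (use j in \<open>simp add: cq h_def\<close>)
        have "coeff q i = 0" if "j < i" for i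
        proof -
          have "i \<notin> D" using jmax[of i] that by linarith
          then show ?thesis unfolding cq h_def using that j(1) by (simp add: D_def)
        qed
        then show "degree q \<le> j" by (intro degree_le allI impI)
      qed
      then have lc: "lead_coeff q = a j - b j" using j by (simp add: cq h_def)
      have "poly (map_poly of_int q) x = (\<Sum>i<d + n. of_int (h i) * x ^ i)"
      proof -
        have "map_poly of_int q = (\<Sum>i<d + n. monom (of_int (h i)) i :: complex poly)"
        proof (rule poly_eqI)
          fix i
          have "coeff (map_poly of_int q) i = (of_int (h i) :: complex)" by (simp add: coeff_map_poly cq)
          also have "\<dots> = (\<Sum>k<d + n. if k = i then of_int (h k) else 0)" by (simp add: h_def)
          also have "\<dots> = coeff (\<Sum>i<d + n. monom (of_int (h i)) i) i"
            unfolding coeff_sum coeff_monom by (rule sum.cong[OF refl]) simp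
          finally show "coeff (map_poly of_int q) i = coeff (\<Sum>i<d + n. monom (of_int (h i)) i :: complex poly) i" .
        qed
        then show ?thesis by (simp add: poly_sum poly_monom)
      qed
      also have "{..<d + n} = {..<d} \<union> {d..<d + n}" by auto
      also have "(\<Sum>i\<in>{..<d} \<union> {d..<d + n}. of_int (h i) * x ^ i)
          = (\<Sum>i<d. of_int (h i) * x ^ i) + (\<Sum>i\<in>{d..<d + n}. of_int (h i) * x ^ i)"
        by (rule sum.union_disjoint) auto
      also have "(\<Sum>i<d. of_int (h i) * x ^ i) = - (\<Sum>i<d. of_int (g i) * x ^ i)"
        unfolding sum_negf[symmetric] by (rule sum.cong[OF refl]) (simp add: h_def)
      also have "(\<Sum>i\<in>{d..<d + n}. of_int (h i) * x ^ i) = \<phi> a - \<phi> b"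
        unfolding \<phi>_def sum_subtractf[symmetric] by (rule sum.cong[OF refl]) (simp add: h_def left_diff_distrib)
      finally have "poly (map_poly of_int q) x = 0" unfolding g by simp
      then have "int c dvd a j - b j" using lead[of q] lc by simp
      moreover have "a j \<in> {0..<int c}" "b j \<in> {0..<int c}"
        using PiE_mem[OF ab(1), of j] PiE_mem[OF ab(2), of j] j by simp_all
      then have "\<bar>a j - b j\<bar> < int c" by auto
      ultimately have "a j - b j = 0" using dvd_imp_le_int[of "a j - b j" "int c"] by linarith
      then show False using j(3) by simp
    qed
    have inj: "inj_on \<phi> ?F"
      by (rule inj_onI) (rule incong, assumption+, simp add: add_closed_zero[OF Z, simplified])
    have "card (\<phi> ` ?F) \<le> ?N ^ (d + n) * C"
    proof (rule covered_card[OF covered_trans[OF A(3) cov] Z])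
      show "\<phi> ` ?F \<subseteq> A"
      proof (rule image_subsetI)
        fix a show "\<phi> a \<in> A"
          unfolding \<phi>_def by (rule add_closed_sum[OF A(1)], rule add_closed_int_mult[OF A(1)], rule A(2)) simp
      qed
      fix s t assume st: "s \<in> \<phi> ` ?F" "t \<in> \<phi> ` ?F" "s - t \<in> ?Z"
      obtain a where a: "a \<in> ?F" "s = \<phi> a" using st(1) by (elim imageE)
      obtain b where b: "b \<in> ?F" "t = \<phi> b" using st(2) by (elim imageE)
      have "a = b" by (rule incong[OF a(1) b(1)]) (use st(3) a b in simp)
      then show "s = t" using a b by simp
    qed
    moreover have "card (\<phi> ` ?F) = c ^ n" by (simp add: card_image[OF inj] card_PiE)
    ultimately show ?thesis by simp
  qed
  \<comment> \<open>If \<open>c\<close> exceeded \<open>?N\<close>, the powers of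
    \<open>c / ?N\<close> would be unbounded, while \<open>bound\<close> keeps them below a
    constant.\<close>
  have N0: "real ?N > 0" using denominator_norm_pos by simp
  have "real c / real ?N > 1" using \<open>\<not> c \<le> ?N\<close> N0 by simp
  then obtain n where n: "real ?N ^ d * real C < (real c / real ?N) ^ n" using real_arch_pow by blast
  have "real (c ^ n) \<le> real (?N ^ (d + n) * C)" using bound[of n] by (simp only: of_nat_le_iff)
  then have "real c ^ n \<le> (real ?N ^ d * real C) * real ?N ^ n" by (simp add: power_add mult_ac)
  then have "(real c / real ?N) ^ n \<le> real ?N ^ d * real C"
    using N0 by (simp add: power_divide pos_divide_le_eq)
  then show False using n by simp
qed

end

subsection \<open>Generated number fields\<close>

definition rpoly :: "(nat \<Rightarrow> rat) \<Rightarrow> nat \<Rightarrow> complex poly" where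
  "rpoly q n = (\<Sum>i<n. monom (of_rat (q i)) i)"

lemma coeff_rpoly: "coeff (rpoly q n) i = (if i < n then of_rat (q i) else 0)"
proof -
  have "coeff (rpoly q n) i = (\<Sum>k<n. if k = i then of_rat (q k) else 0)"
    unfolding rpoly_def coeff_sum coeff_monom by (rule sum.cong[OF refl]) simp
  then show ?thesis by simp
qed

lemma poly_rpoly: "poly (rpoly q n) z = (\<Sum>i<n. of_rat (q i) * z ^ i)"
  by (simp add: rpoly_def poly_sum poly_monom)

lemma rpoly_Rats: "rpoly q n \<in> polys_over \<rat>"
  by (simp add: polys_over_def coeff_rpoly)

lemma subfield_csubfield:
  assumes "csubfield F"
  shows "subfield F complex_field"
proof -
  interpret F: csubfield F by fact
  interpret C: field complex_field by (rule field_from_type_algebra)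
  have minus: "\<ominus>\<^bsub>complex_field\<^esub> x = - x" for x :: complex
    by (rule C.minus_equality) (auto simp: ring_of_type_algebra_def)
  have inv: "inv\<^bsub>complex_field\<^esub> x = inverse x" if "x \<noteq> 0" for x :: complex
    by (rule C.comm_inv_char) (use that in \<open>auto simp: ring_of_type_algebra_def\<close>)
  have "subring F complex_field"
    by (rule C.subringI) (simp_all add: minus F.neg, simp_all add: ring_of_type_algebra_def F.one F.mult F.add)
  then show ?thesis
    by (rule C.subfieldI') (simp add: ring_of_type_algebra_def inv[unfolded ring_of_type_algebra_def] F.inv)
qed

locale algebraic_number =
  fixes x :: complex
  assumes alg: "algebraic x"
begin

sublocale Q: csubfield \<rat> by (rule csubfield_Rats)

sublocale A: csubfield "adj x" by (rule csubfield_adj[OF alg])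

abbreviation "d \<equiv> degree (minp \<rat> x)"

lemma generate_field_eq_adj: "generate_field complex_field {x} = adj x"
proof
  interpret C: field complex_field by (rule field_from_type_algebra)
  have c: "{x} \<subseteq> carrier complex_field" by (simp add: ring_of_type_algebra_def)
  show "generate_field complex_field {x} \<subseteq> adj x"
    by (rule C.generate_field_min_subfield1[OF c subfield_csubfield[OF A.csubfield_axioms]]) (simp add: adj_self)
  show "adj x \<subseteq> generate_field complex_field {x}"
    by (rule adj_subset[OF csubfield_subfield[OF C.generate_field_is_subfield[OF c]]]) (simp add: generate_field.incl)
qed

lemma adj_coords:
  assumes "z \<in> adj x"
  shows "\<exists>q. z = (\<Sum>i<d. of_rat (q i) * x ^ i)"
proof -
  obtain p where p: "p \<in> polys_over \<rat>" "z = poly p x" using assms by (auto simp: adj_def)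
  obtain s r where r: "r \<in> polys_over \<rat>" "p = s * minp \<rat> x + r" "r = 0 \<or> degree r < d"
    using Q.polys_division[OF Q.minp_poly[OF alg] Q.minp_nz[OF alg] p(1)] by (elim bexE conjE)
  have dr: "degree r < d" using r(3) Q.degree_minp_pos[OF alg] by auto
  have "coeff r i \<in> \<rat>" for i using r(1) by (simp add: polys_over_def)
  then obtain q where q: "r = map_poly of_rat q" by (rule ratpolyE)
  have "coeff r i = coeff (rpoly (coeff q) d) i" for i
    using coeff_eq_0[of r i] dr by (cases "i < d") (simp_all add: coeff_rpoly q coeff_map_poly)
  then have "r = rpoly (coeff q) d" by (rule poly_eqI)
  then have "z = poly (rpoly (coeff q) d) x" using p(2) r(2) Q.minp_root[OF alg] by simp
  then show ?thesis unfolding poly_rpoly by (intro exI[of _ "coeff q"])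
qed

lemma conjs_poly_subset:
  assumes p: "p \<in> polys_over \<rat>"
  shows "conjs \<rat> (poly p x) \<subseteq> poly p ` conjs \<rat> x"
proof -
  obtain L G where LG: "galois L G" "{x} \<subseteq> L"
    using galois_exists[of "{x}"] alg by (auto simp: Qbar_def)
  interpret L: galois L G by fact
  have xL: "x \<in> L" by (rule subsetD[OF LG(2)]) (rule singletonI)
  have pL: "p \<in> polys_over L" by (rule subsetD[OF polys_over_mono[OF L.Rats_subset] p])
  have g: "g (poly p x) = poly p (g x)" if "g \<in> G" for g
  proof -
    have "g (coeff p i) = coeff p i" for i
    proof -
      have "coeff p i \<in> \<rat>" using p by (simp add: polys_over_def)
      then show ?thesis using L.stab_fix[of g \<rat>] that L.Rats_subset by (auto simp: L.stab_Rats)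
    qed
    then show ?thesis unfolding L.hom_poly[OF that pL xL] by (simp only: poly_altdef)
  qed
  have "conjs \<rat> (poly p x) = (\<lambda>g. g (poly p x)) ` G"
    using L.orbit_eq_conjs[OF csubfield_Rats L.poly_in[OF pL xL]] by (simp only: L.stab_Rats)
  also have "\<dots> = (\<lambda>g. poly p (g x)) ` G" by (rule image_cong[OF refl g])
  also have "\<dots> = poly p ` (\<lambda>g. g x) ` G" by (simp only: image_image)
  also have "(\<lambda>g. g x) ` G = conjs \<rat> x"
    using L.orbit_eq_conjs[OF csubfield_Rats xL] by (simp only: L.stab_Rats)
  finally show ?thesis by simp
qed

lemma algebraic_int_comb:
  assumes k: "algebraic_int (of_nat k * x)"
  shows "algebraic_int (of_nat k ^ d * (\<Sum>i<d. of_int (a i) * x ^ i))"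
proof -
  have "of_nat k ^ d * (\<Sum>i<d. of_int (a i) * x ^ i) = (\<Sum>i<d. of_int (a i) * (of_nat k ^ (d - i) * (of_nat k * x) ^ i))"
    unfolding sum_distrib_left
  proof (rule sum.cong[OF refl])
    fix i assume "i \<in> {..<d}"
    then have "of_nat k ^ d = (of_nat k ^ (d - i) * of_nat k ^ i :: complex)" by (simp flip: power_add)
    then show "of_nat k ^ d * (of_int (a i) * x ^ i) = of_int (a i) * (of_nat k ^ (d - i) * (of_nat k * x) ^ i)"
      by (simp only: power_mult_distrib) (simp only: mult_ac)
  qed
  also have "algebraic_int \<dots>"
    by (intro algebraic_int_sum algebraic_int_times[OF _ algebraic_int_times[OF _ algebraic_int_power[OF k]]] algebraic_int_power)
      simp_all
  finally show ?thesis .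
qed

text \<open>
  Reducing the coordinates of an algebraic integer modulo \<open>M\<close> leaves, up to the fixed factor \<open>k\<^sup>d\<close>, an
  algebraic integer all of whose conjugates are bounded; there are only finitely many of these.
\<close>

lemma covered_powers:
  assumes M: "M > 0"
  shows "\<exists>n. covered {y \<in> adj x. algebraic_int y}
    {of_nat M * (\<Sum>i<d. of_int (a i) * x ^ i) | a :: nat \<Rightarrow> int. True} n"
proof -
  let ?R = "{y \<in> adj x. algebraic_int y}"
  obtain k :: nat where k: "k > 0" "algebraic_int (of_nat k * x)" using algebraic_int_multiple[OF alg] by blast
  have "\<forall>z\<in>?R. \<exists>q. z = (\<Sum>i<d. of_rat (q i) * x ^ i)" using adj_coords by simp
  from bchoice[OF this] obtain q where q: "\<And>z. z \<in> ?R \<Longrightarrow> z = (\<Sum>i<d. of_rat (q z i) * x ^ i)" by blast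
  \<comment> \<open>Division of the coordinates by \<open>M\<close> with remainder:
    \<open>fr\<close> lies between \<open>0\<close> and \<open>M\<close> however large
    \<open>z\<close> is.\<close>
  define fl where "fl z i = \<lfloor>q z i / of_nat M\<rfloor>" for z i
  define fr where "fr z i = q z i - of_nat M * of_int (fl z i)" for z i
  define f where "f z = poly (rpoly (\<lambda>i. of_nat k ^ d * fr z i) d) x" for z
  have fr: "0 \<le> fr z i" "fr z i \<le> of_nat M" for z i
  proof -
    have "of_int (fl z i) \<le> q z i / of_nat M" "q z i / of_nat M \<le> of_int (fl z i) + 1"
      unfolding fl_def by linarith+
    then have "of_int (fl z i) * of_nat M \<le> q z i" "q z i \<le> (of_int (fl z i) + 1) * of_nat M"
      using M by (simp_all add: pos_le_divide_eq pos_divide_le_eq)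
    then show "0 \<le> fr z i" "fr z i \<le> of_nat M" by (simp_all add: fr_def algebra_simps)
  qed
  have f: "f z = of_nat k ^ d * (z - of_nat M * (\<Sum>i<d. of_int (fl z i) * x ^ i))" if z: "z \<in> ?R" for z
  proof -
    have "f z = of_nat k ^ d * (\<Sum>i<d. of_rat (fr z i) * x ^ i)"
      unfolding f_def poly_rpoly sum_distrib_left by (simp add: of_rat_mult of_rat_power mult.assoc)
    also have "(\<Sum>i<d. of_rat (fr z i) * x ^ i)
        = (\<Sum>i<d. of_rat (q z i) * x ^ i) - of_nat M * (\<Sum>i<d. of_int (fl z i) * x ^ i)"
      unfolding sum_distrib_left sum_subtractf[symmetric]
      by (rule sum.cong[OF refl]) (simp add: fr_def of_rat_diff of_rat_mult left_diff_distrib)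
    finally show ?thesis using q[OF z] by simp
  qed
  let ?B = "\<Sum>y\<in>conjs \<rat> x. \<Sum>i<d. real k ^ d * real M * norm y ^ i"
  let ?Z = "{z. algebraic_int z \<and> card (conjs \<rat> z) \<le> d \<and> (\<forall>y\<in>conjs \<rat> z. norm y \<le> ?B)}"
  have sub: "f ` ?R \<subseteq> ?Z"
  proof (rule image_subsetI)
    fix z assume z: "z \<in> ?R"
    let ?p = "rpoly (\<lambda>i. of_nat k ^ d * fr z i) d"
    have c: "conjs \<rat> (f z) \<subseteq> poly ?p ` conjs \<rat> x"
      unfolding f_def by (rule conjs_poly_subset[OF rpoly_Rats])
    note fc = Q.finite_conjs[OF alg]
    have "card (conjs \<rat> (f z)) \<le> card (poly ?p ` conjs \<rat> x)" by (rule card_mono[OF finite_imageI[OF fc] c])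
    also have "\<dots> \<le> d" unfolding Q.degree_minp[OF alg] by (rule card_image_le[OF fc])
    finally have 1: "card (conjs \<rat> (f z)) \<le> d" .
    have "f z = of_nat k ^ d * z - of_nat M * (of_nat k ^ d * (\<Sum>i<d. of_int (fl z i) * x ^ i))"
      unfolding f[OF z] by (simp add: algebra_simps)
    moreover have "algebraic_int (of_nat k ^ d * z)" using z by (intro algebraic_int_times algebraic_int_power) simp_all
    moreover have "algebraic_int (of_nat M * (of_nat k ^ d * (\<Sum>i<d. of_int (fl z i) * x ^ i)))"
      by (rule algebraic_int_times[OF _ algebraic_int_comb[OF k(2)]]) simp
    ultimately have 2: "algebraic_int (f z)" by (simp only: algebraic_int_diff)
    have 3: "norm y \<le> ?B" if y: "y \<in> conjs \<rat> (f z)" for y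
    proof -
      obtain \<eta> where \<eta>: "\<eta> \<in> conjs \<rat> x" "y = poly ?p \<eta>" using subsetD[OF c y] by (elim imageE)
      have "norm y \<le> (\<Sum>i<d. norm (of_rat (of_nat k ^ d * fr z i) * \<eta> ^ i))"
        unfolding \<eta>(2) poly_rpoly by (rule norm_sum)
      also have "\<dots> \<le> (\<Sum>i<d. real k ^ d * real M * norm \<eta> ^ i)"
      proof (rule sum_mono)
        fix i
        have "norm (of_rat (of_nat k ^ d * fr z i) :: complex) = real_of_rat (of_nat k ^ d * fr z i)"
        proof -
          have "(of_rat r :: complex) = of_real (real_of_rat r)" for r
            by (cases r) (simp add: of_rat_rat)
          then have "norm (of_rat (of_nat k ^ d * fr z i) :: complex) = \<bar>real_of_rat (of_nat k ^ d * fr z i)\<bar>"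
            by (simp only: norm_of_real)
          then show ?thesis using fr(1)[of z i] by (simp add: of_rat_mult of_rat_power)
        qed
        also have "\<dots> \<le> real k ^ d * real M"
        proof -
          have "real_of_rat (fr z i) \<le> real_of_rat (of_nat M)" using fr(2)[of z i] by (simp only: of_rat_less_eq)
          then show ?thesis by (simp add: of_rat_mult of_rat_power mult_left_mono)
        qed
        finally show "norm (of_rat (of_nat k ^ d * fr z i) * \<eta> ^ i) \<le> real k ^ d * real M * norm \<eta> ^ i"
          unfolding norm_mult norm_power by (rule mult_right_mono) simp
      qed
      also have "\<dots> \<le> ?B"
        by (rule member_le_sum[OF \<eta>(1) _ fc]) (simp add: sum_nonneg)
      finally show ?thesis .
    qed
    show "f z \<in> ?Z" using 1 2 3 by simp
  qed
  have fin: "finite (f ` ?R)" by (rule finite_subset[OF sub finite_bounded_algebraic_ints])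
  have "covered ?R {of_nat M * (\<Sum>i<d. of_int (a i) * x ^ i) | a :: nat \<Rightarrow> int. True} (card (f ` ?R))"
  proof (rule coveredI[OF fin order_refl])
    fix u v assume uv: "u \<in> ?R" "v \<in> ?R" "f u = f v"
    have "u - of_nat M * (\<Sum>i<d. of_int (fl u i) * x ^ i) = v - of_nat M * (\<Sum>i<d. of_int (fl v i) * x ^ i)"
      using uv(3) k(1) unfolding f[OF uv(1)] f[OF uv(2)] by simp
    then have "u - v = of_nat M * (\<Sum>i<d. of_int (fl u i - fl v i) * x ^ i)"
      by (simp add: left_diff_distrib sum_subtractf right_diff_distrib algebra_simps)
    then show "u - v \<in> {of_nat M * (\<Sum>i<d. of_int (a i) * x ^ i) | a :: nat \<Rightarrow> int. True}"
      by (intro CollectI exI[of _ "\<lambda>i. fl u i - fl v i"]) simp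
  qed
  then show ?thesis by (rule exI)
qed

text \<open>For finiteness modulo \<open>m\<close> the coordinates are reduced modulo
  \<open>m * k ^ d\<close>: the factor \<open>k ^ d\<close> makes the integer combinations of powers
  of \<open>x\<close> integral, so that the differences are multiples of \<open>m\<close> in the
  ring of integers.\<close>

lemma number_field_adj: "number_field (adj x) {y \<in> adj x. algebraic_int y}"
proof
  show "\<exists>m>0. of_nat m * y \<in> {y \<in> adj x. algebraic_int y}" if y: "y \<in> adj x" for y
  proof -
    obtain m :: nat where "m > 0" "algebraic_int (of_nat m * y)"
      using algebraic_int_multiple[OF adj_algebraic[OF alg y]] by blast
    then show ?thesis using A.mult[OF A.of_nat y] by (intro exI[of _ m]) simp
  qed
  fix m :: nat assume m: "m > 0"
  obtain k :: nat where k: "k > 0" "algebraic_int (of_nat k * x)" using algebraic_int_multiple[OF alg] by blast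
  obtain n where n: "covered {y \<in> adj x. algebraic_int y}
      {of_nat (m * k ^ d) * (\<Sum>i<d. of_int (a i) * x ^ i) | a :: nat \<Rightarrow> int. True} n"
    using covered_powers[of "m * k ^ d"] m k(1) by auto
  have "{of_nat (m * k ^ d) * (\<Sum>i<d. of_int (a i) * x ^ i) | a :: nat \<Rightarrow> int. True}
      \<subseteq> (\<lambda>r. of_nat m * r) ` {y \<in> adj x. algebraic_int y}"
  proof
    fix z assume "z \<in> {of_nat (m * k ^ d) * (\<Sum>i<d. of_int (a i) * x ^ i) | a :: nat \<Rightarrow> int. True}"
    then obtain a :: "nat \<Rightarrow> int" where "z = of_nat (m * k ^ d) * (\<Sum>i<d. of_int (a i) * x ^ i)" by (elim CollectE exE conjE)
    then have z: "z = of_nat m * (of_nat k ^ d * (\<Sum>i<d. of_int (a i) * x ^ i))" by (simp add: mult.assoc)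
    have "of_nat k ^ d * (\<Sum>i<d. of_int (a i) * x ^ i) \<in> adj x"
      by (intro A.mult A.sum A.power A.of_nat A.of_int adj_self)
    then show "z \<in> (\<lambda>r. of_nat m * r) ` {y \<in> adj x. algebraic_int y}"
      unfolding z using algebraic_int_comb[OF k(2)] by (intro imageI CollectI conjI)
  qed
  then show "\<exists>n. covered {y \<in> adj x. algebraic_int y} ((\<lambda>r. of_nat m * r) ` {y \<in> adj x. algebraic_int y}) n"
    by (intro exI[of _ n] covered_mono[OF n order_refl])
qed (rule refl)

text \<open>Each \<open>x ^ m\<close> with \<open>m < d\<close> is outside the span of the earlier
  powers by minimality of the degree, hence raises the dimension by one; by division with remainder
  the first \<open>d\<close> powers span.\<close>

lemma dim_adj: "ring.dim complex_field \<rat> (adj x) = d"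
proof -
  interpret C: field complex_field by (rule field_from_type_algebra)
  let ?V = "\<lambda>m. {\<Sum>i<m. of_rat (q i) * x ^ i | q :: nat \<Rightarrow> rat. True}"
  have dim: "ring.dimension complex_field m \<rat> (?V m)" if "m \<le> d" for m
    using that
  proof (induction m)
    case 0
    have "?V 0 = {\<zero>\<^bsub>complex_field\<^esub>}" by (simp add: ring_of_type_algebra_def)
    then show ?case using C.zero_dim by (simp only:)
  next
    case (Suc m)
    have "x ^ m \<notin> ?V m"
    proof
      assume "x ^ m \<in> ?V m"
      then obtain q where q: "x ^ m = (\<Sum>i<m. of_rat (q i) * x ^ i)" by (elim CollectE exE conjE)
      let ?p = "monom 1 m - rpoly q m"
      have "coeff ?p m = 1" by (simp add: coeff_rpoly)
      then have "?p \<noteq> 0" by (metis coeff_0 zero_neq_one)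
      moreover have "?p \<in> polys_over \<rat>" by (rule Q.polys_diff[OF Q.polys_monom[OF Q.one] rpoly_Rats])
      moreover have "poly ?p x = 0" unfolding poly_diff poly_rpoly poly_monom using q by simp
      ultimately have "d \<le> degree ?p" by (intro Q.minp_least[OF alg])
      also have "\<dots> \<le> m" by (rule degree_le) (simp add: coeff_rpoly)
      finally show False using Suc.prems by simp
    qed
    moreover have "?V (Suc m) = C.line_extension \<rat> (x ^ m) (?V m)"
    proof (rule Set.set_eqI)
      fix u
      have "u \<in> C.line_extension \<rat> (x ^ m) (?V m) \<longleftrightarrow> (\<exists>k\<in>\<rat>. \<exists>v\<in>?V m. u = k * x ^ m + v)"
        unfolding C.line_extension_mem_iff by (simp add: ring_of_type_algebra_def)
      also have "\<dots> \<longleftrightarrow> u \<in> ?V (Suc m)"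
      proof
        assume "\<exists>k\<in>\<rat>. \<exists>v\<in>?V m. u = k * x ^ m + v"
        then obtain k q where kq: "k \<in> \<rat>" "u = k * x ^ m + (\<Sum>i<m. of_rat (q i) * x ^ i)" by auto
        obtain k' where k': "k = of_rat k'" using kq(1) by (rule Rats_cases)
        have "(\<Sum>i<m. of_rat ((q(m := k')) i) * x ^ i) = (\<Sum>i<m. of_rat (q i) * x ^ i)"
          by (rule sum.cong[OF refl]) simp
        then have "u = (\<Sum>i<Suc m. of_rat ((q(m := k')) i) * x ^ i)" using kq(2) k' by simp
        then show "u \<in> ?V (Suc m)" by (intro CollectI exI[of _ "q(m := k')"]) simp
      next
        assume "u \<in> ?V (Suc m)"
        then obtain q :: "nat \<Rightarrow> rat" where "u = (\<Sum>i<Suc m. of_rat (q i) * x ^ i)" by (elim CollectE exE conjE)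
        then have "u = of_rat (q m) * x ^ m + (\<Sum>i<m. of_rat (q i) * x ^ i)" by simp
        then show "\<exists>k\<in>\<rat>. \<exists>v\<in>?V m. u = k * x ^ m + v"
          by (intro bexI[of _ "of_rat (q m)"] bexI[of _ "\<Sum>i<m. of_rat (q i) * x ^ i"]) auto
      qed
      finally show "u \<in> ?V (Suc m) \<longleftrightarrow> u \<in> C.line_extension \<rat> (x ^ m) (?V m)" by simp
    qed
    moreover have "x ^ m \<in> carrier complex_field" by (simp add: ring_of_type_algebra_def)
    ultimately show ?case using C.Suc_dim[of "x ^ m" "?V m" m \<rat>] Suc by simp
  qed
  have "?V d = adj x"
  proof
    show "?V d \<subseteq> adj x"
    proof
      fix z assume "z \<in> ?V d"
      then obtain q :: "nat \<Rightarrow> rat" where "z = (\<Sum>i<d. of_rat (q i) * x ^ i)" by (elim CollectE exE conjE)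
      then have "z = poly (rpoly q d) x" by (simp only: poly_rpoly)
      then show "z \<in> adj x" unfolding adj_def by (rule image_eqI) (rule rpoly_Rats)
    qed
    show "adj x \<subseteq> ?V d" using adj_coords by blast
  qed
  then have "C.dimension d \<rat> (adj x)" using dim[of d] by simp
  from C.dimI[OF subfield_csubfield[OF csubfield_Rats] this] show ?thesis by (simp add: over_def)
qed

text \<open>An embedding fixes the rationals, so it is determined by its value at \<open>x\<close>,
  a root of the minimal polynomial; \<open>aut\<close> realizes every root.\<close>

lemma embeddings_bij: "bij_betw (\<lambda>\<sigma>. \<sigma> x) (embeddings (adj x)) (conjs \<rat> x)"
proof -
  have hom: "\<sigma> (poly p x) = poly p (\<sigma> x)" if \<sigma>: "\<sigma> \<in> embeddings (adj x)" and p: "p \<in> polys_over \<rat>" for \<sigma> p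
  proof -
    have h: "\<sigma> \<in> Ring.ring_hom (subring_of_complex (adj x)) complex_field" using \<sigma> by (simp add: embeddings_def)
    have add: "\<sigma> (a + b) = \<sigma> a + \<sigma> b" and mult: "\<sigma> (a * b) = \<sigma> a * \<sigma> b" if "a \<in> adj x" "b \<in> adj x" for a b
      using Ring.ring_hom_add[OF h] Ring.ring_hom_mult[OF h] that by (simp_all add: ring_of_type_algebra_def)
    have one: "\<sigma> 1 = 1" using Ring.ring_hom_one[OF h] by (simp add: ring_of_type_algebra_def)
    have zero: "\<sigma> 0 = 0" using add[OF A.zero A.zero] by simp
    have nat: "\<sigma> (of_nat n) = of_nat n" for n
      by (induction n) (simp_all add: zero one add[OF A.one A.of_nat])
    have rat: "\<sigma> c = c" if c: "c \<in> \<rat>" for c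
    proof -
      obtain a b :: int where ab: "b > 0" "c = of_int a / of_int b" using c by (rule Rats_cases')
      have cA: "c \<in> adj x" by (rule subsetD[OF A.Rats_subset c])
      \<comment> \<open>The equation \<open>c * b = a\<close> is rearranged so that only sums and
        products with natural numbers occur, which \<sigma> is already known to respect.\<close>
      have "c * of_nat (nat b) = of_int a" using ab by simp
      moreover have "of_int a + of_nat (nat (- a)) = (of_nat (nat a) :: complex)" by (cases "a \<ge> 0") simp_all
      ultimately have e: "c * of_nat (nat b) + of_nat (nat (- a)) = of_nat (nat a)" by simp
      have "\<sigma> (c * of_nat (nat b) + of_nat (nat (- a))) = \<sigma> c * of_nat (nat b) + of_nat (nat (- a))"
        by (simp only: add[OF A.mult[OF cA A.of_nat] A.of_nat] mult[OF cA A.of_nat] nat)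
      then have "\<sigma> c * of_nat (nat b) + of_nat (nat (- a)) = c * of_nat (nat b) + of_nat (nat (- a))"
        unfolding e nat by simp
      then show ?thesis using ab(1) by simp
    qed
    show ?thesis using p
    proof (induction p)
      case 0 then show ?case by (simp add: zero)
    next
      case (pCons c p)
      have i: "coeff (pCons c p) i \<in> \<rat>" for i using pCons.prems by (simp only: polys_over_def mem_Collect_eq)
      have c: "c \<in> \<rat>" using i[of 0] by (simp only: coeff_pCons_0)
      have p: "p \<in> polys_over \<rat>" unfolding polys_over_def
        by (intro CollectI allI) (rule i[of "Suc _", unfolded coeff_pCons_Suc])
      have pA: "poly p x \<in> adj x" using p by (auto simp: adj_def)
      have "\<sigma> (c + x * poly p x) = \<sigma> c + \<sigma> x * \<sigma> (poly p x)"
        using add[OF subsetD[OF A.Rats_subset c] A.mult[OF adj_self pA]] mult[OF adj_self pA] by simp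
      then show ?case using rat[OF c] pCons.IH[OF p] by simp
    qed
  qed
  have zero: "\<sigma> 0 = 0" if "\<sigma> \<in> embeddings (adj x)" for \<sigma> using hom[OF that Q.polys_0] by simp
  show ?thesis
  proof (rule bij_betw_imageI)
    show "inj_on (\<lambda>\<sigma>. \<sigma> x) (embeddings (adj x))"
    proof (rule inj_onI)
      fix \<sigma> \<tau> assume st: "\<sigma> \<in> embeddings (adj x)" "\<tau> \<in> embeddings (adj x)" "\<sigma> x = \<tau> x"
      have "\<sigma> \<in> extensional (adj x)" "\<tau> \<in> extensional (adj x)" using st by (simp_all add: embeddings_def)
      then show "\<sigma> = \<tau>"
      proof (rule extensionalityI)
        fix z assume "z \<in> adj x"
        then obtain p where "p \<in> polys_over \<rat>" "z = poly p x" by (auto simp: adj_def)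
        then show "\<sigma> z = \<tau> z" using hom[OF st(1)] hom[OF st(2)] st(3) by simp
      qed
    qed
    show "(\<lambda>\<sigma>. \<sigma> x) ` embeddings (adj x) = conjs \<rat> x"
    proof
      show "(\<lambda>\<sigma>. \<sigma> x) ` embeddings (adj x) \<subseteq> conjs \<rat> x"
      proof (rule image_subsetI)
        fix \<sigma> assume s: "\<sigma> \<in> embeddings (adj x)"
        show "\<sigma> x \<in> conjs \<rat> x"
          using hom[OF s Q.minp_poly[OF alg]] zero[OF s] Q.minp_root[OF alg] by (simp add: conjs_def)
      qed
      show "conjs \<rat> x \<subseteq> (\<lambda>\<sigma>. \<sigma> x) ` embeddings (adj x)"
      proof
        fix \<eta> assume \<eta>: "\<eta> \<in> conjs \<rat> x"
        let ?s = "restrict (aut x \<eta>) (adj x)"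
        have "?s \<in> Ring.ring_hom (subring_of_complex (adj x)) complex_field"
          by (rule Ring.ring_hom_memI)
            (simp_all add: ring_of_type_algebra_def A.add A.mult A.one aut_add[OF alg \<eta>] aut_mult[OF alg \<eta>]
              aut_one[OF alg \<eta> A.one A.one])
        then have "?s \<in> embeddings (adj x)" by (simp add: embeddings_def)
        moreover have "\<eta> = ?s x" using aut_self[OF alg \<eta> adj_self adj_self] adj_self[of x] by simp
        ultimately show "\<eta> \<in> (\<lambda>\<sigma>. \<sigma> x) ` embeddings (adj x)"
          by (rule image_eqI[where f = "\<lambda>\<sigma>. \<sigma> x" and x = ?s, rotated])
      qed
    qed
  qed
qed

end

subsection \<open>The primitive minimal polynomial\<close>

lemma map_poly_of_int_mult: "map_poly of_int (p * q) = (map_poly of_int p * map_poly of_int q :: complex poly)"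
  by (rule poly_eqI) (simp add: coeff_map_poly coeff_mult)

lemma map_poly_of_int_smult: "map_poly of_int (smult c q) = (smult (of_int c) (map_poly of_int q) :: complex poly)"
  by (rule poly_eqI) (simp add: coeff_map_poly)

lemma map_poly_of_int_inj:
  assumes "map_poly of_int p = (map_poly of_int q :: complex poly)"
  shows "p = q"
proof (rule poly_eqI)
  fix i show "coeff p i = coeff q i"
    using arg_cong[OF assms, of "\<lambda>r. coeff r i"] by (simp add: coeff_map_poly)
qed

lemma clear_denominators:
  assumes p: "p \<in> polys_over \<rat>"
  shows "\<exists>c>0. \<exists>f. smult (of_nat c) p = map_poly of_int f"
proof -
  have "\<exists>n::nat. n > 0 \<and> of_nat n * coeff p i \<in> \<int>" for i
  proof -
    have "coeff p i \<in> \<rat>" using p by (simp add: polys_over_def)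
    then obtain a b :: int where "b > 0" "coeff p i = of_int a / of_int b" by (rule Rats_cases')
    then show ?thesis by (intro exI[of _ "nat b"]) simp
  qed
  then obtain n :: "nat \<Rightarrow> nat" where n: "\<And>i. n i > 0 \<and> of_nat (n i) * coeff p i \<in> \<int>" by metis
  define c where "c = (\<Prod>i\<le>degree p. n i)"
  have "coeff (smult (of_nat c) p) i \<in> \<int>" for i
  proof (cases "i \<le> degree p")
    case True
    have "c = n i * (\<Prod>j\<in>{..degree p} - {i}. n j)" unfolding c_def using True by (intro prod.remove) simp_all
    then have "coeff (smult (of_nat c) p) i = of_nat (\<Prod>j\<in>{..degree p} - {i}. n j) * (of_nat (n i) * coeff p i)"
      by (simp only: coeff_smult of_nat_mult mult_ac)
    also have "\<dots> \<in> \<int>" by (rule Ints_mult[OF Ints_of_nat conjunct2[OF n]])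
    finally show ?thesis .
  next
    case False
    then show ?thesis by (simp add: coeff_eq_0)
  qed
  then obtain f where "smult (of_nat c) p = map_poly of_int f" by (rule intpolyE)
  moreover have "c > 0" unfolding c_def using n by (intro prod_pos) simp
  ultimately show ?thesis by blast
qed

context algebraic_number
begin

lemma primitive_min_poly:
  "\<exists>f. content f = 1 \<and> lead_coeff f \<noteq> 0 \<and> map_poly of_int f = smult (of_int (lead_coeff f)) (minp \<rat> x)"
proof -
  obtain c f0 where c: "c > 0" "smult (of_nat c) (minp \<rat> x) = map_poly of_int f0"
    using clear_denominators[OF Q.minp_poly[OF alg]] by blast
  have "f0 \<noteq> 0"
  proof
    assume "f0 = 0"
    then have "smult (of_nat c) (minp \<rat> x) = 0" using c(2) by simp
    then show False using c(1) Q.minp_nz[OF alg] by simp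
  qed
  define f where "f = primitive_part f0"
  define m where "m = content f0"
  have m: "m \<noteq> 0" using \<open>f0 \<noteq> 0\<close> by (simp add: m_def)
  have "f0 = smult m f" by (simp add: f_def m_def)
  then have "smult (of_nat c) (minp \<rat> x) = smult (of_int m) (map_poly of_int f)"
    using c(2) by (simp add: map_poly_of_int_smult)
  then have "smult (inverse (of_int m)) (smult (of_nat c) (minp \<rat> x)) = map_poly of_int f" using m by simp
  then have e: "map_poly of_int f = smult (of_nat c / of_int m) (minp \<rat> x)" by (simp add: divide_inverse mult.commute)
  have cm: "of_nat c / of_int m \<noteq> (0 :: complex)" using c(1) m by simp
  have "degree (map_poly of_int f :: complex poly) = degree f" by (rule degree_map_poly) simp
  then have "degree f = d" using cm by (simp add: e)
  then have "of_int (lead_coeff f) = coeff (map_poly of_int f :: complex poly) d" by (simp add: coeff_map_poly)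
  also have "\<dots> = of_nat c / of_int m" unfolding e using Q.minp_monic[OF alg] by simp
  finally have l: "of_int (lead_coeff f) = (of_nat c / of_int m :: complex)" .
  then have "lead_coeff f \<noteq> 0" using cm by (metis of_int_0)
  moreover have "content f = 1" unfolding f_def by (rule content_primitive_part[OF \<open>f0 \<noteq> 0\<close>])
  ultimately show ?thesis using e l by (intro exI[of _ f]) simp
qed

text \<open>Gauss's lemma: being primitive, \<open>f\<close> divides over the integers every integer
  polynomial that it divides over the rationals.\<close>

lemma lead_coeff_dvd:
  assumes f: "content f = 1" "lead_coeff f \<noteq> 0" "map_poly of_int f = smult (of_int (lead_coeff f)) (minp \<rat> x)"
    and q: "poly (map_poly of_int q) x = 0"
  shows "lead_coeff f dvd lead_coeff q"
proof -
  let ?l = "lead_coeff f"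
  have "map_poly of_int q \<in> polys_over \<rat>" by (simp add: polys_over_def coeff_map_poly)
  from Q.minp_dvd[OF alg this q] obtain r where r: "r \<in> polys_over \<rat>" "map_poly of_int q = r * minp \<rat> x" by blast
  obtain e s where e: "e > 0" "smult (of_nat e) r = map_poly of_int s" using clear_denominators[OF r(1)] by blast
  have "map_poly of_int (smult (?l * int e) q) = (map_poly of_int (s * f) :: complex poly)"
    unfolding map_poly_of_int_smult map_poly_of_int_mult f(3) e(2)[symmetric] r(2) by (simp add: mult_ac)
  then have sf: "smult (?l * int e) q = s * f" by (rule map_poly_of_int_inj)
  have "[:?l * int e:] dvd s * f" unfolding sf[symmetric] by (intro dvdI[of _ _ q]) simp
  then have "?l * int e dvd content s" unfolding const_poly_dvd_iff_dvd_content content_mult f(1) by simp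
  then have "[:?l * int e:] dvd s" unfolding const_poly_dvd_iff_dvd_content .
  then obtain t where t: "s = [:?l * int e:] * t" by (elim dvdE)
  have "smult (?l * int e) q = smult (?l * int e) (t * f)" unfolding sf t by simp
  then have "smult (?l * int e) (q - t * f) = 0" by (simp only: smult_diff_right diff_self)
  then have "q = t * f" using f(2) e(1) by (simp only: smult_eq_0_iff) simp
  then show ?thesis by (simp add: lead_coeff_mult)
qed

text \<open>The witnesses are \<open>k = 1\<close> and the absolute value of the leading coefficient
  of the primitive minimal polynomial. Its products with conjugates are integral by
  \<open>algebraic_int_lead_times_roots\<close>, and its logarithm is at most the finite part of the
  height by the counting argument.\<close>

theorem height_le_weil_height:
  assumes nz: "x \<noteq> 0"
  shows "height_le x (weil_height x)"
proof -
  interpret N: number_field "adj x" "{y \<in> adj x. algebraic_int y}" by (rule number_field_adj)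
  obtain f where f: "content f = 1" "lead_coeff f \<noteq> 0" "map_poly of_int f = smult (of_int (lead_coeff f)) (minp \<rat> x)"
    using primitive_min_poly by blast
  define c where "c = nat \<bar>lead_coeff f\<bar>"
  have c: "c > 0" "int c = \<bar>lead_coeff f\<bar>" using f(2) by (simp_all add: c_def)
  obtain C where "covered {y \<in> adj x. algebraic_int y} {of_nat 1 * (\<Sum>i<d. of_int (a i) * x ^ i) | a :: nat \<Rightarrow> int. True} C"
    using covered_powers[of 1] by auto
  then have cov: "covered {y \<in> adj x. algebraic_int y} {\<Sum>i<d. of_int (a i) * x ^ i | a :: nat \<Rightarrow> int. True} C" by simp
  have "c \<le> N.denominator_norm x"
  proof (rule N.leading_coeff_le_denominator_norm[OF adj_self nz c(1) _ cov])
    fix q :: "int poly" assume "poly (map_poly of_int q) x = 0"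
    from lead_coeff_dvd[OF f this] show "int c dvd lead_coeff q" unfolding c(2) by simp
  qed
  then have ln: "ln (real c) \<le> ln (real (N.denominator_norm x))" using c(1) by simp
  have d0: "real d > 0" using Q.degree_minp_pos[OF alg] by simp
  have "weil_height x = ((\<Sum>y\<in>conjs \<rat> x. log_plus (norm y)) + ln (real (N.denominator_norm x))) / real d"
    unfolding weil_height_def generate_field_eq_adj height_in_def dim_adj N.infsum_finite_places[OF adj_self nz]
    using sum.reindex_bij_betw[OF embeddings_bij, of "\<lambda>y. log_plus (norm y)"] by simp
  then have h: "weil_height x * real d = (\<Sum>y\<in>conjs \<rat> x. log_plus (norm y)) + ln (real (N.denominator_norm x))"
    using d0 by simp
  have "algebraic_int (of_nat c * (\<Prod>y\<in>S. y))" if S: "S \<subseteq> conjs \<rat> x" for S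
  proof (rule algebraic_int_lead_times_roots[OF Q.finite_conjs[OF alg] _ S])
    fix i
    have sgn: "of_nat c = (of_int (sgn (lead_coeff f)) * of_int (lead_coeff f) :: complex)"
    proof -
      have "int c = sgn (lead_coeff f) * lead_coeff f" unfolding c(2) by (simp add: abs_sgn mult.commute)
      then have "(of_int (int c) :: complex) = of_int (sgn (lead_coeff f) * lead_coeff f)" by (simp only:)
      then show ?thesis by simp
    qed
    have "smult (of_nat c) (minp \<rat> x) = smult (of_int (sgn (lead_coeff f))) (map_poly of_int f)"
      unfolding f(3) sgn by simp
    then have e: "coeff (smult (of_nat c) (minp \<rat> x)) i = of_int (sgn (lead_coeff f) * coeff f i)"
      by (simp add: coeff_map_poly)
    show "algebraic_int (coeff (smult (of_nat c) (\<Prod>y\<in>conjs \<rat> x. [:- y, 1:])) i)"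
      unfolding Q.minp_eq_prod[OF alg, symmetric] e by (rule int_imp_algebraic_int[OF Ints_of_int])
  qed
  then show ?thesis
    unfolding height_le_def using c(1) ln h Q.degree_minp[OF alg]
    by (intro exI[of _ 1] exI[of _ c]) simp
qed

end

lemma height_le_mono: "height_le x r \<Longrightarrow> r \<le> s \<Longrightarrow> height_le x s"
  unfolding height_le_def by (meson mult_right_mono of_nat_0_le_iff order_trans)

theorem corollary1p4:
  fixes N :: nat and K :: "nat \<Rightarrow> complex set" and \<alpha> :: complex
  assumes "N \<ge> 1"
    and "\<And>n. n \<in> {1..N} \<Longrightarrow> subfield (K n) complex_field \<and> \<rat> \<subseteq> K n \<and> K n \<subseteq> Qbar"
    and "\<And>n1 n2. n1 \<in> {1..N} \<Longrightarrow> n2 \<in> {1..N} \<Longrightarrow> n1 \<noteq> n2 \<Longrightarrow>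
           galois_extension (K n1 \<inter> K n2) (K n1) \<or> galois_extension (K n1 \<inter> K n2) (K n2)"
    and "\<alpha> \<in> Qbar - {0}"
    and "\<And>\<epsilon>::real. \<epsilon> > 0 \<Longrightarrow>
           \<exists>(m::int) \<beta>. m \<noteq> 0 \<and> (\<forall>n\<in>{1..N}. \<beta> n \<in> K n - {0}) \<and>
             weil_height (\<alpha> powi m * (\<Prod>n=1..N. inverse (\<beta> n))) < \<epsilon> * real_of_int \<bar>m\<bar>"
  shows "\<exists>q::int. q \<noteq> 0 \<and> \<alpha> powi q \<in> units_product K N"
proof (rule approximation_theorem)
  have K: "csubfield (K n) \<and> K n \<subseteq> Qbar" if n: "n \<in> {1..N}" for n
    using csubfield_subfield[OF conjunct1[OF assms(2)[OF n]]] conjunct2[OF conjunct2[OF assms(2)[OF n]]] by (rule conjI)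
  show "csubfield (K n) \<and> K n \<subseteq> Qbar" if "n \<in> {1..N}" for n using K[OF that] .
  show "galois_extension (K n1 \<inter> K n2) (K n1) \<or> galois_extension (K n1 \<inter> K n2) (K n2)"
    if "n1 \<in> {1..N}" "n2 \<in> {1..N}" "n1 \<noteq> n2" for n1 n2 by (rule assms(3)[OF that])
  show \<alpha>: "algebraic \<alpha>" "\<alpha> \<noteq> 0" using assms(4) by (simp_all add: Qbar_def)
  fix \<epsilon> :: real assume "\<epsilon> > 0"
  from assms(5)[OF this] obtain m :: int and \<beta> where mb: "m \<noteq> 0" "\<forall>n\<in>{1..N}. \<beta> n \<in> K n - {0}"
    "weil_height (\<alpha> powi m * (\<Prod>n=1..N. inverse (\<beta> n))) < \<epsilon> * real_of_int \<bar>m\<bar>" by (elim exE conjE)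
  let ?x = "\<alpha> powi m * (\<Prod>n=1..N. inverse (\<beta> n))"
  interpret Qb: csubfield Qbar by (rule csubfield_Qbar)
  have \<alpha>Q: "\<alpha> \<in> Qbar" using assms(4) by simp
  have "\<alpha> powi m \<in> Qbar"
    unfolding power_int_def using Qb.power[OF \<alpha>Q] Qb.power[OF Qb.inv[OF \<alpha>Q]] by (simp split: if_split)
  moreover have "(\<Prod>n=1..N. inverse (\<beta> n)) \<in> Qbar"
  proof (rule Qb.prod)
    fix n assume n: "n \<in> {1..N}"
    show "inverse (\<beta> n) \<in> Qbar"
      by (rule Qb.inv[OF subsetD[OF conjunct2[OF K[OF n]] DiffD1[OF bspec[OF mb(2) n]]]])
  qed
  ultimately have "?x \<in> Qbar" by (rule Qb.mult)
  then interpret algebraic_number ?x by unfold_locales (simp only: Qbar_def mem_Collect_eq)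
  have "(\<Prod>n=1..N. inverse (\<beta> n)) \<noteq> 0"
    using mb(2) by (simp add: prod_zero_iff)
  then have "?x \<noteq> 0" using \<open>\<alpha> \<noteq> 0\<close> by simp
  have h: "height_le ?x (\<epsilon> * real_of_int \<bar>m\<bar>)"
    by (rule height_le_mono[OF height_le_weil_height[OF \<open>?x \<noteq> 0\<close>] less_imp_le[OF mb(3)]])
  show "\<exists>(m::int) \<beta>. m \<noteq> 0 \<and> (\<forall>n\<in>{1..N}. \<beta> n \<in> K n - {0}) \<and>
      height_le (\<alpha> powi m * (\<Prod>n=1..N. inverse (\<beta> n))) (\<epsilon> * real_of_int \<bar>m\<bar>)"
    by (rule exI[of _ m], rule exI[of _ \<beta>], rule conjI[OF mb(1) conjI[OF mb(2) h]])
qed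

end
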